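(* Let $m,n\ge 1$. A subset of $H_{mn}$ is multiplicatively quasi-dense if and only if it is nonseparated.
   Context: For integers $m,n\ge 1$, $H_{mn}=\mathbb{R}^{m-1}\times\mathbb{R}\times\mathbb{R}^n$ denotes the simply connected Lie group (with the usual manifold structure) with product $(v,a,\mathbf b)(v',a',\mathbf b')=(v+v',\,a+a',\,\mathbf b+e^{a}\mathbf b')$, where $v,v'\in\mathbb{R}^{m-1}$, $a,a'\in\mathbb{R}$, $\mathbf b,\mathbf b'\in\mathbb{R}^n$. A maximal subsemigroup of a topological group $G$ (always understood: with nonempty interior) is a proper subsemigroup $M$ of $G$ with nonempty interior such that $M$ is not a group and the only subsemigroups of $G$ containing $M$ are $G$ and $M$. A subset $S$ of $G$ is nonseparated if it is not contained in any maximal subsemigroup of $G$. A subset $S$ of a Lie group is multiplicatively quasi-dense if the closure of the semigroup it generates is a group that is not contained in any connected codimension 1 subgroup. *)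

theory Defs
  imports "HOL-Analysis.Analysis" "HOL-Algebra.Group"
begin

section \<open>Topological groups and their subsemigroups\<close>

definition topological_group :: "('a, 'b) monoid_scheme \<Rightarrow> 'a topology \<Rightarrow> bool" where
  "topological_group G X \<longleftrightarrow>
     group G \<and> topspace X = carrier G \<and>
     continuous_map (prod_topology X X) X (\<lambda>(g, h). g \<otimes>\<^bsub>G\<^esub> h) \<and>
     continuous_map X X (\<lambda>g. inv\<^bsub>G\<^esub> g)"

definition subsemigroup :: "'a set \<Rightarrow> ('a, 'b) monoid_scheme \<Rightarrow> bool" where
  "subsemigroup M G \<longleftrightarrow> M \<subseteq> carrier G \<and> (\<forall>g\<in>M. \<forall>h\<in>M. g \<otimes>\<^bsub>G\<^esub> h \<in> M)"

inductive_set semigroup_generated :: "('a, 'b) monoid_scheme \<Rightarrow> 'a set \<Rightarrow> 'a set"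
  for G (structure) and S where
  incl: "g \<in> S \<Longrightarrow> g \<in> semigroup_generated G S"
| mult: "g \<in> semigroup_generated G S \<Longrightarrow> h \<in> semigroup_generated G S \<Longrightarrow>
           g \<otimes> h \<in> semigroup_generated G S"

definition maximal_subsemigroup :: "('a, 'b) monoid_scheme \<Rightarrow> 'a topology \<Rightarrow> 'a set \<Rightarrow> bool" where
  "maximal_subsemigroup G X M \<longleftrightarrow>
     subsemigroup M G \<and> M \<noteq> carrier G \<and> X interior_of M \<noteq> {} \<and> \<not> subgroup M G \<and>
     (\<forall>T. subsemigroup T G \<and> M \<subseteq> T \<longrightarrow> T = M \<or> T = carrier G)"

definition nonseparated :: "('a, 'b) monoid_scheme \<Rightarrow> 'a topology \<Rightarrow> 'a set \<Rightarrow> bool" where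
  "nonseparated G X S \<longleftrightarrow> (\<nexists>M. maximal_subsemigroup G X M \<and> S \<subseteq> M)"


section \<open>Smooth maps on open subsets of Euclidean space\<close>

text \<open>Points of \<^term>\<open>Euclidean_space d\<close> are functions vanishing at all indices \<open>\<ge> d\<close>.\<close>

definition partial_deriv :: "nat \<Rightarrow> ((nat \<Rightarrow> real) \<Rightarrow> real) \<Rightarrow> (nat \<Rightarrow> real) \<Rightarrow> real" where
  "partial_deriv i f p = deriv (\<lambda>t. f (p(i := t))) (p i)"

fun Ck_on :: "nat \<Rightarrow> nat \<Rightarrow> (nat \<Rightarrow> real) set \<Rightarrow> ((nat \<Rightarrow> real) \<Rightarrow> real) \<Rightarrow> bool" where
  "Ck_on d 0 W f \<longleftrightarrow> continuous_map (subtopology (Euclidean_space d) W) euclideanreal f"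
| "Ck_on d (Suc k) W f \<longleftrightarrow>
     continuous_map (subtopology (Euclidean_space d) W) euclideanreal f \<and>
     (\<forall>i<d. (\<forall>p\<in>W. (\<lambda>t. f (p(i := t))) field_differentiable (at (p i))) \<and>
            Ck_on d k W (partial_deriv i f))"

definition smooth_on :: "nat \<Rightarrow> (nat \<Rightarrow> real) set \<Rightarrow> ((nat \<Rightarrow> real) \<Rightarrow> real) \<Rightarrow> bool" where
  "smooth_on d W f \<longleftrightarrow> (\<forall>k. Ck_on d k W f)"


section \<open>Lie subgroups of a Lie group with a global chart\<close>

text \<open>
  The manifold structure of \<open>G\<close> is given by global coordinate functions \<open>x 0, \<dots>, x (N - 1)\<close>, so
  that a map into \<open>G\<close> is smooth iff its compositions with them are.
\<close>

definition smooth_immersion ::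
    "nat \<Rightarrow> (nat \<Rightarrow> 'a \<Rightarrow> real) \<Rightarrow> nat \<Rightarrow> (nat \<Rightarrow> real) set \<Rightarrow> ((nat \<Rightarrow> real) \<Rightarrow> 'a) \<Rightarrow> bool" where
  "smooth_immersion N x d W \<phi> \<longleftrightarrow>
     (\<forall>j<N. smooth_on d W (x j \<circ> \<phi>)) \<and>
     (\<forall>p\<in>W. \<forall>c :: nat \<Rightarrow> real.
        (\<forall>j<N. (\<Sum>i<d. c i * partial_deriv i (x j \<circ> \<phi>) p) = 0) \<longrightarrow> (\<forall>i<d. c i = 0))"

text \<open>
  A connected Lie subgroup is an immersed one: its intrinsic topology \<open>Y\<close> may be finer than the
  subspace topology, and its dimension and connectedness refer to \<open>Y\<close>.  Two charts \<open>\<phi>\<close> as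
  below are smoothly compatible, since both are immersions into \<open>G\<close> and homeomorphisms onto
  \<open>Y\<close>-open sets; for the same reason the group operations are smooth.  Second countability of \<open>Y\<close>
  follows from connectedness.
\<close>

definition connected_lie_subgroup ::
    "('a, 'b) monoid_scheme \<Rightarrow> nat \<Rightarrow> (nat \<Rightarrow> 'a \<Rightarrow> real) \<Rightarrow> nat \<Rightarrow> 'a set \<Rightarrow> bool" where
  "connected_lie_subgroup G N x d L \<longleftrightarrow>
     subgroup L G \<and>
     (\<exists>Y. topological_group (G\<lparr>carrier := L\<rparr>) Y \<and> connected_space Y \<and>
          (\<forall>g\<in>L. \<exists>U W \<phi>. openin Y U \<and> g \<in> U \<and> openin (Euclidean_space d) W \<and>
             homeomorphic_map (subtopology (Euclidean_space d) W) (subtopology Y U) \<phi> \<and>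
             smooth_immersion N x d W \<phi>))"

definition multiplicatively_quasi_dense ::
    "('a, 'b) monoid_scheme \<Rightarrow> 'a topology \<Rightarrow> nat \<Rightarrow> (nat \<Rightarrow> 'a \<Rightarrow> real) \<Rightarrow> 'a set \<Rightarrow> bool" where
  "multiplicatively_quasi_dense G X N x S \<longleftrightarrow>
     subgroup (X closure_of semigroup_generated G S) G \<and>
     (\<nexists>L. connected_lie_subgroup G N x (N - 1) L \<and> X closure_of semigroup_generated G S \<subseteq> L)"


section \<open>The groups \<open>H\<^sub>m\<^sub>n\<close>\<close>

type_synonym H_elt = "(nat \<Rightarrow> real) \<times> real \<times> (nat \<Rightarrow> real)"

definition H_top :: "nat \<Rightarrow> nat \<Rightarrow> H_elt topology" where
  "H_top m n =
     prod_topology (Euclidean_space (m - 1)) (prod_topology euclideanreal (Euclidean_space n))"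

definition H_group :: "nat \<Rightarrow> nat \<Rightarrow> H_elt monoid" where
  "H_group m n =
     \<lparr>carrier = topspace (Euclidean_space (m - 1)) \<times> UNIV \<times> topspace (Euclidean_space n),
      monoid.mult = (\<lambda>(v, a, b) (v', a', b').
        (\<lambda>i. v i + v' i, a + a', \<lambda>i. b i + exp a * b' i)),
      one = (\<lambda>i. 0, 0, \<lambda>i. 0)\<rparr>"

text \<open>The \<open>m + n\<close> coordinates of \<open>(v, a, b)\<close>, in this order.\<close>

definition H_coord :: "nat \<Rightarrow> nat \<Rightarrow> H_elt \<Rightarrow> real" where
  "H_coord m j = (\<lambda>(v, a, b). if j < m - 1 then v j else if j = m - 1 then a else b (j - m))"

lemma group_H_group: "group (H_group m n)"
proof (rule groupI)
  fix g assume "g \<in> carrier (H_group m n)"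
  moreover obtain v a b where "g = (v, a, b)"
    by (cases g)
  ultimately show "\<exists>h\<in>carrier (H_group m n). h \<otimes>\<^bsub>H_group m n\<^esub> g = \<one>\<^bsub>H_group m n\<^esub>"
    by (intro bexI[of _ "(\<lambda>i. - v i, - a, \<lambda>i. - (exp (- a) * b i))"])
      (auto simp: H_group_def topspace_Euclidean_space)
qed (auto simp: H_group_def topspace_Euclidean_space algebra_simps exp_add)

lemma inv_H_group:
  assumes "(v, a, b) \<in> carrier (H_group m n)"
  shows "inv\<^bsub>H_group m n\<^esub> (v, a, b) = (\<lambda>i. - v i, - a, \<lambda>i. - (exp (- a) * b i))"
  using assms
  by (intro group.inv_equality[OF group_H_group]) (auto simp: H_group_def topspace_Euclidean_space)

lemma continuous_map_into_H:
  "continuous_map X (H_top m n) f \<longleftrightarrow>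
     f \<in> topspace X \<rightarrow> carrier (H_group m n) \<and>
     (\<forall>i. continuous_map X euclideanreal (\<lambda>p. fst (f p) i)) \<and>
     continuous_map X euclideanreal (\<lambda>p. fst (snd (f p))) \<and>
     (\<forall>i. continuous_map X euclideanreal (\<lambda>p. snd (snd (f p)) i))"
  unfolding H_top_def H_group_def continuous_map_pairwise o_def Euclidean_space_def
    continuous_map_in_subtopology continuous_map_componentwise_UNIV
  by (fastforce simp: Pi_iff image_subset_iff mem_Times_iff)

lemma topological_group_H: "topological_group (H_group m n) (H_top m n)"
proof -
  let ?P = "prod_topology (H_top m n) (H_top m n)"
  have top: "topspace (H_top m n) = carrier (H_group m n)"
    by (simp add: H_top_def H_group_def)
  have exp: "continuous_map X euclideanreal (\<lambda>p. exp (f p))"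
    if "continuous_map X euclideanreal f" for X :: "'c topology" and f
    using continuous_map_compose[OF that, of euclideanreal exp]
    by (simp add: o_def continuous_on_exp)
  have "continuous_map ?P (H_top m n) fst" "continuous_map ?P (H_top m n) snd"
    by (simp_all add: continuous_map_fst continuous_map_snd)
  then have "continuous_map ?P (H_top m n)
      (\<lambda>p. (\<lambda>i. fst (fst p) i + fst (snd p) i, fst (snd (fst p)) + fst (snd (snd p)),
            \<lambda>i. snd (snd (fst p)) i + exp (fst (snd (fst p))) * snd (snd (snd p)) i))"
    by (auto simp: continuous_map_into_H top H_group_def topspace_Euclidean_space
        intro!: continuous_map_add continuous_map_real_mult exp)
  then have mult: "continuous_map ?P (H_top m n) (\<lambda>(g, h). g \<otimes>\<^bsub>H_group m n\<^esub> h)"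
    by (rule continuous_map_eq) (auto simp: H_group_def)
  have "continuous_map (H_top m n) (H_top m n) (\<lambda>p. p)"
    by simp
  then have "continuous_map (H_top m n) (H_top m n)
      (\<lambda>p. (\<lambda>i. - fst p i, - fst (snd p), \<lambda>i. - (exp (- fst (snd p)) * snd (snd p) i)))"
    unfolding continuous_map_into_H
    by (auto simp: top H_group_def topspace_Euclidean_space
        intro!: continuous_map_minus continuous_map_real_mult exp)
  then have "continuous_map (H_top m n) (H_top m n) (\<lambda>g. inv\<^bsub>H_group m n\<^esub> g)"
    by (rule continuous_map_eq) (auto simp: top inv_H_group)
  with mult top show ?thesis
    by (simp add: topological_group_def group_H_group)
qed

end

theory Submission
  imports Defs "HOL-Homology.Invariance_of_Domain"
begin

text \<open>
  An element \<open>g = (v, a, b)\<close> acts on \<open>\<real>\<^sup>n\<close> by the similarity \<open>x \<mapsto> e\<^sup>a x + b\<close> and has the image \<open>(v, a)\<close>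
  in the abelian quotient \<open>\<real>\<^sup>m\<close>.  The group has two kinds of half-spaces \<open>{F \<ge> 0}\<close>: those pulled back
  from \<open>\<real>\<^sup>m\<close> by a linear form, and those saying that points of an affine hyperplane of \<open>\<real>\<^sup>n\<close> are moved
  to one side of it, so that \<open>F g = \<gamma> \<bullet> b - c (e\<^sup>a - 1)\<close>.  In both cases
  \<open>F (g h) = F g + \<rho> g F h\<close> with \<open>\<rho> > 0\<close>.  Hence a half-space is a subsemigroup, and its boundary
  \<open>{F = 0}\<close> is a subgroup.  The boundary is a graph over the other coordinates, so it is a connected Lie
  subgroup of codimension one.  Moreover half-spaces are maximal
  (\<open>maximal_subsemigroup_half_space\<close>).

  The heart of the matter is that a closed subsemigroup \<open>T\<close> which lies in no half-space is a group
  (\<open>subgroup_if_off_half_spaces\<close>).  As \<open>T\<close> lies in no half-space of the first kind, every finite set of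
  elements of \<open>T\<close> is contained in a finite subset whose images in \<open>\<real>\<^sup>m\<close> have a linear dependence with
  positive coefficients, and by Dirichlet's simultaneous approximation there are words of \<open>T\<close> in which
  every one of these elements occurs arbitrarily often and whose image in \<open>\<real>\<^sup>m\<close> is close to \<open>0\<close>;
  this can be done with elements that have \<open>a \<noteq> 0\<close>, that is, with contractions and expansions.
  Let \<open>p\<close> be an expansion and \<open>q\<close> a contraction in \<open>T\<close>.  Put all expansions of such a word to the right,
  \<open>p\<close> rightmost, and all contractions to the left, \<open>q\<close> leftmost.  The word then sends a point near the
  fixed point \<open>x\<^sub>p\<close> to a point near \<open>x\<^sub>q\<close>, while it is almost a translation; so in the limit the translation
  by \<open>x\<^sub>q - x\<^sub>p\<close> belongs to \<open>T\<close> (\<open>translation_between_fixpoints\<close>).  If all translations in \<open>T\<close> were in a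
  half-space \<open>\<gamma> \<bullet> u \<ge> 0\<close> of \<open>\<real>\<^sup>n\<close>, then \<open>\<gamma> \<bullet> x\<^sub>p \<le> \<gamma> \<bullet> x\<^sub>q\<close> for all such \<open>p\<close> and \<open>q\<close>, and a hyperplane
  that separates the two sets of fixed points would give a half-space of the second kind around \<open>T\<close>.
  Hence the translations in \<open>T\<close> positively span \<open>\<real>\<^sup>n\<close>.  Replacing \<open>q\<close> by \<open>q\<^sup>k \<tau>\<^sub>u q\<^sup>k\<close> moves its fixed
  point by about \<open>e\<^bsup>k a\<^esup> u\<close>, where \<open>a < 0\<close> is the height of \<open>q\<close>, so arbitrarily fine multiples of
  translations can be added to \<open>x\<^sub>q - x\<^sub>p\<close>; therefore \<open>T\<close> contains all translations
  (\<open>all_translations\<close>).  Inverses then come from the same near-dependences, the translation part being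
  corrected at will.

  Two facts connect this with the statement.  A maximal subsemigroup is closed, and it is not a group, so
  it lies in a half-space; if the closure of the semigroup generated by \<open>S\<close> is a group inside it, this
  group lies in the boundary of the half-space, a connected Lie subgroup of codimension one.
  Conversely, a connected Lie subgroup of codimension one lies in a half-space
  (\<open>connected_lie_subgroup_in_half_space\<close>).  For if \<open>\<phi>\<close> and \<open>\<psi>\<close> are charts of \<open>L\<close>, the product of
  \<open>\<phi> p\<close> with a curve in the image of \<open>\<psi>\<close> cannot be locally injective on \<open>\<real>\<^bsup>m+n\<^esup>\<close>, because it takes
  values in a manifold of dimension \<open>m + n - 1\<close>.  So left and right translates of tangent hyperplanes
  of \<open>L\<close> agree.  A covector that annihilates the tangent space at the identity therefore
  annihilates, suitably transported, every tangent space of \<open>L\<close>, and comparing the left and the right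
  transport shows that \<open>L\<close> lies in the zero set of an \<open>F\<close> as above.
\<close>

(* Its arrow would make every tendsto below ambiguous. *)
no_notation exact_seq_arrow
  (\<open>(\<open>indent=3 notation=\<open>mixfix exact_seq\<close>\<close>_ / \<longlongrightarrow>\<index> _)\<close> [1000, 60])

(* As a rewrite rule for finite sets it sends the simplifier into a loop. *)
declare card_of_ordIso_finite [simp del]

section \<open>Finite linear systems\<close>

text \<open>
  Gaussian elimination of the last unknown.  The equations are indexed by an arbitrary finite set, so
  that the pivot equation can be removed without renumbering.
\<close>

lemma homogeneous_system_solution:
  fixes a :: "'e \<Rightarrow> nat \<Rightarrow> real"
  assumes "finite E" and "card E < N"
  shows "\<exists>c. (\<exists>j<N. c j \<noteq> 0) \<and> (\<forall>e\<in>E. (\<Sum>j<N. c j * a e j) = 0)"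
  using assms
proof (induction N arbitrary: E a)
  case 0
  then show ?case by simp
next
  case (Suc M)
  show ?case
  proof (cases "\<forall>e\<in>E. a e M = 0")
    case True
    then show ?thesis
      by (intro exI[of _ "\<lambda>j. if j = M then 1 else 0"]) auto
  next
    case False
    then obtain e0 where e0: "e0 \<in> E" "a e0 M \<noteq> 0" by blast
    define a' where "a' e j = a e j - a e M / a e0 M * a e0 j" for e j
    have "card (E - {e0}) < M" using Suc.prems card_Diff1_less[OF _ e0(1)] by linarith
    then obtain c' where c': "\<exists>j<M. c' j \<noteq> 0" "\<forall>e\<in>E - {e0}. (\<Sum>j<M. c' j * a' e j) = 0"
      using Suc.IH[of "E - {e0}" a'] Suc.prems by auto
    define s where "s = (\<Sum>j<M. c' j * a e0 j)"
    define c where "c = c'(M := - s / a e0 M)"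
    have sum: "(\<Sum>j<Suc M. c j * a e j) = (\<Sum>j<M. c' j * a e j) - s / a e0 M * a e M" for e
      by (simp add: c_def)
    have "(\<Sum>j<Suc M. c j * a e j) = 0" if "e \<in> E" for e
    proof (cases "e = e0")
      case True
      then show ?thesis using e0 by (simp only: sum) (simp add: s_def)
    next
      case False
      then have "0 = (\<Sum>j<M. c' j * a' e j)" using c' that by simp
      also have "\<dots> = (\<Sum>j<M. c' j * a e j) - a e M / a e0 M * s"
        by (simp add: a'_def s_def algebra_simps sum_subtractf sum_distrib_left sum_divide_distrib)
      finally show ?thesis by (simp only: sum) (simp add: algebra_simps)
    qed
    moreover have "\<exists>j<Suc M. c j \<noteq> 0" using c'(1) by (auto simp: c_def intro!: exI[where P="\<lambda>j. j < Suc M \<and> _ j"])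
    ultimately show ?thesis by blast
  qed
qed

text \<open>
  If \<open>w = u - s l\<close> were nonzero, with \<open>s\<close> chosen to make its entry at \<open>j\<^sub>0\<close> vanish, then some nontrivial
  combination \<open>y\<close> of the \<open>d\<close> vectors would vanish in all coordinates except \<open>j\<^sub>0\<close> and one \<open>j\<close> with
  \<open>w j \<noteq> 0\<close>.  Orthogonality to \<open>w\<close> and then to \<open>l\<close> kills these two entries as well.
\<close>

lemma annihilator_unique:
  fixes x :: "nat \<Rightarrow> nat \<Rightarrow> real"
  assumes N: "N = Suc d" and indep: "\<And>c. (\<And>j. j < N \<Longrightarrow> (\<Sum>i<d. c i * x i j) = 0) \<Longrightarrow> (\<And>i. i < d \<Longrightarrow> c i = 0)"
    and l: "\<And>i. i < d \<Longrightarrow> (\<Sum>j<N. l j * x i j) = 0" and nz: "\<exists>j<N. l j \<noteq> 0"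
    and u: "\<And>i. i < d \<Longrightarrow> (\<Sum>j<N. u j * x i j) = 0"
  shows "\<exists>s. \<forall>j<N. u j = s * l j"
proof -
  obtain j0 where j0: "j0 < N" "l j0 \<noteq> 0" using nz by blast
  define s where "s = u j0 / l j0"
  define w where "w j = u j - s * l j" for j
  have "w j = 0" if "j < N" for j
  proof (rule ccontr)
    assume wj: "w j \<noteq> 0"
    have w0: "w j0 = 0" using j0 by (simp add: w_def s_def)
    with wj have ne: "j \<noteq> j0" by auto
    let ?E = "{..<N} - {j0, j}"
    have "card ?E < d" using N j0 that ne by (simp add: card_Diff_subset)
    from homogeneous_system_solution[OF _ this, of "\<lambda>j i. x i j"]
    obtain c where c: "\<exists>i<d. c i \<noteq> 0" "\<And>j. j \<in> ?E \<Longrightarrow> (\<Sum>i<d. c i * x i j) = 0" by auto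
    define y where "y j = (\<Sum>i<d. c i * x i j)" for j
    have orth: "(\<Sum>j<N. g j * y j) = 0" if "\<And>i. i < d \<Longrightarrow> (\<Sum>j<N. g j * x i j) = 0" for g
    proof -
      have "(\<Sum>j<N. g j * y j) = (\<Sum>i<d. c i * (\<Sum>j<N. g j * x i j))"
        unfolding y_def sum_distrib_left by (subst sum.swap) (simp add: algebra_simps)
      then show ?thesis using that by simp
    qed
    have split: "(\<Sum>j<N. g j * y j) = g j0 * y j0 + g j * y j" for g
    proof -
      have "(\<Sum>j<N. g j * y j) = (\<Sum>j\<in>{j0,j}. g j * y j)"
        using j0 that c(2) by (intro sum.mono_neutral_right) (auto simp: y_def)
      then show ?thesis using ne by simp
    qed
    have "(\<Sum>j<N. w j * x i j) = 0" if "i < d" for i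
      using l[OF that] u[OF that]
      by (simp add: w_def algebra_simps sum_subtractf flip: sum_distrib_left)
    from orth[OF this] split[of w] w0 wj have "y j = 0" by simp
    moreover from this orth[OF l] split[of l] j0 have "y j0 = 0" by simp
    ultimately have "(\<Sum>i<d. c i * x i k) = 0" if "k < N" for k
      using c(2)[of k] that by (cases "k \<in> ?E") (auto simp: y_def)
    from indep[OF this] c(1) show False by blast
  qed
  then show ?thesis by (auto simp: w_def)
qed

text \<open>
  The \<open>k\<close>-th row of \<open>B\<close> is found by solving all equations but the \<open>k\<close>-th; the remaining value cannot
  vanish, so the row can be normalised.
\<close>

lemma dual_system:
  fixes A :: "nat \<Rightarrow> nat \<Rightarrow> real"
  assumes "\<And>u. (\<And>i. i < N \<Longrightarrow> (\<Sum>j<N. u j * A i j) = 0) \<Longrightarrow> (\<And>j. j < N \<Longrightarrow> u j = 0)"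
  shows "\<exists>B. \<forall>i<N. \<forall>k<N. (\<Sum>j<N. B k j * A i j) = (if i = k then 1 else 0)"
proof -
  have "\<exists>b. \<forall>i<N. (\<Sum>j<N. b j * A i j) = (if i = k then 1 else 0)" if k: "k < N" for k
  proof -
    have "card ({..<N} - {k}) < N" using k by simp
    from homogeneous_system_solution[OF _ this, of A]
    obtain c where c: "\<exists>j<N. c j \<noteq> 0" "\<And>i. i < N \<Longrightarrow> i \<noteq> k \<Longrightarrow> (\<Sum>j<N. c j * A i j) = 0" by auto
    define s where "s = (\<Sum>j<N. c j * A k j)"
    have "s \<noteq> 0"
      using assms[of c] c unfolding s_def by metis
    moreover have "(\<Sum>j<N. c j / s * A i j) = (\<Sum>j<N. c j * A i j) / s" for i
      by (simp add: sum_divide_distrib)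
    ultimately have "\<forall>i<N. (\<Sum>j<N. (c j / s) * A i j) = (if i = k then 1 else 0)"
      using c(2) by (auto simp: s_def)
    then show ?thesis by (intro exI[of _ "\<lambda>j. c j / s"])
  qed
  then have "\<forall>k. \<exists>b. k < N \<longrightarrow> (\<forall>i<N. (\<Sum>j<N. b j * A i j) = (if i = k then 1 else 0))" by blast
  then show ?thesis by metis
qed

section \<open>Positive and integral dependences off half-spaces\<close>

lemma continuous_on_coordinate [continuous_intros]:
  "continuous_on T (\<lambda>f :: nat \<Rightarrow> real. f i)"
  by (rule continuous_on_subset[OF continuous_on_product_coordinates]) simp

lemma compact_cube: "compact {f :: nat \<Rightarrow> real. (\<forall>i<d. \<bar>f i\<bar> \<le> R) \<and> (\<forall>i\<ge>d. f i = 0)}"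
proof -
  have "compactin (product_topology (\<lambda>i::nat. euclideanreal) UNIV) (PiE UNIV (\<lambda>i. if i < d then {-R..R} else {0}))"
    by (subst compactin_PiE) auto
  moreover have "PiE UNIV (\<lambda>i. if i < d then {-R..R} else {0}) = {f :: nat \<Rightarrow> real. (\<forall>i<d. \<bar>f i\<bar> \<le> R) \<and> (\<forall>i\<ge>d. f i = 0)}"
  proof -
    have "(t \<in> (if i < d then {-R..R} else {0})) \<longleftrightarrow> (i < d \<longrightarrow> \<bar>t\<bar> \<le> R) \<and> (i \<ge> d \<longrightarrow> t = 0)" for i and t :: real
      by (auto simp: abs_le_iff)
    then show ?thesis by (auto simp: PiE_UNIV_domain)
  qed
  ultimately show ?thesis by (simp add: euclidean_product_topology)
qed

text \<open>
  Minimise \<open>\<Phi> f = (\<Sum>z. exp (- f \<bullet> x z))\<close>.  By compactness of the unit sphere (of the maximum norm)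
  there are finitely many \<open>z\<close> such that every direction \<open>f\<close> has \<open>f \<bullet> x z < 0\<close> for one of them.  This makes
  \<open>\<Phi>\<close> grow at infinity, so it has a minimum, and the vanishing gradient there is the dependence with
  the positive coefficients \<open>exp (- f \<bullet> x z)\<close>.
\<close>

lemma positive_dependence:
  fixes x :: "'i \<Rightarrow> nat \<Rightarrow> real"
  assumes nohs: "\<forall>f. (\<exists>i<d. f i \<noteq> 0) \<longrightarrow> (\<exists>z\<in>I. (\<Sum>i<d. f i * x z i) < 0)" and Y: "finite Y" "Y \<subseteq> I"
  obtains Z c where "finite Z" "Y \<subseteq> Z" "Z \<subseteq> I" "\<And>z. z \<in> Z \<Longrightarrow> c z > 0"
    "\<And>i. i < d \<Longrightarrow> (\<Sum>z\<in>Z. c z * x z i) = 0"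
proof -
  define ip where "ip f z = (\<Sum>i<d. f i * x z i)" for f z
  define C where "C R = {f :: nat \<Rightarrow> real. (\<forall>i<d. \<bar>f i\<bar> \<le> R) \<and> (\<forall>i\<ge>d. f i = 0)}" for R
  define S where "S = C 1 \<inter> (\<Union>i<d. {f. \<bar>f i\<bar> = 1})"
  have contip[continuous_intros]: "continuous_on T (\<lambda>f. ip f z)" for T z
    unfolding ip_def by (intro continuous_intros)
  have "closed {f :: nat \<Rightarrow> real. \<bar>f i\<bar> = 1}" for i
    by (intro closed_Collect_eq continuous_intros)
  then have "compact S" unfolding S_def C_def
    by (intro compact_Int_closed compact_cube closed_UN) auto
  have op: "open {f. ip f z < 0}" for z
    by (intro open_Collect_less continuous_intros)
  have cover: "S \<subseteq> (\<Union>z\<in>I. {f. ip f z < 0})"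
  proof
    fix f assume "f \<in> S"
    then have "\<exists>i<d. f i \<noteq> 0" by (force simp: S_def)
    with nohs show "f \<in> (\<Union>z\<in>I. {f. ip f z < 0})" by (simp add: ip_def)
  qed
  obtain Z0 where Z0: "Z0 \<subseteq> I" "finite Z0" "S \<subseteq> (\<Union>z\<in>Z0. {f. ip f z < 0})"
    using compactE_image[OF \<open>compact S\<close> op cover] by metis
  define Z where "Z = Z0 \<union> Y"
  have Z: "finite Z" "Y \<subseteq> Z" "Z \<subseteq> I" "S \<subseteq> (\<Union>z\<in>Z. {f. ip f z < 0})"
    using Z0 Y by (auto simp: Z_def)
  \<comment> \<open>\<open>\<sigma>\<close> is a lower bound for \<open>\<Phi>\<close> that is positively homogeneous and positive on the sphere.\<close>
  define \<sigma> where "\<sigma> f = (\<Sum>z\<in>Z. max 0 (- ip f z))" for f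
  have \<sigma>pos: "\<sigma> f > 0" if f: "f \<in> S" for f
  proof -
    obtain z where "z \<in> Z" "ip f z < 0" using Z(4) f by auto
    then show ?thesis unfolding \<sigma>_def by (intro sum_pos2[of Z z]) (auto simp: Z)
  qed
  have "\<exists>\<delta>>0. \<forall>f\<in>S. \<sigma> f \<ge> \<delta>"
  proof (cases "S = {}")
    case False
    have "continuous_on S \<sigma>" unfolding \<sigma>_def by (intro continuous_intros)
    from continuous_attains_inf[OF \<open>compact S\<close> False this] \<sigma>pos show ?thesis by blast
  qed (auto intro: exI[of _ 1])
  then obtain \<delta> where \<delta>: "\<delta> > 0" "\<And>f. f \<in> S \<Longrightarrow> \<sigma> f \<ge> \<delta>" by blast
  \<comment> \<open>On the boundary of the cube of size \<open>R\<close>, \<open>\<Phi>\<close> exceeds \<open>\<Phi> 0 = card Z\<close>; so the minimum is inside.\<close>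
  define R where "R = (real (card Z) + 1) / \<delta>"
  have R: "R > 0" using \<delta> by (simp add: R_def add_nonneg_pos)
  define \<Phi> where "\<Phi> f = (\<Sum>z\<in>Z. exp (- ip f z))" for f
  have \<Phi>\<sigma>: "\<Phi> f \<ge> \<sigma> f" for f
    unfolding \<Phi>_def \<sigma>_def
  proof (rule sum_mono)
    fix z show "max 0 (- ip f z) \<le> exp (- ip f z)"
      using exp_ge_add_one_self[of "- ip f z"] by simp
  qed
  have 0: "(\<lambda>_. 0) \<in> C R" using R by (simp add: C_def)
  have "continuous_on (C R) \<Phi>" unfolding \<Phi>_def by (intro continuous_intros)
  moreover have "compact (C R)" unfolding C_def by (rule compact_cube)
  ultimately obtain f where f: "f \<in> C R" "\<And>g. g \<in> C R \<Longrightarrow> \<Phi> f \<le> \<Phi> g"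
    using continuous_attains_inf[of "C R" \<Phi>] 0 by blast
  have "\<Phi> f \<le> real (card Z)" using f(2)[OF 0] by (simp add: \<Phi>_def ip_def)
  have int: "\<bar>f i\<bar> < R" if i: "i < d" for i
  proof (rule ccontr)
    assume "\<not> \<bar>f i\<bar> < R"
    moreover have le: "\<bar>f j\<bar> \<le> R" if "j < d" for j
      using f(1) that by (simp add: C_def)
    ultimately have eq: "\<bar>f i\<bar> = R" using i by (simp add: order_antisym)
    define g where "g j = f j / R" for j
    have "g \<in> S" unfolding S_def
    proof (intro IntI UN_I)
      have "f j = 0" if "\<not> j < d" for j using f(1) that by (simp add: C_def)
      then show "g \<in> C 1" using le R by (auto simp: C_def g_def divide_le_eq_1)
      show "g \<in> {f. \<bar>f i\<bar> = 1}" using eq R by (simp add: g_def)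
    qed (use i in auto)
    have "ip f z = R * ip g z" for z using R by (simp add: ip_def g_def sum_distrib_left)
    then have "\<sigma> f = R * \<sigma> g" using R
      by (simp add: \<sigma>_def sum_distrib_left max_mult_distrib_left)
    then have "\<Phi> f \<ge> R * \<delta>" using \<Phi>\<sigma>[of f] \<delta>(2)[OF \<open>g \<in> S\<close>] R
      by (smt (verit) mult_left_mono)
    also have "R * \<delta> = real (card Z) + 1" using \<delta> by (simp add: R_def)
    finally show False using \<open>\<Phi> f \<le> real (card Z)\<close> by simp
  qed
  have "(\<Sum>z\<in>Z. exp (- ip f z) * x z i) = 0" if i: "i < d" for i
  proof -
    have upd: "ip (f(i := t)) z = ip f z + (t - f i) * x z i" for t z
    proof -
      have "ip (f(i := t)) z = (\<Sum>j<d. f j * x z j + (if j = i then (t - f i) * x z i else 0))"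
        unfolding ip_def by (intro sum.cong) (auto simp: algebra_simps)
      then show ?thesis using i by (simp add: sum.distrib ip_def)
    qed
    have "((\<lambda>t. \<Phi> (f(i := t))) has_real_derivative (\<Sum>z\<in>Z. exp (- ip f z) * (- x z i))) (at (f i))"
      unfolding \<Phi>_def upd by (auto intro!: derivative_eq_intros DERIV_sum)
    moreover have "\<forall>t. \<bar>f i - t\<bar> < R - \<bar>f i\<bar> \<longrightarrow> \<Phi> (f(i := f i)) \<le> \<Phi> (f(i := t))"
    proof (intro allI impI)
      fix t assume "\<bar>f i - t\<bar> < R - \<bar>f i\<bar>"
      then have "f(i := t) \<in> C R" using f(1) i by (auto simp: C_def)
      then show "\<Phi> (f(i := f i)) \<le> \<Phi> (f(i := t))" using f(2) by simp
    qed
    ultimately have "(\<Sum>z\<in>Z. exp (- ip f z) * (- x z i)) = 0"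
      using DERIV_local_min[of "\<lambda>t. \<Phi> (f(i := t))" _ "f i" "R - \<bar>f i\<bar>"] int[OF i] by simp
    then show ?thesis by (simp add: sum_negf)
  qed
  with Z(1-3) show thesis by (intro that[of Z "\<lambda>z. exp (- ip f z)"]) auto
qed

text \<open>
  Simultaneous rational approximation of the coefficients of a positive dependence.  The weights
  \<open>w k z\<close> are the integers next to a large multiple of these coefficients, so they tend to infinity.
\<close>

lemma integral_near_dependence:
  fixes x :: "'i \<Rightarrow> nat \<Rightarrow> real"
  assumes nohs: "\<forall>f. (\<exists>i<d. f i \<noteq> 0) \<longrightarrow> (\<exists>z\<in>I. (\<Sum>i<d. f i * x z i) < 0)" and Y: "finite Y" "Y \<subseteq> I"
  obtains Z and w :: "nat \<Rightarrow> 'i \<Rightarrow> nat" where "finite Z" "Y \<subseteq> Z" "Z \<subseteq> I"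
    "\<And>z. z \<in> Z \<Longrightarrow> filterlim (\<lambda>k. w k z) at_top sequentially"
    "\<And>i. i < d \<Longrightarrow> (\<lambda>k. \<Sum>z\<in>Z. real (w k z) * x z i) \<longlonglongrightarrow> 0"
proof -
  obtain Z c where Z: "finite Z" "Y \<subseteq> Z" "Z \<subseteq> I" and c: "\<And>z. z \<in> Z \<Longrightarrow> c z > 0"
    "\<And>i. i < d \<Longrightarrow> (\<Sum>z\<in>Z. c z * x z i) = 0"
    by (rule positive_dependence[OF nohs Y]) blast
  obtain h where h: "bij_betw h {0..<card Z} Z" using ex_bij_betw_nat_finite[OF Z(1)] by blast
  have "\<exists>K p. K \<ge> real (Suc k) \<and> (\<forall>z\<in>Z. \<bar>K * c z - real (p z)\<bar> < 1 / real (Suc k))" for k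
  proof -
    \<comment> \<open>With precision \<open>1 / (k + 1)\<^sup>2\<close>, the denominator can be multiplied by \<open>k + 1\<close> to make it large.\<close>
    define N where "N = Suc k * Suc k"
    have "N > 0" by (simp add: N_def)
    then have N1: "1 / real N \<le> 1" by (simp add: divide_le_eq_1)
    have N2: "real (Suc k) * (1 / N) = 1 / real (Suc k)"
      unfolding N_def of_nat_mult by (simp del: of_nat_Suc)
    obtain q p where q: "0 < q" and
      p: "\<And>i. i < card Z \<Longrightarrow> \<bar>of_int q * c (h i) - of_int (p i)\<bar> < 1 / N"
      using Dirichlet_approx_simult[OF \<open>N > 0\<close>, of "card Z" "\<lambda>i. c (h i)"] by metis
    define g where "g z = nat (p (inv_into {0..<card Z} h z))" for z
    have g: "\<bar>of_int q * c z - real (g z)\<bar> < 1 / N" if "z \<in> Z" for z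
    proof -
      let ?i = "inv_into {0..<card Z} h z"
      have i: "?i < card Z" "h ?i = z"
        using h that by (metis atLeastLessThan_iff bij_betw_def inv_into_into, metis bij_betw_inv_into_right)
      have "0 < of_int q * c z" using c(1)[OF that] q by simp
      then have "real_of_int (- 1) < real_of_int (p ?i)"
        using p[OF i(1)] N1 unfolding i(2) by simp
      then have "p ?i \<ge> 0" by (simp only: of_int_less_iff)
      then show ?thesis using p[OF i(1)] unfolding i(2) by (simp add: g_def)
    qed
    have "\<bar>(real (Suc k) * of_int q) * c z - real (Suc k * g z)\<bar> < 1 / real (Suc k)" if "z \<in> Z" for z
    proof -
      have "\<bar>(real (Suc k) * of_int q) * c z - real (Suc k * g z)\<bar> = real (Suc k) * \<bar>of_int q * c z - real (g z)\<bar>"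
        by (simp only: of_nat_mult mult.assoc right_diff_distrib[symmetric] abs_mult abs_of_nat)
      also have "\<dots> < real (Suc k) * (1 / N)" by (rule mult_strict_left_mono[OF g[OF that]]) simp
      also have "\<dots> = 1 / real (Suc k)" by (rule N2)
      finally show ?thesis .
    qed
    moreover have "real (Suc k) * of_int q \<ge> real (Suc k)"
      using q by (simp add: mult_le_cancel_left1)
    ultimately show ?thesis by (intro exI[of _ "real (Suc k) * of_int q"] exI[of _ "\<lambda>z. Suc k * g z"]) blast
  qed
  then obtain K w where K: "\<And>k. K k \<ge> real (Suc k)"
    and w: "\<And>k z. z \<in> Z \<Longrightarrow> \<bar>K k * c z - real (w k z)\<bar> < 1 / real (Suc k)" by metis
  have lim: "filterlim (\<lambda>k. w k z) at_top sequentially" if z: "z \<in> Z" for z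
  proof -
    have "real (w k z) \<ge> real k * c z + (- 1)" for k
    proof -
      have "1 / real (Suc k) \<le> 1" by simp
      moreover have "real k * c z \<le> K k * c z" using K[of k] c(1)[OF z] by (intro mult_right_mono) auto
      ultimately show ?thesis using w[OF z, of k] by linarith
    qed
    moreover have "filterlim (\<lambda>k. real k * c z + (- 1)) at_top sequentially"
      using c(1)[OF z] by real_asymp
    ultimately have "filterlim (\<lambda>k. real (w k z)) at_top sequentially"
      using filterlim_at_top_mono by (metis (mono_tags, lifting) always_eventually)
    then show ?thesis using filterlim_sequentially_iff_filterlim_real by blast
  qed
  have "(\<lambda>k. \<Sum>z\<in>Z. real (w k z) * x z i) \<longlonglongrightarrow> 0" if i: "i < d" for i
  proof -
    have "(\<lambda>k. (real (w k z) - K k * c z) * x z i) \<longlonglongrightarrow> 0" if "z \<in> Z" for z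
    proof (rule tendsto_mult_left_zero, rule Lim_null_comparison)
      show "\<forall>\<^sub>F k in sequentially. norm (real (w k z) - K k * c z) \<le> 1 / real (Suc k)"
        using w[OF that] by (intro always_eventually allI) (simp add: abs_minus_commute less_imp_le)
      show "(\<lambda>k. 1 / real (Suc k)) \<longlonglongrightarrow> 0" using LIMSEQ_Suc lim_1_over_n by blast
    qed
    then have "(\<lambda>k. \<Sum>z\<in>Z. (real (w k z) - K k * c z) * x z i) \<longlonglongrightarrow> 0"
      by (intro tendsto_null_sum)
    moreover have "(\<Sum>z\<in>Z. (real (w k z) - K k * c z) * x z i) = (\<Sum>z\<in>Z. real (w k z) * x z i)" for k
    proof -
      have "(\<Sum>z\<in>Z. (real (w k z) - K k * c z) * x z i) = (\<Sum>z\<in>Z. real (w k z) * x z i) - K k * (\<Sum>z\<in>Z. c z * x z i)"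
        by (simp add: algebra_simps sum_subtractf sum_distrib_left)
      then show ?thesis using c(2)[OF i] by simp
    qed
    ultimately show ?thesis by simp
  qed
  with lim Z show thesis by (intro that[of Z w]) auto
qed

section \<open>Components of \<open>H\<^sub>m\<^sub>n\<close>\<close>

abbreviation ht :: "H_elt \<Rightarrow> real" where "ht g \<equiv> fst (snd g)"
abbreviation tr :: "H_elt \<Rightarrow> nat \<Rightarrow> real" where "tr g \<equiv> snd (snd g)"

lemma H_mult: "g \<otimes>\<^bsub>H_group m n\<^esub> h =
    (\<lambda>i. fst g i + fst h i, ht g + ht h,
     \<lambda>i. tr g i + exp (ht g) * tr h i)"
  by (simp add: H_group_def split_beta)

lemma H_one: "\<one>\<^bsub>H_group m n\<^esub> = (\<lambda>i. 0, 0, \<lambda>i. 0)"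
  by (simp add: H_group_def)

lemma H_carrier: "g \<in> carrier (H_group m n) \<longleftrightarrow>
    (\<forall>i\<ge>m - 1. fst g i = 0) \<and> (\<forall>i\<ge>n. tr g i = 0)"
  by (cases g) (auto simp: H_group_def topspace_Euclidean_space)

lemma topspace_H_top: "topspace (H_top m n) = carrier (H_group m n)"
  using topological_group_H by (simp add: topological_group_def)

lemma H_inv:
  assumes "g \<in> carrier (H_group m n)"
  shows "inv\<^bsub>H_group m n\<^esub> g = (\<lambda>i. - fst g i, - ht g, \<lambda>i. - (exp (- ht g) * tr g i))"
  using inv_H_group[of "fst g" "ht g" "tr g" m n] assms by simp

lemma H_coord_eq: "H_coord m j g =
    (if j < m - 1 then fst g j else if j = m - 1 then ht g else tr g (j - m))"
  by (simp add: H_coord_def split_beta)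

lemma H_coord_one: "H_coord m i \<one>\<^bsub>H_group m n\<^esub> = 0"
  by (simp add: H_coord_eq H_one)

lemma H_coord_mult:
  "j < m \<Longrightarrow> H_coord m j (g \<otimes>\<^bsub>H_group m n\<^esub> h) = H_coord m j g + H_coord m j h"
  by (auto simp: H_coord_eq H_mult)

lemma continuous_map_H_components:
  "continuous_map (H_top m n) euclideanreal (\<lambda>g. fst g i)"
  "continuous_map (H_top m n) euclideanreal (\<lambda>g. ht g)"
  "continuous_map (H_top m n) euclideanreal (\<lambda>g. tr g i)"
proof -
  have "continuous_map (H_top m n) (H_top m n) (\<lambda>g. g)" by simp
  from iffD1[OF continuous_map_into_H this]
  show "continuous_map (H_top m n) euclideanreal (\<lambda>g. fst g i)"
    "continuous_map (H_top m n) euclideanreal (\<lambda>g. ht g)"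
    "continuous_map (H_top m n) euclideanreal (\<lambda>g. tr g i)"
    by blast+
qed

lemma continuous_map_H_coord: "continuous_map (H_top m n) euclideanreal (H_coord m j)"
  by (auto simp: H_coord_eq[abs_def] continuous_map_H_components)

text \<open>
  Coordinates beyond the dimension vanish on the carrier, so convergence of the others suffices.
\<close>

lemma closedin_H_sequentially:
  assumes "closedin (H_top m n) T" and "\<And>k. g k \<in> T" and l: "l \<in> carrier (H_group m n)"
    and "\<And>i. i < m - 1 \<Longrightarrow> (\<lambda>k. fst (g k) i) \<longlonglongrightarrow> fst l i"
    and "(\<lambda>k. ht (g k)) \<longlonglongrightarrow> ht l"
    and "\<And>i. i < n \<Longrightarrow> (\<lambda>k. tr (g k) i) \<longlonglongrightarrow> tr l i"
  shows "l \<in> T"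
proof (rule limitin_closedin)
  have g: "g k \<in> carrier (H_group m n)" for k
    using assms(1,2) closedin_subset topspace_H_top by fastforce
  have "(\<lambda>k. fst (g k) i) \<longlonglongrightarrow> fst l i" for i
    using g l assms(4)[of i] by (cases "i < m - 1") (auto simp: H_carrier)
  moreover have "(\<lambda>k. tr (g k) i) \<longlonglongrightarrow> tr l i" for i
    using g l assms(6)[of i] by (cases "i < n") (auto simp: H_carrier)
  ultimately show "limitin (H_top m n) g l sequentially"
    using g l assms(5)
    by (auto simp: H_top_def limitin_pairwise o_def Euclidean_space_def limitin_subtopology
        limitin_componentwise H_carrier)
qed (use assms in auto)

section \<open>Half-spaces and their maximality\<close>

definition lin_form :: "nat \<Rightarrow> (nat \<Rightarrow> real) \<Rightarrow> H_elt \<Rightarrow> real" where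
  "lin_form m f g = (\<Sum>i<m. f i * H_coord m i g)"

text \<open>
  In the action on \<open>\<real>\<^sup>n\<close> this is the displacement, in direction \<open>\<gamma>\<close>, of the points \<open>x\<close> with
  \<open>\<gamma> \<bullet> x = - c\<close>.
\<close>

definition aff_form :: "nat \<Rightarrow> (nat \<Rightarrow> real) \<Rightarrow> real \<Rightarrow> H_elt \<Rightarrow> real" where
  "aff_form n \<gamma> c g = (\<Sum>i<n. \<gamma> i * tr g i) - c * (exp (ht g) - 1)"

definition half_space_form :: "nat \<Rightarrow> nat \<Rightarrow> (H_elt \<Rightarrow> real) \<Rightarrow> bool" where
  "half_space_form m n F \<longleftrightarrow>
     (\<exists>f. (\<exists>i<m. f i \<noteq> 0) \<and> F = lin_form m f) \<or>
     (\<exists>\<gamma> c. (\<exists>i<n. \<gamma> i \<noteq> 0) \<and> F = aff_form n \<gamma> c)"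

lemma lin_form_mult: "lin_form m f (g \<otimes>\<^bsub>H_group m n\<^esub> h) = lin_form m f g + lin_form m f h"
  by (simp add: lin_form_def H_coord_mult algebra_simps sum.distrib)

lemma aff_form_mult:
  "aff_form n \<gamma> c (g \<otimes>\<^bsub>H_group m n\<^esub> h) = aff_form n \<gamma> c g + exp (ht g) * aff_form n \<gamma> c h"
  by (simp add: aff_form_def H_mult algebra_simps sum.distrib exp_add sum_distrib_left)

text \<open>
  The one property of the two kinds of forms that most arguments need; the factor \<open>\<rho>\<close> is \<open>1\<close> for the
  linear and \<open>e\<^sup>a\<close> for the affine ones.
\<close>

lemma half_space_form_cocycle:
  assumes "half_space_form m n F"
  obtains \<rho> :: "H_elt \<Rightarrow> real" where "\<And>g. \<rho> g > 0"
    "\<And>g h. F (g \<otimes>\<^bsub>H_group m n\<^esub> h) = F g + \<rho> g * F h"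
  using assms unfolding half_space_form_def
proof (elim disjE exE conjE)
  fix f assume "F = lin_form m f"
  then show thesis using that[of "\<lambda>_. 1"] by (simp add: lin_form_mult)
next
  fix \<gamma> c assume "F = aff_form n \<gamma> c"
  then show thesis using that[of "\<lambda>g. exp (ht g)"] by (simp add: aff_form_mult)
qed

lemma half_space_form_one: "half_space_form m n F \<Longrightarrow> F \<one>\<^bsub>H_group m n\<^esub> = 0"
  by (auto simp: half_space_form_def lin_form_def aff_form_def H_coord_one) (auto simp: H_one)

lemma half_space_form_inv:
  assumes F: "half_space_form m n F" and g: "g \<in> carrier (H_group m n)"
  shows "F g > 0 \<longleftrightarrow> F (inv\<^bsub>H_group m n\<^esub> g) < 0"
proof -
  obtain \<rho> where \<rho>: "\<And>g. \<rho> g > 0" "\<And>g h. F (g \<otimes>\<^bsub>H_group m n\<^esub> h) = F g + \<rho> g * F h"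
    by (rule half_space_form_cocycle[OF F]) blast
  have "F g + \<rho> g * F (inv\<^bsub>H_group m n\<^esub> g) = 0"
    using \<rho>(2)[of g "inv\<^bsub>H_group m n\<^esub> g"] group.r_inv[OF group_H_group g] half_space_form_one[OF F] by simp
  then show ?thesis using \<rho>(1)[of g]
    by (smt (verit) mult_less_0_iff zero_less_mult_iff)
qed

lemma continuous_map_half_space_form:
  assumes "half_space_form m n F"
  shows "continuous_map (H_top m n) euclideanreal F"
proof -
  have "continuous_map (H_top m n) euclideanreal (\<lambda>g. exp (ht g))"
    using continuous_map_compose[OF continuous_map_H_components(2), of euclideanreal exp]
    by (simp add: o_def continuous_on_exp)
  then have "continuous_map (H_top m n) euclideanreal (aff_form n \<gamma> c)" for \<gamma> c
    unfolding aff_form_def[abs_def]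
    by (intro continuous_map_diff continuous_map_real_mult continuous_map_sum continuous_map_H_components) auto
  moreover have "continuous_map (H_top m n) euclideanreal (lin_form m f)" for f
    unfolding lin_form_def[abs_def]
    by (intro continuous_map_real_mult continuous_map_sum continuous_map_H_coord) auto
  ultimately show ?thesis using assms by (auto simp: half_space_form_def)
qed

lemma half_space_form_positive:
  assumes "half_space_form m n F"
  obtains g where "g \<in> carrier (H_group m n)" "F g > 0"
  using assms unfolding half_space_form_def
proof (elim disjE exE conjE)
  fix f i assume F: "F = lin_form m f" and i: "i < m" "f i \<noteq> 0"
  let ?g = "(\<lambda>i. if i < m - 1 then f i else 0, f (m - 1), \<lambda>i. 0)"
  have "H_coord m j ?g = f j" if "j < m" for j
    using that by (auto simp: H_coord_eq)
  then have "F ?g = (\<Sum>j<m. f j * f j)" by (simp add: F lin_form_def)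
  also have "\<dots> > 0" using i by (intro sum_pos2[of _ i]) (auto simp: zero_less_mult_iff)
  finally show thesis by (intro that[of ?g]) (auto simp: H_carrier)
next
  fix \<gamma> c i assume F: "F = aff_form n \<gamma> c" and i: "i < n" "\<gamma> i \<noteq> 0"
  let ?g = "(\<lambda>i. 0, 0, \<lambda>i. if i < n then \<gamma> i else 0)"
  have "F ?g = (\<Sum>j<n. \<gamma> j * \<gamma> j)" by (simp add: F aff_form_def)
  also have "\<dots> > 0" using i by (intro sum_pos2[of _ i]) (auto simp: zero_less_mult_iff)
  finally show thesis by (intro that[of ?g]) (auto simp: H_carrier)
qed

text \<open>
  For a linear form take powers of \<open>t\<close>.  In the other case multiply \<open>t\<close> from the left by an element of the
  boundary with large height \<open>A\<close>, which scales \<open>F t\<close> by \<open>e\<^sup>A\<close>.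
\<close>

lemma half_space_form_unbounded_below:
  assumes F: "half_space_form m n F" and T: "subsemigroup T (H_group m n)"
    and sub: "{g \<in> carrier (H_group m n). F g \<ge> 0} \<subseteq> T" and t: "t \<in> T" "F t < 0"
  shows "\<exists>t'\<in>T. F t' \<le> r"
  using F unfolding half_space_form_def
proof (elim disjE exE conjE)
  fix f assume Ff: "F = lin_form m f"
  have "\<exists>t'\<in>T. F t' = real (Suc k) * F t" for k
  proof (induction k)
    case 0
    then show ?case using t by auto
  next
    case (Suc k)
    then obtain t' where t': "t' \<in> T" "F t' = real (Suc k) * F t" by blast
    have "F (t' \<otimes>\<^bsub>H_group m n\<^esub> t) = real (Suc (Suc k)) * F t"
      using t'(2) by (simp add: Ff lin_form_mult algebra_simps)
    moreover have "t' \<otimes>\<^bsub>H_group m n\<^esub> t \<in> T" using T t t'(1) by (auto simp: subsemigroup_def)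
    ultimately show ?case by blast
  qed
  moreover obtain k :: nat where "- r < real k * (- F t)"
    using reals_Archimedean3[of "- F t"] t(2) by (metis neg_0_less_iff_less)
  then have "real (Suc k) * F t \<le> r" using t(2) by (simp add: algebra_simps)
  ultimately show ?thesis by metis
next
  fix \<gamma> c i assume Ff: "F = aff_form n \<gamma> c" and i: "i < n" "\<gamma> i \<noteq> 0"
  define A where "A = ln ((\<bar>r\<bar> + 1) / (- F t))"
  have A: "exp A = (\<bar>r\<bar> + 1) / (- F t)" using t(2) by (simp add: A_def zero_less_divide_iff divide_less_0_iff add_nonneg_pos)
  let ?e = "(\<lambda>i. 0, A, \<lambda>j. if j = i then c * (exp A - 1) / \<gamma> i else 0) :: H_elt"
  have "F ?e = 0" using i by (simp add: Ff aff_form_def if_distrib[of "\<lambda>x. _ * x"] cong: if_cong)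
  moreover have "?e \<in> carrier (H_group m n)" using i by (auto simp: H_carrier)
  ultimately have "?e \<in> T" using sub by auto
  then have "?e \<otimes>\<^bsub>H_group m n\<^esub> t \<in> T" using T t by (auto simp: subsemigroup_def)
  moreover have "F (?e \<otimes>\<^bsub>H_group m n\<^esub> t) = exp A * F t"
    using \<open>F ?e = 0\<close> by (simp add: Ff aff_form_mult)
  moreover have "exp A * F t \<le> r" using t(2) by (simp add: A)
  ultimately show ?thesis by metis
qed

text \<open>
  If \<open>T\<close> contains more than the half-space, then \<open>F\<close> is unbounded below on \<open>T\<close>.  So any \<open>g\<close> can be
  written as \<open>t' h\<close> with \<open>t' \<in> T\<close> and \<open>F t' \<le> F g\<close>; the cocycle identity then gives \<open>F h \<ge> 0\<close>.
\<close>

theorem maximal_subsemigroup_half_space: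
  assumes F: "half_space_form m n F"
  shows "maximal_subsemigroup (H_group m n) (H_top m n) {g \<in> carrier (H_group m n). F g \<ge> 0}"
    (is "maximal_subsemigroup ?G ?X ?E")
proof -
  interpret G: group ?G by (rule group_H_group)
  obtain \<rho> where \<rho>: "\<And>g. \<rho> g > 0" "\<And>g h. F (g \<otimes>\<^bsub>?G\<^esub> h) = F g + \<rho> g * F h"
    by (rule half_space_form_cocycle[OF F]) blast
  obtain g where g: "g \<in> carrier ?G" "F g > 0" by (rule half_space_form_positive[OF F])
  have g': "inv\<^bsub>?G\<^esub> g \<in> carrier ?G" "F (inv\<^bsub>?G\<^esub> g) < 0"
    using g half_space_form_inv[OF F] by auto
  have "subsemigroup ?E ?G"
    unfolding subsemigroup_def using \<rho> by (auto simp: less_imp_le)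
  moreover have "?E \<noteq> carrier ?G" using g' by force
  moreover have "?X interior_of ?E \<noteq> {}"
  proof -
    have "openin ?X {g \<in> topspace ?X. F g \<in> {0<..}}"
      by (rule openin_continuous_map_preimage[OF continuous_map_half_space_form[OF F]]) simp
    then have "{g \<in> topspace ?X. F g \<in> {0<..}} \<subseteq> ?X interior_of ?E"
      by (intro interior_of_maximal) (auto simp: topspace_H_top)
    then show ?thesis using g by (auto simp: topspace_H_top)
  qed
  moreover have "\<not> subgroup ?E ?G"
  proof
    assume "subgroup ?E ?G"
    then have "inv\<^bsub>?G\<^esub> g \<in> ?E" using g by (intro subgroup.m_inv_closed) auto
    then show False using g' by simp
  qed
  moreover have "T = ?E \<or> T = carrier ?G" if T: "subsemigroup T ?G" "?E \<subseteq> T" for T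
  proof (cases "T = ?E")
    case False
    then obtain t where t: "t \<in> T" "F t < 0" using T by (force simp: subsemigroup_def)
    have "g \<in> T" if g: "g \<in> carrier ?G" for g
    proof -
      obtain t' where t': "t' \<in> T" "F t' \<le> F g"
        using half_space_form_unbounded_below[OF F T t] by blast
      then have car: "t' \<in> carrier ?G" using T by (auto simp: subsemigroup_def)
      let ?h = "inv\<^bsub>?G\<^esub> t' \<otimes>\<^bsub>?G\<^esub> g"
      have eq: "t' \<otimes>\<^bsub>?G\<^esub> ?h = g" using car g by (simp flip: G.m_assoc)
      then have "\<rho> t' * F ?h \<ge> 0" using \<rho>(2)[of t' ?h] t' by simp
      then have "F ?h \<ge> 0" using \<rho>(1)[of t'] by (simp add: zero_le_mult_iff)
      then have "?h \<in> T" using T car g by auto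
      then show ?thesis using T t'(1) eq by (metis subsemigroup_def)
    qed
    then show ?thesis using T by (auto simp: subsemigroup_def)
  qed simp
  ultimately show ?thesis by (auto simp: maximal_subsemigroup_def)
qed

lemma subgroup_half_space_boundary:
  assumes F: "half_space_form m n F"
  shows "subgroup {g \<in> carrier (H_group m n). F g = 0} (H_group m n)"
proof -
  interpret G: group "H_group m n" by (rule group_H_group)
  obtain \<rho> where \<rho>: "\<And>g. \<rho> g > 0" "\<And>g h. F (g \<otimes>\<^bsub>H_group m n\<^esub> h) = F g + \<rho> g * F h"
    by (rule half_space_form_cocycle[OF F]) blast
  show ?thesis
  proof
    fix g assume g: "g \<in> {g \<in> carrier (H_group m n). F g = 0}"
    then have "F (inv\<^bsub>H_group m n\<^esub> g) = 0"
      using \<rho>(2)[of g "inv\<^bsub>H_group m n\<^esub> g"] \<rho>(1)[of g] half_space_form_one[OF F] by simp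
    then show "inv\<^bsub>H_group m n\<^esub> g \<in> {g \<in> carrier (H_group m n). F g = 0}" using g by simp
  qed (auto simp: \<rho>(2) half_space_form_one[OF F])
qed

lemma subgroup_half_space_subset_boundary:
  assumes F: "half_space_form m n F" and K: "subgroup K (H_group m n)"
    and "K \<subseteq> {g \<in> carrier (H_group m n). F g \<ge> 0}"
  shows "K \<subseteq> {g \<in> carrier (H_group m n). F g = 0}"
proof
  fix g assume g: "g \<in> K"
  then have "inv\<^bsub>H_group m n\<^esub> g \<in> K" by (rule subgroup.m_inv_closed[OF K])
  then have "g \<in> carrier (H_group m n)" "F g \<ge> 0" "F (inv\<^bsub>H_group m n\<^esub> g) \<ge> 0"
    using assms(3) g by blast+
  then show "g \<in> {g \<in> carrier (H_group m n). F g = 0}"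
    using half_space_form_inv[OF F, of g] by auto
qed

section \<open>Subsemigroups of topological groups\<close>

lemma subsemigroup_generated:
  assumes "S \<subseteq> carrier G" "group G"
  shows "subsemigroup (semigroup_generated G S) G"
proof -
  have "g \<in> carrier G" if "g \<in> semigroup_generated G S" for g
    using that assms by induction (auto intro: monoid.m_closed group.is_monoid)
  then show ?thesis by (auto simp: subsemigroup_def intro: semigroup_generated.mult)
qed

lemma semigroup_generated_subset:
  assumes "subsemigroup M G" "S \<subseteq> M"
  shows "semigroup_generated G S \<subseteq> M"
proof
  fix g assume "g \<in> semigroup_generated G S"
  then show "g \<in> M" using assms by induction (auto simp: subsemigroup_def)
qed

lemma subsemigroup_closure:
  assumes G: "topological_group G X" and T: "subsemigroup T G"
  shows "subsemigroup (X closure_of T) G"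
  unfolding subsemigroup_def
proof (intro conjI ballI)
  show "X closure_of T \<subseteq> carrier G"
    using G closure_of_subset_topspace by (fastforce simp: topological_group_def)
  fix g h assume "g \<in> X closure_of T" "h \<in> X closure_of T"
  then have "(g, h) \<in> prod_topology X X closure_of (T \<times> T)" by (simp add: closure_of_Times)
  moreover have "((\<lambda>(g, h). g \<otimes>\<^bsub>G\<^esub> h) ` (prod_topology X X closure_of (T \<times> T)))
      \<subseteq> (X closure_of ((\<lambda>(g, h). g \<otimes>\<^bsub>G\<^esub> h) ` (T \<times> T)))"
    using G by (intro continuous_map_image_closure_subset) (simp add: topological_group_def)
  moreover have "X closure_of ((\<lambda>(g, h). g \<otimes>\<^bsub>G\<^esub> h) ` (T \<times> T)) \<subseteq> X closure_of T"
    using T by (intro closure_of_mono) (auto simp: subsemigroup_def)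
  ultimately show "g \<otimes>\<^bsub>G\<^esub> h \<in> X closure_of T" by auto
qed

text \<open>
  By maximality the closure of \<open>M\<close> is \<open>M\<close> or the whole group.  If \<open>M\<close> is dense and \<open>U\<close> is its interior,
  then for every \<open>g\<close> the open set \<open>g U\<^bsup>-1\<^esup>\<close> meets \<open>M\<close>, so \<open>g \<in> M U \<subseteq> M\<close>.
\<close>

lemma closedin_maximal_subsemigroup:
  fixes G (structure)
  assumes G: "topological_group G X" and M: "maximal_subsemigroup G X M"
  shows "closedin X M"
proof -
  interpret group G using G by (simp add: topological_group_def)
  have top: "topspace X = carrier G" using G by (simp add: topological_group_def)
  have M': "subsemigroup M G" using M by (simp add: maximal_subsemigroup_def)
  then have sub: "M \<subseteq> X closure_of M"
    using top by (intro closure_of_subset) (auto simp: subsemigroup_def)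
  have "X closure_of M \<noteq> carrier G"
  proof
    assume dense: "X closure_of M = carrier G"
    define U where "U = X interior_of M"
    have "U \<noteq> {}" using M by (simp add: maximal_subsemigroup_def U_def)
    then obtain u where "u \<in> U" by blast
    then have u: "u \<in> U" "openin X U" "U \<subseteq> M" by (auto simp: U_def interior_of_subset)
    then have uc: "u \<in> carrier G" using M' by (auto simp: subsemigroup_def)
    have "g \<in> M" if g: "g \<in> carrier G" for g
    proof -
      have "continuous_map X (prod_topology X X) (\<lambda>k. (inv k, g))"
        using G g top by (simp add: continuous_map_pairwise o_def topological_group_def)
      then have "continuous_map X X (\<lambda>k. inv k \<otimes> g)"
        using continuous_map_compose[of X "prod_topology X X" "\<lambda>k. (inv k, g)" X "\<lambda>(g, h). g \<otimes> h"] G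
        by (simp add: topological_group_def o_def)
      then have "openin X {k \<in> topspace X. inv k \<otimes> g \<in> U}"
        using u by (intro openin_continuous_map_preimage)
      moreover have "g \<otimes> inv u \<in> {k \<in> topspace X. inv k \<otimes> g \<in> U}"
        using g u uc top by (simp add: inv_mult_group m_assoc)
      ultimately obtain k where "k \<in> M" "inv k \<otimes> g \<in> U"
        using dense g uc by (auto simp: in_closure_of set_eq_iff) (metis (no_types, lifting) inv_closed m_closed mem_Collect_eq)
      moreover from this have "k \<otimes> (inv k \<otimes> g) = g"
        using g M' by (auto simp: subsemigroup_def simp flip: m_assoc)
      ultimately show ?thesis using M' u by (metis subsemigroup_def subsetD)
    qed
    then show False using M M' by (auto simp: maximal_subsemigroup_def subsemigroup_def)
  qed
  with M sub subsemigroup_closure[OF G M'] have "X closure_of M = M"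
    by (auto simp: maximal_subsemigroup_def)
  then show ?thesis by (metis closedin_closure_of)
qed

section \<open>Closed subsemigroups in no half-space\<close>

text \<open>
  The fixed point of the similarity \<open>x \<mapsto> e\<^sup>a x + b\<close>, meaningful for \<open>a \<noteq> 0\<close>.
\<close>

definition fixpt :: "H_elt \<Rightarrow> nat \<Rightarrow> real" where
  "fixpt g i = tr g i / (1 - exp (ht g))"

lemma closedin_H_eventually:
  assumes "closedin (H_top m n) T" and ev: "\<forall>\<^sub>F k in sequentially. g k \<in> T" and l: "l \<in> carrier (H_group m n)"
    and "\<And>i. i < m - 1 \<Longrightarrow> (\<lambda>k. fst (g k) i) \<longlonglongrightarrow> fst l i"
    and "(\<lambda>k. ht (g k)) \<longlonglongrightarrow> ht l"
    and "\<And>i. i < n \<Longrightarrow> (\<lambda>k. tr (g k) i) \<longlonglongrightarrow> tr l i"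
  shows "l \<in> T"
proof -
  obtain k0 where "\<And>k. k \<ge> k0 \<Longrightarrow> g k \<in> T" using ev by (auto simp: eventually_sequentially)
  then show ?thesis using assms(4-6)
    by (intro closedin_H_sequentially[OF assms(1) _ l, of "\<lambda>k. g (k + k0)"])
      (auto intro: LIMSEQ_ignore_initial_segment)
qed

lemma H_pow:
  "fst (q [^]\<^bsub>H_group m n\<^esub> k) = (\<lambda>i. real k * fst q i)"
  "ht (q [^]\<^bsub>H_group m n\<^esub> k) = real k * ht q"
  "ht q \<noteq> 0 \<Longrightarrow> tr (q [^]\<^bsub>H_group m n\<^esub> k) i = (1 - exp (real k * ht q)) * fixpt q i"
proof (induction k)
  case (Suc k)
  { case 1 show ?case using Suc by (simp add: nat_pow_Suc H_mult algebra_simps) }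
  { case 2 show ?case using Suc by (simp add: nat_pow_Suc H_mult algebra_simps) }
  { case 3
    have a: "tr q i = (1 - exp (ht q)) * fixpt q i" using 3 by (simp add: fixpt_def)
    have b: "tr (q [^]\<^bsub>H_group m n\<^esub> Suc k) i
        = (1 - exp (real k * ht q)) * fixpt q i + exp (real k * ht q) * tr q i"
      using Suc(2) Suc(3)[OF 3] by (simp add: nat_pow_Suc H_mult)
    show ?case unfolding b a by (simp add: algebra_simps exp_add) }
qed (simp_all add: nat_pow_0 H_one)

lemma insert_one_mult:
  assumes "subsemigroup T G" "group G"
  shows "x \<in> insert \<one>\<^bsub>G\<^esub> T \<Longrightarrow> y \<in> T \<Longrightarrow> x \<otimes>\<^bsub>G\<^esub> y \<in> T"
    "x \<in> T \<Longrightarrow> y \<in> insert \<one>\<^bsub>G\<^esub> T \<Longrightarrow> x \<otimes>\<^bsub>G\<^esub> y \<in> T"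
    "x \<in> insert \<one>\<^bsub>G\<^esub> T \<Longrightarrow> y \<in> insert \<one>\<^bsub>G\<^esub> T \<Longrightarrow> x \<otimes>\<^bsub>G\<^esub> y \<in> insert \<one>\<^bsub>G\<^esub> T"
proof -
  interpret group G by fact
  show "x \<in> insert \<one>\<^bsub>G\<^esub> T \<Longrightarrow> y \<in> T \<Longrightarrow> x \<otimes>\<^bsub>G\<^esub> y \<in> T"
    "x \<in> T \<Longrightarrow> y \<in> insert \<one>\<^bsub>G\<^esub> T \<Longrightarrow> x \<otimes>\<^bsub>G\<^esub> y \<in> T"
    "x \<in> insert \<one>\<^bsub>G\<^esub> T \<Longrightarrow> y \<in> insert \<one>\<^bsub>G\<^esub> T \<Longrightarrow> x \<otimes>\<^bsub>G\<^esub> y \<in> insert \<one>\<^bsub>G\<^esub> T"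
    using assms(1) by (auto simp: subsemigroup_def)
qed

lemma pow_in_subsemigroup:
  assumes "subsemigroup T G" "group G" "q \<in> T"
  shows "q [^]\<^bsub>G\<^esub> (k::nat) \<in> insert \<one>\<^bsub>G\<^esub> T" "q [^]\<^bsub>G\<^esub> Suc k \<in> T"
proof -
  interpret group G by fact
  show *: "q [^]\<^bsub>G\<^esub> (k::nat) \<in> insert \<one>\<^bsub>G\<^esub> T"
    by (induction k) (use assms insert_one_mult(1)[OF assms(1,2)] in auto)
  then show "q [^]\<^bsub>G\<^esub> Suc k \<in> T"
    using insert_one_mult(1)[OF assms(1,2) * assms(3)] by simp
qed

text \<open>
  A word in the elements of \<open>Z\<close>, grown to the left from \<open>g0\<close>, each \<open>z\<close> being used \<open>w z\<close> times.  Its image in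
  the abelian quotient does not depend on the order; the predicate \<open>P\<close> carries along whatever is known of
  its translation part.  The neutral element is adjoined because words may be empty.
\<close>

lemma semigroup_word:
  assumes T: "subsemigroup T (H_group m n)" and Z: "finite Z" "Z \<subseteq> T"
    and g0: "g0 \<in> insert \<one>\<^bsub>H_group m n\<^esub> T" "P g0"
    and P: "\<And>z g. z \<in> Z \<Longrightarrow> g \<in> insert \<one>\<^bsub>H_group m n\<^esub> T \<Longrightarrow> P g \<Longrightarrow> P (z \<otimes>\<^bsub>H_group m n\<^esub> g)"
  shows "\<exists>g\<in>insert \<one>\<^bsub>H_group m n\<^esub> T. P g \<and>
    (\<forall>i. fst g i = (\<Sum>z\<in>Z. real (w z) * fst z i) + fst g0 i) \<and>
    ht g = (\<Sum>z\<in>Z. real (w z) * ht z) + ht g0"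
  using Z P
proof (induction Z rule: finite_induct)
  case empty
  then show ?case using g0 by auto
next
  case (insert z Z)
  have "\<exists>g\<in>insert \<one>\<^bsub>H_group m n\<^esub> T. P g \<and>
    (\<forall>i. fst g i = (\<Sum>z\<in>Z. real (w z) * fst z i) + fst g0 i) \<and>
    ht g = (\<Sum>z\<in>Z. real (w z) * ht z) + ht g0"
    by (rule insert.IH) (use insert.prems in blast)+
  then obtain g where g: "g \<in> insert \<one>\<^bsub>H_group m n\<^esub> T" "P g"
    "\<And>i. fst g i = (\<Sum>z\<in>Z. real (w z) * fst z i) + fst g0 i"
    "ht g = (\<Sum>z\<in>Z. real (w z) * ht z) + ht g0" by blast
  have "\<exists>h\<in>insert \<one>\<^bsub>H_group m n\<^esub> T. P h \<and> (\<forall>i. fst h i = real k * fst z i + fst g i) \<and>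
    ht h = real k * ht z + ht g" for k
  proof (induction k)
    case 0
    then show ?case using g by auto
  next
    case (Suc k)
    then obtain h where h: "h \<in> insert \<one>\<^bsub>H_group m n\<^esub> T" "P h"
      "\<And>i. fst h i = real k * fst z i + fst g i" "ht h = real k * ht z + ht g" by blast
    have "z \<otimes>\<^bsub>H_group m n\<^esub> h \<in> T"
      using insert.prems h by (intro insert_one_mult(2)[OF T group_H_group]) auto
    moreover have "P (z \<otimes>\<^bsub>H_group m n\<^esub> h)" using insert.prems h by blast
    ultimately show ?case using h
      by (intro bexI[of _ "z \<otimes>\<^bsub>H_group m n\<^esub> h"]) (auto simp: H_mult algebra_simps)
  qed
  from this[of "w z"] obtain h where "h \<in> insert \<one>\<^bsub>H_group m n\<^esub> T" "P h"
      "\<And>i. fst h i = real (w z) * fst z i + fst g i" "ht h = real (w z) * ht z + ht g" by blast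
  then show ?case using insert.hyps g by (intro bexI[of _ h]) (auto simp: algebra_simps)
qed

text \<open>
  All contractions of a finite set map a sufficiently large cube \<open>\<bar>x\<^sub>i\<bar> \<le> R\<^sub>0\<close> around the origin into itself.
  So a word in them sends the origin to a point of the cube, and the power of \<open>q\<close> applied last attracts this
  point to the fixed point of \<open>q\<close> exponentially fast.
\<close>

lemma contraction_word:
  assumes T: "subsemigroup T (H_group m n)" and Z: "finite Z" "Z \<subseteq> T" "\<And>z. z \<in> Z \<Longrightarrow> ht z < 0"
    and q: "q \<in> Z"
  shows "\<exists>R. \<forall>w. \<exists>g\<in>insert \<one>\<^bsub>H_group m n\<^esub> T.
    (w q > 0 \<longrightarrow> g \<in> T) \<and>
    (\<forall>i. fst g i = (\<Sum>z\<in>Z. real (w z) * fst z i)) \<and> ht g = (\<Sum>z\<in>Z. real (w z) * ht z) \<and>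
    (\<forall>i<n. \<bar>tr g i - fixpt q i\<bar> \<le> R * exp (real (w q) * ht q))"
proof -
  let ?G = "H_group m n"
  define Rz where "Rz z = (\<Sum>i<n. \<bar>tr z i\<bar>) / (1 - exp (ht z))" for z
  define R0 where "R0 = (\<Sum>z\<in>Z. Rz z)"
  have Rz: "Rz z \<ge> 0" if "z \<in> Z" for z
    using Z(3)[OF that] by (auto simp: Rz_def intro!: divide_nonneg_pos sum_nonneg)
  have inv: "\<bar>tr z i\<bar> + exp (ht z) * R0 \<le> R0" if z: "z \<in> Z" and i: "i < n" for z i
  proof -
    have pos: "1 - exp (ht z) > 0" using Z(3)[OF z] by simp
    have "\<bar>tr z i\<bar> \<le> (\<Sum>i<n. \<bar>tr z i\<bar>)" using i by (intro member_le_sum) auto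
    also have "\<dots> = Rz z * (1 - exp (ht z))" using pos by (simp add: Rz_def)
    also have "\<dots> \<le> R0 * (1 - exp (ht z))"
      unfolding R0_def using pos Rz z Z(1) by (intro mult_right_mono member_le_sum) auto
    finally show ?thesis by (simp add: algebra_simps)
  qed
  define R where "R = R0 + (\<Sum>i<n. \<bar>fixpt q i\<bar>)"
  have "\<exists>g\<in>insert \<one>\<^bsub>?G\<^esub> T.
    (w q > 0 \<longrightarrow> g \<in> T) \<and>
    (\<forall>i. fst g i = (\<Sum>z\<in>Z. real (w z) * fst z i)) \<and> ht g = (\<Sum>z\<in>Z. real (w z) * ht z) \<and>
    (\<forall>i<n. \<bar>tr g i - fixpt q i\<bar> \<le> R * exp (real (w q) * ht q))" for w
  proof -
    have "\<exists>g\<in>insert \<one>\<^bsub>?G\<^esub> T. (\<forall>i<n. \<bar>tr g i\<bar> \<le> R0) \<and>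
      (\<forall>i. fst g i = (\<Sum>z\<in>Z - {q}. real (w z) * fst z i) + fst \<one>\<^bsub>?G\<^esub> i) \<and>
      ht g = (\<Sum>z\<in>Z - {q}. real (w z) * ht z) + ht \<one>\<^bsub>?G\<^esub>"
    proof (rule semigroup_word[OF T])
      show "\<forall>i<n. \<bar>tr \<one>\<^bsub>?G\<^esub> i\<bar> \<le> R0" using Rz by (simp add: H_one R0_def sum_nonneg)
      fix z g assume z: "z \<in> Z - {q}" and g: "\<forall>i<n. \<bar>tr g i\<bar> \<le> R0"
      show "\<forall>i<n. \<bar>tr (z \<otimes>\<^bsub>?G\<^esub> g) i\<bar> \<le> R0"
      proof (intro allI impI)
        fix i assume i: "i < n"
        have "\<bar>tr z i + exp (ht z) * tr g i\<bar> \<le> \<bar>tr z i\<bar> + exp (ht z) * \<bar>tr g i\<bar>"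
          by (metis abs_triangle_ineq abs_mult abs_exp_cancel)
        also have "\<dots> \<le> \<bar>tr z i\<bar> + exp (ht z) * R0" using g i by simp
        finally show "\<bar>tr (z \<otimes>\<^bsub>?G\<^esub> g) i\<bar> \<le> R0" using inv[of z i] z i by (simp add: H_mult)
      qed
    qed (use Z in auto)
    then obtain g where "g \<in> insert \<one>\<^bsub>?G\<^esub> T" "\<forall>i<n. \<bar>tr g i\<bar> \<le> R0"
      "\<forall>i. fst g i = (\<Sum>z\<in>Z - {q}. real (w z) * fst z i) + fst \<one>\<^bsub>?G\<^esub> i"
      "ht g = (\<Sum>z\<in>Z - {q}. real (w z) * ht z) + ht \<one>\<^bsub>?G\<^esub>" by blast
    then have g: "g \<in> insert \<one>\<^bsub>?G\<^esub> T" "\<And>i. i < n \<Longrightarrow> \<bar>tr g i\<bar> \<le> R0"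
      "\<And>i. fst g i = (\<Sum>z\<in>Z - {q}. real (w z) * fst z i)"
      "ht g = (\<Sum>z\<in>Z - {q}. real (w z) * ht z)" by (simp_all add: H_one)
    let ?q = "q [^]\<^bsub>?G\<^esub> w q"
    have qT: "q \<in> T" using q Z by auto
    have q0: "ht q \<noteq> 0" using Z(3)[OF q] by simp
    have "\<bar>tr (?q \<otimes>\<^bsub>?G\<^esub> g) i - fixpt q i\<bar> \<le> R * exp (real (w q) * ht q)" if i: "i < n" for i
    proof -
      have "tr (?q \<otimes>\<^bsub>?G\<^esub> g) i - fixpt q i = (tr g i - fixpt q i) * exp (real (w q) * ht q)"
        using q0 by (simp add: H_mult H_pow algebra_simps)
      moreover have "\<bar>fixpt q i\<bar> \<le> (\<Sum>i<n. \<bar>fixpt q i\<bar>)" using i by (intro member_le_sum) auto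
      then have "\<bar>tr g i - fixpt q i\<bar> \<le> R" using g(2)[OF i] unfolding R_def by linarith
      ultimately show ?thesis by (simp add: abs_mult)
    qed
    moreover have "?q \<otimes>\<^bsub>?G\<^esub> g \<in> insert \<one>\<^bsub>?G\<^esub> T"
      using insert_one_mult(3)[OF T group_H_group pow_in_subsemigroup(1)[OF T group_H_group qT] g(1)] .
    moreover have "?q \<otimes>\<^bsub>?G\<^esub> g \<in> T" if "w q > 0"
      using insert_one_mult(2)[OF T group_H_group pow_in_subsemigroup(2)[OF T group_H_group qT] g(1), of "w q - 1"] that
      by simp
    ultimately show ?thesis using q Z(1) g
      by (intro bexI[of _ "?q \<otimes>\<^bsub>?G\<^esub> g"]) (auto simp: H_mult H_pow sum.remove[of Z q])
  qed
  then show ?thesis by blast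
qed

text \<open>
  An involution that reverses products and exchanges expansions with contractions.  It is inversion
  followed by the automorphism \<open>(v, a, b) \<mapsto> (- v, a, - b)\<close>.
\<close>

definition flip :: "H_elt \<Rightarrow> H_elt" where
  "flip g = (fst g, - ht g, \<lambda>i. exp (- ht g) * tr g i)"

lemma flip_flip [simp]: "flip (flip g) = g"
  by (cases g) (simp add: flip_def flip: mult.assoc exp_add)

lemma flip_mult: "flip (g \<otimes>\<^bsub>H_group m n\<^esub> h) = flip h \<otimes>\<^bsub>H_group m n\<^esub> flip g"
  by (auto simp: flip_def H_mult algebra_simps fun_eq_iff simp flip: exp_add)

lemma subsemigroup_flip:
  assumes "subsemigroup T (H_group m n)"
  shows "subsemigroup (flip ` T) (H_group m n)"
  unfolding subsemigroup_def
proof (intro conjI ballI)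
  show "flip ` T \<subseteq> carrier (H_group m n)"
    using assms by (fastforce simp: subsemigroup_def H_carrier flip_def)
  fix g h assume "g \<in> flip ` T" "h \<in> flip ` T"
  then obtain x y where "x \<in> T" "y \<in> T" and [simp]: "g = flip x" "h = flip y" by auto
  then have "flip (y \<otimes>\<^bsub>H_group m n\<^esub> x) \<in> flip ` T" using assms by (auto simp: subsemigroup_def)
  then show "g \<otimes>\<^bsub>H_group m n\<^esub> h \<in> flip ` T" by (simp add: flip_mult)
qed

text \<open>
  Mirror image of the statement on contractions.  The point \<open>- e\<^bsup>-a\<^esup> b\<close> is the preimage of the origin under
  \<open>(v, a, b)\<close>, so here it is the preimage that is close to the fixed point of \<open>p\<close>.
\<close>

lemma expansion_word:
  assumes T: "subsemigroup T (H_group m n)" and Z: "finite Z" "Z \<subseteq> T" "\<And>z. z \<in> Z \<Longrightarrow> ht z > 0"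
    and p: "p \<in> Z"
  shows "\<exists>R. \<forall>w. \<exists>g\<in>insert \<one>\<^bsub>H_group m n\<^esub> T.
    (\<forall>i. fst g i = (\<Sum>z\<in>Z. real (w z) * fst z i)) \<and> ht g = (\<Sum>z\<in>Z. real (w z) * ht z) \<and>
    (\<forall>i<n. \<bar>exp (- ht g) * tr g i + fixpt p i\<bar> \<le> R * exp (- (real (w p) * ht p)))"
proof -
  let ?G = "H_group m n"
  have inj: "inj_on flip Z" by (metis flip_flip inj_onI)
  have prems: "finite (flip ` Z)" "flip ` Z \<subseteq> flip ` T" "flip p \<in> flip ` Z" using Z p by auto
  have neg: "ht z < 0" if "z \<in> flip ` Z" for z using that Z(3) by (auto simp: flip_def)
  from contraction_word[OF subsemigroup_flip[OF T] prems(1,2) neg prems(3)]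
  obtain R where R: "\<forall>w. \<exists>g\<in>insert \<one>\<^bsub>?G\<^esub> (flip ` T).
    (w (flip p) > 0 \<longrightarrow> g \<in> flip ` T) \<and>
    (\<forall>i. fst g i = (\<Sum>z\<in>flip ` Z. real (w z) * fst z i)) \<and> ht g = (\<Sum>z\<in>flip ` Z. real (w z) * ht z) \<and>
    (\<forall>i<n. \<bar>tr g i - fixpt (flip p) i\<bar> \<le> R * exp (real (w (flip p)) * ht (flip p)))"
    by (rule exE)
  have "\<exists>g\<in>insert \<one>\<^bsub>H_group m n\<^esub> T.
    (\<forall>i. fst g i = (\<Sum>z\<in>Z. real (w z) * fst z i)) \<and> ht g = (\<Sum>z\<in>Z. real (w z) * ht z) \<and>
    (\<forall>i<n. \<bar>exp (- ht g) * tr g i + fixpt p i\<bar> \<le> R * exp (- (real (w p) * ht p)))" for w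
  proof -
    obtain g where g: "g \<in> insert \<one>\<^bsub>?G\<^esub> (flip ` T)"
      "\<And>i. fst g i = (\<Sum>z\<in>flip ` Z. real (w (flip z)) * fst z i)"
      "ht g = (\<Sum>z\<in>flip ` Z. real (w (flip z)) * ht z)"
      "\<And>i. i < n \<Longrightarrow> \<bar>tr g i - fixpt (flip p) i\<bar> \<le> R * exp (real (w (flip (flip p))) * ht (flip p))"
      using R[rule_format, of "\<lambda>z. w (flip z)"] by blast
    have one: "flip \<one>\<^bsub>?G\<^esub> = \<one>\<^bsub>?G\<^esub>" by (simp add: flip_def H_one)
    have "flip g \<in> insert \<one>\<^bsub>?G\<^esub> T" using g(1) one by auto
    moreover have "fst (flip g) i = (\<Sum>z\<in>Z. real (w z) * fst z i)" for i
      using g(2)[of i] by (simp add: sum.reindex[OF inj]) (simp add: flip_def)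
    moreover have "ht (flip g) = (\<Sum>z\<in>Z. real (w z) * ht z)"
      using g(3) by (simp add: sum.reindex[OF inj]) (simp add: flip_def sum_negf)
    moreover have "\<bar>exp (- ht (flip g)) * tr (flip g) i + fixpt p i\<bar> \<le> R * exp (- (real (w p) * ht p))"
      if i: "i < n" for i
    proof -
      have "exp (- ht (flip g)) * tr (flip g) i = tr g i"
        by (simp add: flip_def flip: mult.assoc exp_add)
      moreover have "fixpt (flip p) i = - fixpt p i"
        using Z(3)[OF p] by (simp add: flip_def fixpt_def exp_minus field_simps)
      moreover have "ht (flip p) = - ht p" by (simp add: flip_def)
      ultimately show ?thesis using g(4)[OF i] by simp
    qed
    ultimately show ?thesis by blast
  qed
  then show ?thesis by blast
qed

definition off_half_spaces :: "nat \<Rightarrow> nat \<Rightarrow> H_elt set \<Rightarrow> bool" where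
  "off_half_spaces m n T \<longleftrightarrow> (\<forall>F. half_space_form m n F \<longrightarrow> (\<exists>g\<in>T. F g < 0))"

text \<open>
  If the form is negative at some \<open>z\<close> of height \<open>0\<close>, it is also negative at \<open>z\<^sup>k p\<close> for large \<open>k\<close>.  In this
  way elements of height \<open>0\<close>, which are neither contractions nor expansions, can be avoided.
\<close>

lemma lin_form_negative_off_level:
  assumes T: "subsemigroup T (H_group m n)" and off: "\<exists>g\<in>T. lin_form m f g < 0" and p: "p \<in> T" "ht p \<noteq> 0"
  shows "\<exists>g\<in>T. ht g \<noteq> 0 \<and> lin_form m f g < 0"
proof -
  obtain z where z: "z \<in> T" "lin_form m f z < 0" using off by blast
  show ?thesis
  proof (cases "ht z = 0")
    case True
    have pow: "lin_form m f (z [^]\<^bsub>H_group m n\<^esub> k) = real k * lin_form m f z" for k :: nat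
    proof (induction k)
      case 0
      show ?case by (simp add: lin_form_def H_coord_one)
    qed (simp add: nat_pow_Suc lin_form_mult algebra_simps)
    obtain k :: nat where "lin_form m f p < real k * (- lin_form m f z)"
      using reals_Archimedean3[of "- lin_form m f z"] z by (metis neg_0_less_iff_less)
    then have "lin_form m f (z [^]\<^bsub>H_group m n\<^esub> k \<otimes>\<^bsub>H_group m n\<^esub> p) < 0"
      by (simp add: lin_form_mult pow)
    moreover have "ht (z [^]\<^bsub>H_group m n\<^esub> k \<otimes>\<^bsub>H_group m n\<^esub> p) \<noteq> 0"
      using True p by (simp add: H_mult H_pow)
    moreover have "z [^]\<^bsub>H_group m n\<^esub> k \<otimes>\<^bsub>H_group m n\<^esub> p \<in> T"
      using insert_one_mult(1)[OF T group_H_group pow_in_subsemigroup(1)[OF T group_H_group z(1)] p(1)] .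
    ultimately show ?thesis by blast
  qed (use z in auto)
qed

text \<open>
  Let \<open>g\<^sub>k\<close> collect the contractions and \<open>h\<^sub>k\<close> the expansions of the \<open>k\<close>-th near-dependence.  The preimage of the
  origin under \<open>h\<^sub>k\<close> tends to the fixed point of \<open>p\<close>, the image of the origin under \<open>g\<^sub>k\<close> tends to the fixed
  point of \<open>q\<close>, and the image of \<open>g\<^sub>k h\<^sub>k\<close> in \<open>\<real>\<^sup>m\<close> tends to \<open>0\<close>.  Therefore \<open>g\<^sub>k h\<^sub>k\<close> converges to the
  translation that takes the first fixed point to the second.
\<close>

lemma translation_between_fixpoints:
  assumes T: "subsemigroup T (H_group m n)" "closedin (H_top m n) T" and off: "off_half_spaces m n T"
    and p: "p \<in> T" "ht p > 0" and q: "q \<in> T" "ht q < 0" and m: "m \<ge> 1"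
  shows "(\<lambda>i. 0, 0, \<lambda>i. fixpt q i - fixpt p i) \<in> T"
proof -
  let ?G = "H_group m n"
  let ?I = "{g \<in> T. ht g \<noteq> 0}"
  have "\<forall>f. (\<exists>i<m. f i \<noteq> 0) \<longrightarrow> (\<exists>z\<in>?I. (\<Sum>i<m. f i * H_coord m i z) < 0)"
  proof (intro allI impI)
    fix f :: "nat \<Rightarrow> real" assume "\<exists>i<m. f i \<noteq> 0"
    then have "\<exists>g\<in>T. lin_form m f g < 0"
      using off unfolding off_half_spaces_def half_space_form_def by blast
    then have "\<exists>g\<in>T. ht g \<noteq> 0 \<and> lin_form m f g < 0"
      by (rule lin_form_negative_off_level[OF T(1) _ p(1)]) (use p(2) in simp)
    then show "\<exists>z\<in>?I. (\<Sum>i<m. f i * H_coord m i z) < 0" unfolding lin_form_def by blast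
  qed
  moreover have "finite {p, q}" "{p, q} \<subseteq> ?I" using p q by auto
  ultimately obtain Z and w :: "nat \<Rightarrow> H_elt \<Rightarrow> nat" where Z: "finite Z" "{p, q} \<subseteq> Z" "Z \<subseteq> ?I"
    and w: "\<And>z. z \<in> Z \<Longrightarrow> filterlim (\<lambda>k. w k z) at_top sequentially"
    and lim: "\<And>i. i < m \<Longrightarrow> (\<lambda>k. \<Sum>z\<in>Z. real (w k z) * H_coord m i z) \<longlonglongrightarrow> 0"
    by (rule integral_near_dependence) blast
  let ?N = "{z \<in> Z. ht z < 0}" and ?P = "{z \<in> Z. ht z > 0}"
  obtain R1 where "\<forall>w. \<exists>g\<in>insert \<one>\<^bsub>?G\<^esub> T. (w q > 0 \<longrightarrow> g \<in> T) \<and>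
    (\<forall>i. fst g i = (\<Sum>z\<in>?N. real (w z) * fst z i)) \<and> ht g = (\<Sum>z\<in>?N. real (w z) * ht z) \<and>
    (\<forall>i<n. \<bar>tr g i - fixpt q i\<bar> \<le> R1 * exp (real (w q) * ht q))"
  proof -
    have "finite ?N" "?N \<subseteq> T" "\<And>z. z \<in> ?N \<Longrightarrow> ht z < 0" "q \<in> ?N" using Z q by auto
    from contraction_word[OF T(1) this] that show thesis by blast
  qed
  then have "\<forall>k. \<exists>g. g \<in> insert \<one>\<^bsub>?G\<^esub> T \<and> (w k q > 0 \<longrightarrow> g \<in> T) \<and>
    (\<forall>i. fst g i = (\<Sum>z\<in>?N. real (w k z) * fst z i)) \<and> ht g = (\<Sum>z\<in>?N. real (w k z) * ht z) \<and>
    (\<forall>i<n. \<bar>tr g i - fixpt q i\<bar> \<le> R1 * exp (real (w k q) * ht q))" by blast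
  from choice[OF this] obtain g where g: "\<And>k. w k q > 0 \<Longrightarrow> g k \<in> T"
    "\<And>k i. fst (g k) i = (\<Sum>z\<in>?N. real (w k z) * fst z i)" "\<And>k. ht (g k) = (\<Sum>z\<in>?N. real (w k z) * ht z)"
    "\<And>k i. i < n \<Longrightarrow> \<bar>tr (g k) i - fixpt q i\<bar> \<le> R1 * exp (real (w k q) * ht q)" by blast
  obtain R2 where "\<forall>w. \<exists>g\<in>insert \<one>\<^bsub>?G\<^esub> T.
    (\<forall>i. fst g i = (\<Sum>z\<in>?P. real (w z) * fst z i)) \<and> ht g = (\<Sum>z\<in>?P. real (w z) * ht z) \<and>
    (\<forall>i<n. \<bar>exp (- ht g) * tr g i + fixpt p i\<bar> \<le> R2 * exp (- (real (w p) * ht p)))"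
  proof -
    have "finite ?P" "?P \<subseteq> T" "\<And>z. z \<in> ?P \<Longrightarrow> ht z > 0" "p \<in> ?P" using Z p by auto
    from expansion_word[OF T(1) this] that show thesis by blast
  qed
  then have "\<forall>k. \<exists>g. g \<in> insert \<one>\<^bsub>?G\<^esub> T \<and>
    (\<forall>i. fst g i = (\<Sum>z\<in>?P. real (w k z) * fst z i)) \<and> ht g = (\<Sum>z\<in>?P. real (w k z) * ht z) \<and>
    (\<forall>i<n. \<bar>exp (- ht g) * tr g i + fixpt p i\<bar> \<le> R2 * exp (- (real (w k p) * ht p)))" by blast
  from choice[OF this] obtain h where h: "\<And>k. h k \<in> insert \<one>\<^bsub>?G\<^esub> T"
    "\<And>k i. fst (h k) i = (\<Sum>z\<in>?P. real (w k z) * fst z i)" "\<And>k. ht (h k) = (\<Sum>z\<in>?P. real (w k z) * ht z)"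
    "\<And>k i. i < n \<Longrightarrow> \<bar>exp (- ht (h k)) * tr (h k) i + fixpt p i\<bar> \<le> R2 * exp (- (real (w k p) * ht p))" by blast
  have split: "(\<Sum>z\<in>?N. F z) + (\<Sum>z\<in>?P. F z) = (\<Sum>z\<in>Z. F z)" for F :: "H_elt \<Rightarrow> real"
  proof -
    have "Z = ?N \<union> ?P" using Z(3) by auto
    then show ?thesis using Z(1) by (subst sum.union_disjoint[symmetric]) auto
  qed
  have htlim: "(\<lambda>k. ht (g k) + ht (h k)) \<longlonglongrightarrow> 0"
    using lim[of "m - 1"] m by (simp add: g h split H_coord_eq)
  have decay: "(\<lambda>k. R * exp (c * real (w k z))) \<longlonglongrightarrow> 0" if "z \<in> Z" "c < 0" for R c z
  proof -
    have "filterlim (\<lambda>k. real (w k z)) at_top sequentially"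
      using w[OF that(1)] filterlim_compose[OF filterlim_real_sequentially] by blast
    then have "filterlim (\<lambda>k. c * real (w k z)) at_bot sequentially"
      using that(2) by (intro filterlim_tendsto_neg_mult_at_bot[OF tendsto_const])
    then have "(\<lambda>k. exp (c * real (w k z))) \<longlonglongrightarrow> 0"
      using filterlim_compose[OF exp_at_bot] by blast
    then show ?thesis by (rule tendsto_mult_right_zero)
  qed
  have glim: "(\<lambda>k. tr (g k) i) \<longlonglongrightarrow> fixpt q i" if "i < n" for i
  proof -
    have "(\<lambda>k. tr (g k) i - fixpt q i) \<longlonglongrightarrow> 0"
    proof (rule Lim_null_comparison)
      show "\<forall>\<^sub>F k in sequentially. norm (tr (g k) i - fixpt q i) \<le> R1 * exp (ht q * real (w k q))"
        using g(4)[OF that] by (simp add: mult.commute)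
    qed (use decay[of q "ht q" R1] q Z in auto)
    then show ?thesis by (simp add: LIM_zero_iff)
  qed
  have hlim: "(\<lambda>k. exp (- ht (h k)) * tr (h k) i) \<longlonglongrightarrow> - fixpt p i" if "i < n" for i
  proof -
    have "(\<lambda>k. exp (- ht (h k)) * tr (h k) i - (- fixpt p i)) \<longlonglongrightarrow> 0"
    proof (rule Lim_null_comparison)
      show "\<forall>\<^sub>F k in sequentially. norm (exp (- ht (h k)) * tr (h k) i - (- fixpt p i)) \<le> R2 * exp (- ht p * real (w k p))"
        using h(4)[OF that] by (simp add: mult.commute)
    qed (use decay[of p "- ht p" R2] p Z in auto)
    then show ?thesis by (simp only: LIM_zero_iff)
  qed
  show ?thesis
  proof (rule closedin_H_eventually[OF T(2), of "\<lambda>k. g k \<otimes>\<^bsub>?G\<^esub> h k"])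
    have "\<forall>\<^sub>F k in sequentially. w k q \<ge> 1"
      using w[of q] Z by (auto simp: filterlim_at_top)
    then show "\<forall>\<^sub>F k in sequentially. g k \<otimes>\<^bsub>?G\<^esub> h k \<in> T"
      by eventually_elim (intro insert_one_mult(2)[OF T(1) group_H_group] g(1) h(1), simp)
    show "(\<lambda>i. 0, 0, \<lambda>i. fixpt q i - fixpt p i) \<in> carrier ?G"
    proof -
      have "p \<in> carrier ?G" "q \<in> carrier ?G" using p q T by (auto simp: subsemigroup_def)
      then show ?thesis by (simp add: H_carrier fixpt_def)
    qed
  next
    fix i assume "i < m - 1"
    then show "(\<lambda>k. fst (g k \<otimes>\<^bsub>?G\<^esub> h k) i) \<longlonglongrightarrow> fst (\<lambda>i. 0, 0, \<lambda>i. fixpt q i - fixpt p i) i"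
      using lim[of i] by (simp add: H_mult g h split H_coord_eq)
  next
    show "(\<lambda>k. ht (g k \<otimes>\<^bsub>?G\<^esub> h k)) \<longlonglongrightarrow> ht (\<lambda>i. 0, 0, \<lambda>i. fixpt q i - fixpt p i)"
      using htlim by (simp add: H_mult)
  next
    fix i assume i: "i < n"
    have "(\<lambda>k. tr (g k) i + exp (ht (g k) + ht (h k)) * (exp (- ht (h k)) * tr (h k) i))
        \<longlonglongrightarrow> fixpt q i + exp 0 * (- fixpt p i)"
      by (intro tendsto_intros glim[OF i] hlim[OF i] htlim)
    moreover have "exp (ht (g k) + ht (h k)) * (exp (- ht (h k)) * tr (h k) i) = exp (ht (g k)) * tr (h k) i" for k
      by (simp flip: mult.assoc exp_add)
    ultimately show "(\<lambda>k. tr (g k \<otimes>\<^bsub>?G\<^esub> h k) i) \<longlonglongrightarrow> tr (\<lambda>i. 0, 0, \<lambda>i. fixpt q i - fixpt p i) i"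
      by (simp add: H_mult)
  qed
qed

lemma translation_combination:
  assumes T: "subsemigroup T (H_group m n)" and Z: "finite Z" "\<And>u. u \<in> Z \<Longrightarrow> (\<lambda>i. 0, 0, u) \<in> T"
  shows "(\<lambda>i. 0, 0, \<lambda>i. \<Sum>u\<in>Z. real (N u) * u i) \<in> insert \<one>\<^bsub>H_group m n\<^esub> T"
  using Z
proof (induction Z rule: finite_induct)
  case empty
  then show ?case by (simp add: H_one)
next
  case (insert u Z)
  let ?G = "H_group m n"
  have "(\<lambda>i. 0, 0, \<lambda>i. real k * u i) \<in> insert \<one>\<^bsub>?G\<^esub> T" for k
  proof (induction k)
    case 0
    then show ?case by (simp add: H_one)
  next
    case (Suc k)
    have "(\<lambda>i. 0, 0, \<lambda>i. real k * u i) \<otimes>\<^bsub>?G\<^esub> (\<lambda>i. 0, 0, u) \<in> T"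
      using insert.prems by (intro insert_one_mult(1)[OF T group_H_group Suc.IH]) auto
    then show ?case by (simp add: H_mult algebra_simps)
  qed
  then have "(\<lambda>i. 0, 0, \<lambda>i. real (N u) * u i) \<otimes>\<^bsub>?G\<^esub> (\<lambda>i. 0, 0, \<lambda>i. \<Sum>u\<in>Z. real (N u) * u i)
      \<in> insert \<one>\<^bsub>?G\<^esub> T"
    by (intro insert_one_mult(3)[OF T group_H_group] insert.IH insert.prems) auto
  then show ?case using insert.hyps by (simp add: H_mult)
qed

text \<open>
  Otherwise \<open>\<gamma>\<close> is at most as large on the fixed points of expansions as on those of contractions.  A level
  \<open>s\<close> between the two sets of values then gives an affine form that is nonnegative on all elements of nonzero
  height.  It is nonnegative at an element \<open>g\<close> of height \<open>0\<close> too, because \<open>g\<^sup>k p\<close> is an expansion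
  for all \<open>k\<close>.
\<close>

lemma translations_off_half_spaces:
  assumes T: "subsemigroup T (H_group m n)" "closedin (H_top m n) T" and off: "off_half_spaces m n T"
    and p: "p \<in> T" "ht p > 0" and q: "q \<in> T" "ht q < 0" and m: "m \<ge> 1"
    and \<gamma>: "\<exists>i<n. \<gamma> i \<noteq> 0"
  shows "\<exists>u. (\<lambda>i. 0, 0, u) \<in> T \<and> (\<Sum>i<n. \<gamma> i * u i) < 0"
proof (rule ccontr)
  assume "\<not> ?thesis"
  then have nonneg: "(\<Sum>i<n. \<gamma> i * u i) \<ge> 0" if "(\<lambda>i. 0, 0, u) \<in> T" for u
    using that by (meson not_le)
  define y where "y g = (\<Sum>i<n. \<gamma> i * fixpt g i)" for g
  have tr: "(\<Sum>i<n. \<gamma> i * tr g i) = (1 - exp (ht g)) * y g" if "ht g \<noteq> 0" for g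
    using that by (simp add: y_def fixpt_def sum_distrib_left)
  have le: "y p' \<le> y q'" if "p' \<in> T" "ht p' > 0" "q' \<in> T" "ht q' < 0" for p' q'
    using nonneg[OF translation_between_fixpoints[OF T off that m]]
    by (simp add: y_def algebra_simps sum_subtractf)
  \<comment> \<open>Any contraction bounds these values, and \<open>p\<close> is an expansion, so the supremum is meaningful.\<close>
  define s where "s = Sup (y ` {g \<in> T. ht g > 0})"
  have up: "y p' \<le> s" if "p' \<in> T" "ht p' > 0" for p'
    unfolding s_def using le[OF _ _ q] that by (intro cSup_upper bdd_aboveI2[where M = "y q"]) auto
  have low: "s \<le> y q'" if "q' \<in> T" "ht q' < 0" for q'
  proof -
    have "p \<in> {g \<in> T. ht g > 0}" using p by blast
    then show ?thesis unfolding s_def using le[OF _ _ that] by (intro cSup_least) blast+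
  qed
  have lower: "(\<Sum>i<n. \<gamma> i * tr g i) \<ge> - s * (exp (ht g) - 1)" if g: "g \<in> T" "ht g \<noteq> 0" for g
  proof -
    have "(1 - exp (ht g)) * s \<le> (1 - exp (ht g)) * y g"
    proof (cases "ht g > 0")
      case True
      then show ?thesis using up[OF g(1)] by (intro mult_left_mono_neg) auto
    next
      case False
      then show ?thesis using low[OF g(1)] g(2) by (intro mult_left_mono) auto
    qed
    then show ?thesis using tr[OF g(2)] by (simp add: algebra_simps)
  qed
  have "aff_form n \<gamma> (- s) g \<ge> 0" if g: "g \<in> T" for g
  proof (cases "ht g = 0")
    case False
    then show ?thesis using lower[OF g] by (simp add: aff_form_def)
  next
    case True
    let ?b = "\<Sum>i<n. \<gamma> i * tr g i"
    have step: "- s * (exp (ht p) - 1) \<le> real k * ?b + (\<Sum>i<n. \<gamma> i * tr p i)" for k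
    proof -
      have trpow: "tr (g [^]\<^bsub>H_group m n\<^esub> k) i = real k * tr g i" for i
        by (induction k) (simp_all add: nat_pow_0 nat_pow_Suc H_one H_mult H_pow True algebra_simps)
      let ?h = "g [^]\<^bsub>H_group m n\<^esub> k \<otimes>\<^bsub>H_group m n\<^esub> p"
      have "?h \<in> T"
        using insert_one_mult(1)[OF T(1) group_H_group pow_in_subsemigroup(1)[OF T(1) group_H_group g] p(1)] .
      moreover have "ht ?h = ht p" by (simp add: H_mult H_pow True)
      moreover have "(\<Sum>i<n. \<gamma> i * tr ?h i) = real k * ?b + (\<Sum>i<n. \<gamma> i * tr p i)"
        by (simp add: H_mult H_pow True trpow algebra_simps sum.distrib sum_distrib_left)
      ultimately show ?thesis using lower[of ?h] p by simp
    qed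
    have "?b \<ge> 0"
    proof (rule ccontr)
      assume "\<not> ?b \<ge> 0"
      then have "- ?b > 0" by simp
      then obtain k :: nat where "s * (exp (ht p) - 1) + (\<Sum>i<n. \<gamma> i * tr p i) < real k * - ?b"
        using reals_Archimedean3 by blast
      then show False using step[of k] by simp
    qed
    then show ?thesis using True by (simp add: aff_form_def)
  qed
  moreover have "half_space_form m n (aff_form n \<gamma> (- s))"
    using \<gamma> by (auto simp: half_space_form_def)
  ultimately show False using off unfolding off_half_spaces_def by (meson not_le)
qed

lemma floor_scaling_limit:
  fixes e :: "nat \<Rightarrow> real"
  assumes "e \<longlonglongrightarrow> 0" "\<And>k. e k > 0" "t \<ge> 0"
  shows "(\<lambda>k. e k * real (nat \<lfloor>t / e k\<rfloor>)) \<longlonglongrightarrow> t"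
proof -
  have "\<bar>e k * real (nat \<lfloor>t / e k\<rfloor>) - t\<bar> \<le> e k" for k
  proof -
    have "real (nat \<lfloor>t / e k\<rfloor>) = of_int \<lfloor>t / e k\<rfloor>"
      using assms(2)[of k] assms(3) by (simp add: of_nat_nat)
    moreover have "of_int \<lfloor>t / e k\<rfloor> \<le> t / e k" "t / e k \<le> of_int \<lfloor>t / e k\<rfloor> + 1" by linarith+
    ultimately have "real (nat \<lfloor>t / e k\<rfloor>) * e k \<le> t" "t \<le> (real (nat \<lfloor>t / e k\<rfloor>) + 1) * e k"
      using assms(2)[of k] by (simp_all only: pos_le_divide_eq pos_divide_le_eq)
    then show ?thesis by (simp add: algebra_simps abs_le_iff)
  qed
  then have "(\<lambda>k. e k * real (nat \<lfloor>t / e k\<rfloor>) - t) \<longlonglongrightarrow> 0"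
    by (intro Lim_null_comparison[OF _ assms(1)]) auto
  then show ?thesis by (simp add: LIM_zero_iff)
qed

text \<open>
  Write \<open>y - (x\<^sub>q - x\<^sub>p)\<close> as a combination \<open>\<Sum> t\<^sub>u u\<close> of translations in \<open>T\<close> with \<open>t\<^sub>u \<ge> 0\<close>.  The contraction
  \<open>q\<^sup>k \<tau> q\<^sup>k\<close>, where \<open>\<tau>\<close> is an integral combination of these translations with coefficients close to
  \<open>e\<^bsup>-k a\<^esup> t\<^sub>u\<close> for the height \<open>a\<close> of \<open>q\<close>, has its fixed point close to \<open>x\<^sub>q + \<Sum> t\<^sub>u u\<close>.  Its distance vector
  from \<open>x\<^sub>p\<close> is a translation in \<open>T\<close> and tends to \<open>y\<close>.
\<close>

lemma all_translations:
  assumes T: "subsemigroup T (H_group m n)" "closedin (H_top m n) T" and off: "off_half_spaces m n T"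
    and m: "m \<ge> 1" and y: "\<And>i. i \<ge> n \<Longrightarrow> y i = 0"
  shows "(\<lambda>i. 0, 0, y) \<in> T"
proof -
  let ?G = "H_group m n"
  have lin: "\<exists>g\<in>T. r * ht g < 0" if "r \<noteq> 0" for r
  proof -
    have "half_space_form m n (lin_form m (\<lambda>i. if i = m - 1 then r else 0))"
      unfolding half_space_form_def using that m by (intro disjI1 exI[of _ "\<lambda>i. if i = m - 1 then r else 0"]) (auto intro: exI[of _ "m - 1"])
    moreover have "lin_form m (\<lambda>i. if i = m - 1 then r else 0) g = r * ht g" for g
    proof -
      have "lin_form m (\<lambda>i. if i = m - 1 then r else 0) g = (\<Sum>i<m. if i = m - 1 then r * ht g else 0)"
        unfolding lin_form_def by (intro sum.cong) (auto simp: H_coord_eq)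
      then show ?thesis using m by simp
    qed
    ultimately show ?thesis using off unfolding off_half_spaces_def by metis
  qed
  obtain p where p: "p \<in> T" "ht p > 0" using lin[of "-1"] by auto
  obtain q where q: "q \<in> T" "ht q < 0" using lin[of 1] by auto
  define x where "x i = fixpt q i - fixpt p i" for i
  define v where "v i = - (y i - x i)" for i
  \<comment> \<open>Adjoining the negative \<open>v\<close> of the target vector puts the latter into the cone of the translations.\<close>
  let ?I = "insert v {u. (\<lambda>i. 0, 0, u) \<in> T}"
  have "\<forall>f. (\<exists>i<n. f i \<noteq> 0) \<longrightarrow> (\<exists>z\<in>?I. (\<Sum>i<n. f i * z i) < 0)"
    using translations_off_half_spaces[OF T off p q m] by blast
  moreover have "finite {v}" "{v} \<subseteq> ?I" by auto
  ultimately obtain Z c where Z: "finite Z" "{v} \<subseteq> Z" "Z \<subseteq> ?I" and c: "\<And>z. z \<in> Z \<Longrightarrow> c z > 0"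
    "\<And>i. i < n \<Longrightarrow> (\<Sum>z\<in>Z. c z * z i) = 0"
    by (rule positive_dependence[where x = "\<lambda>z. z"]) blast
  define Z' where "Z' = Z - {v}"
  have Z': "finite Z'" "\<And>u. u \<in> Z' \<Longrightarrow> (\<lambda>i. 0, 0, u) \<in> T" using Z by (auto simp: Z'_def)
  define t where "t u = c u / c v" for u
  have t: "t u \<ge> 0" if "u \<in> Z'" for u using c(1)[of u] c(1)[of v] that Z by (simp add: t_def Z'_def)
  have sum: "x i + (\<Sum>u\<in>Z'. t u * u i) = y i" if i: "i < n" for i
  proof -
    have "c v * v i + (\<Sum>u\<in>Z'. c u * u i) = 0"
      using c(2)[OF i] Z by (simp add: Z'_def sum.remove[of Z v])
    moreover have "(\<Sum>u\<in>Z'. c u * u i) = c v * (\<Sum>u\<in>Z'. t u * u i)"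
      using c(1)[of v] Z by (simp add: t_def sum_distrib_left)
    ultimately have "c v * (v i + (\<Sum>u\<in>Z'. t u * u i)) = 0" by (simp add: algebra_simps)
    then show ?thesis using c(1)[of v] Z by (simp add: v_def)
  qed
  define e where "e k = exp (real (Suc k) * ht q)" for k
  have e0: "e \<longlonglongrightarrow> 0"
  proof -
    have "filterlim (\<lambda>k. ht q * real (Suc k)) at_bot sequentially"
      using q(2) filterlim_compose[OF filterlim_real_sequentially filterlim_Suc]
      by (intro filterlim_tendsto_neg_mult_at_bot[OF tendsto_const])
    then have "(\<lambda>k. exp (ht q * real (Suc k))) \<longlonglongrightarrow> 0"
      using filterlim_compose[OF exp_at_bot] by blast
    then show ?thesis by (simp add: e_def[abs_def] mult.commute)
  qed
  have epos: "e k > 0" for k by (simp add: e_def)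
  have e1: "e k < 1" for k using q(2) by (simp add: e_def mult_pos_neg)
  define u where "u k i = (\<Sum>u\<in>Z'. real (nat \<lfloor>t u / e k\<rfloor>) * u i)" for k i
  have ulim: "(\<lambda>k. e k * u k i) \<longlonglongrightarrow> (\<Sum>u\<in>Z'. t u * u i)" for i
  proof -
    have "(\<lambda>k. \<Sum>u\<in>Z'. (e k * real (nat \<lfloor>t u / e k\<rfloor>)) * u i) \<longlonglongrightarrow> (\<Sum>u\<in>Z'. t u * u i)"
      using floor_scaling_limit[OF e0 epos t] by (intro tendsto_intros) auto
    then show ?thesis by (simp add: u_def sum_distrib_left mult.assoc)
  qed
  let ?q = "\<lambda>k. q [^]\<^bsub>?G\<^esub> Suc k"
  let ?\<tau> = "\<lambda>k. (\<lambda>i. 0, 0, u k)"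
  define w where "w k = ?q k \<otimes>\<^bsub>?G\<^esub> (?\<tau> k \<otimes>\<^bsub>?G\<^esub> ?q k)" for k
  have wT: "w k \<in> T" for k
  proof -
    have "?\<tau> k \<in> insert \<one>\<^bsub>?G\<^esub> T"
      using translation_combination[OF T(1) Z'] by (simp add: u_def[abs_def])
    from insert_one_mult(1)[OF T(1) group_H_group this pow_in_subsemigroup(2)[OF T(1) group_H_group q(1)]]
    have "?\<tau> k \<otimes>\<^bsub>?G\<^esub> ?q k \<in> T" .
    then show ?thesis
      using T(1) pow_in_subsemigroup(2)[OF T(1) group_H_group q(1)] by (auto simp: w_def subsemigroup_def simp del: nat_pow_Suc)
  qed
  have ht_w: "ht (w k) = 2 * real (Suc k) * ht q" for k
    by (simp del: nat_pow_Suc of_nat_Suc add: w_def H_mult H_pow)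
  have exp_w: "exp (ht (w k)) = e k * e k" for k
    unfolding ht_w e_def by (simp del: of_nat_Suc flip: exp_add)
  have q0: "ht q \<noteq> 0" using q by simp
  have tr_w: "tr (w k) i = (1 - e k * e k) * fixpt q i + e k * u k i" for k i
    by (simp del: nat_pow_Suc of_nat_Suc add: w_def H_mult H_pow q0 flip: e_def) (simp add: algebra_simps)
  have fix_w: "fixpt (w k) i = fixpt q i + e k * u k i / (1 - e k * e k)" for k i
  proof -
    have "e k * e k < 1 * 1" using epos[of k] e1[of k] by (intro mult_strict_mono) auto
    then show ?thesis by (simp add: fixpt_def exp_w tr_w add_divide_distrib)
  qed
  have neg: "ht (w k) < 0" for k unfolding ht_w using q(2) by (intro mult_pos_neg) auto
  show ?thesis
  proof (rule closedin_H_eventually[OF T(2), of "\<lambda>k. (\<lambda>i. 0, 0, \<lambda>i. fixpt (w k) i - fixpt p i)"])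
    show "\<forall>\<^sub>F k in sequentially. (\<lambda>i. 0, 0, \<lambda>i. fixpt (w k) i - fixpt p i) \<in> T"
      using translation_between_fixpoints[OF T off p wT neg m] by simp
    show "(\<lambda>i. 0, 0, y) \<in> carrier ?G" using y by (simp add: H_carrier)
  next
    fix i assume i: "i < n"
    have "(\<lambda>k. fixpt q i + e k * u k i / (1 - e k * e k) - fixpt p i)
       \<longlonglongrightarrow> fixpt q i + (\<Sum>u\<in>Z'. t u * u i) / (1 - 0 * 0) - fixpt p i"
      by (intro tendsto_intros ulim e0) auto
    moreover have "fixpt q i + (\<Sum>u\<in>Z'. t u * u i) / (1 - 0 * 0) - fixpt p i = y i"
      using sum[OF i] by (simp add: x_def)
    ultimately show "(\<lambda>k. tr (\<lambda>i. 0, 0, \<lambda>i. fixpt (w k) i - fixpt p i) i) \<longlonglongrightarrow> tr (\<lambda>i. 0, 0, y) i"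
      by (simp add: fix_w)
  qed auto
qed

text \<open>
  For \<open>s \<in> T\<close> a near-dependence that involves \<open>s\<close> gives, after one occurrence of \<open>s\<close> is removed, elements
  of \<open>T\<close> whose images in \<open>\<real>\<^sup>m\<close> tend to that of the inverse of \<open>s\<close>.  As all translations are in \<open>T\<close>, their
  translation parts can be made equal to that of the inverse.
\<close>

theorem subgroup_if_off_half_spaces:
  assumes T: "subsemigroup T (H_group m n)" "closedin (H_top m n) T" and off: "off_half_spaces m n T"
    and m: "m \<ge> 1"
  shows "subgroup T (H_group m n)"
proof -
  let ?G = "H_group m n"
  interpret G: group ?G by (rule group_H_group)
  note transl = all_translations[OF T off m]
  have one: "\<one>\<^bsub>?G\<^esub> \<in> T" using transl[of "\<lambda>_. 0"] by (simp add: H_one)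
  have car: "T \<subseteq> carrier ?G" using T(1) by (simp add: subsemigroup_def)
  have "inv\<^bsub>?G\<^esub> s \<in> T" if s: "s \<in> T" for s
  proof -
    have sc: "s \<in> carrier ?G" using s car by blast
    have "\<forall>f. (\<exists>i<m. f i \<noteq> 0) \<longrightarrow> (\<exists>z\<in>T. (\<Sum>i<m. f i * H_coord m i z) < 0)"
      using off unfolding off_half_spaces_def half_space_form_def lin_form_def[abs_def] by blast
    moreover have "finite {s}" "{s} \<subseteq> T" using s by auto
    ultimately obtain Z and w :: "nat \<Rightarrow> H_elt \<Rightarrow> nat" where Z: "finite Z" "{s} \<subseteq> Z" "Z \<subseteq> T"
      and w: "\<And>z. z \<in> Z \<Longrightarrow> filterlim (\<lambda>k. w k z) at_top sequentially"
      and lim: "\<And>i. i < m \<Longrightarrow> (\<lambda>k. \<Sum>z\<in>Z. real (w k z) * H_coord m i z) \<longlonglongrightarrow> 0"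
      by (rule integral_near_dependence) blast
    define w' where "w' k = (w k)(s := w k s - 1)" for k
    have "\<exists>g. g \<in> T \<and> (\<forall>i. fst g i = (\<Sum>z\<in>Z. real (w' k z) * fst z i)) \<and>
        ht g = (\<Sum>z\<in>Z. real (w' k z) * ht z)" for k
    proof -
      have "\<exists>g\<in>insert \<one>\<^bsub>?G\<^esub> T. True \<and>
        (\<forall>i. fst g i = (\<Sum>z\<in>Z. real (w' k z) * fst z i) + fst \<one>\<^bsub>?G\<^esub> i) \<and>
        ht g = (\<Sum>z\<in>Z. real (w' k z) * ht z) + ht \<one>\<^bsub>?G\<^esub>"
        by (rule semigroup_word[OF T(1) Z(1,3)]) auto
      moreover have "fst \<one>\<^bsub>?G\<^esub> i = 0" "ht \<one>\<^bsub>?G\<^esub> = 0" for i by (simp_all add: H_one)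
      moreover have "insert \<one>\<^bsub>?G\<^esub> T = T" using one by blast
      ultimately show ?thesis by (simp only: add_0_right simp_thms Bex_def)
    qed
    then have "\<forall>k. \<exists>g. g \<in> T \<and> (\<forall>i. fst g i = (\<Sum>z\<in>Z. real (w' k z) * fst z i)) \<and>
        ht g = (\<Sum>z\<in>Z. real (w' k z) * ht z)" by blast
    from choice[OF this] obtain g where g: "\<And>k. g k \<in> T"
      "\<And>k i. fst (g k) i = (\<Sum>z\<in>Z. real (w' k z) * fst z i)"
      "\<And>k. ht (g k) = (\<Sum>z\<in>Z. real (w' k z) * ht z)" by blast
    have sum: "(\<Sum>z\<in>Z. real (w' k z) * F z) = (\<Sum>z\<in>Z. real (w k z) * F z) - F s"
      if "w k s \<ge> 1" for k and F :: "H_elt \<Rightarrow> real"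
    proof -
      have "(\<Sum>z\<in>Z - {s}. real (w' k z) * F z) = (\<Sum>z\<in>Z - {s}. real (w k z) * F z)"
        by (intro sum.cong) (auto simp: w'_def)
      moreover have eq: "real (w' k s) = real (w k s) - 1" using that by (simp add: w'_def)
      ultimately show ?thesis using Z by (simp add: sum.remove[of Z s] eq left_diff_distrib)
    qed
    have ev: "\<forall>\<^sub>F k in sequentially. w k s \<ge> 1"
      using w[of s] Z by (auto simp: filterlim_at_top)
    have limF: "(\<lambda>k. \<Sum>z\<in>Z. real (w' k z) * F z) \<longlonglongrightarrow> - F s"
      if "(\<lambda>k. \<Sum>z\<in>Z. real (w k z) * F z) \<longlonglongrightarrow> 0" for F :: "H_elt \<Rightarrow> real"
    proof -
      have "(\<lambda>k. (\<Sum>z\<in>Z. real (w k z) * F z) - F s) \<longlonglongrightarrow> 0 - F s"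
        by (intro tendsto_intros that)
      moreover have "\<forall>\<^sub>F k in sequentially. (\<Sum>z\<in>Z. real (w k z) * F z) - F s = (\<Sum>z\<in>Z. real (w' k z) * F z)"
        using ev by eventually_elim (simp add: sum)
      ultimately show ?thesis using Lim_transform_eventually by fastforce
    qed
    \<comment> \<open>The translation that corrects the translation part of \<open>g k\<close> to that of the inverse of \<open>s\<close>.\<close>
    define y where "y k i = - exp (- ht (g k)) * (tr (g k) i + exp (- ht s) * tr s i)" for k i
    define h where "h k = g k \<otimes>\<^bsub>?G\<^esub> (\<lambda>i. 0, 0, y k)" for k
    have "(\<lambda>i. 0, 0, y k) \<in> T" for k
      using subsetD[OF car g(1)[of k]] sc by (intro transl) (simp add: y_def H_carrier)
    then have hT: "h k \<in> T" for k using g(1) T(1) by (auto simp: h_def subsemigroup_def)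
    have trh: "tr (h k) i = - (exp (- ht s) * tr s i)" for k i
      by (simp add: h_def H_mult y_def algebra_simps flip: exp_add)
    show ?thesis
    proof (rule closedin_H_eventually[OF T(2), of h])
      show "inv\<^bsub>?G\<^esub> s \<in> carrier ?G" using sc by simp
    next
      fix i assume "i < m - 1"
      then show "(\<lambda>k. fst (h k) i) \<longlonglongrightarrow> fst (inv\<^bsub>?G\<^esub> s) i"
        using limF[of "\<lambda>z. fst z i"] lim[of i] sc by (simp add: h_def H_mult g H_inv H_coord_eq)
    next
      show "(\<lambda>k. ht (h k)) \<longlonglongrightarrow> ht (inv\<^bsub>?G\<^esub> s)"
        using limF[of ht] lim[of "m - 1"] m sc by (simp add: h_def H_mult g H_inv H_coord_eq)
    next
      fix i
      have "tr (inv\<^bsub>?G\<^esub> s) i = - (exp (- ht s) * tr s i)" using sc by (simp add: H_inv)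
      then show "(\<lambda>k. tr (h k) i) \<longlonglongrightarrow> tr (inv\<^bsub>?G\<^esub> s) i" by (simp add: trh)
    qed (simp add: hT)
  qed
  then show ?thesis
    using one car T(1) by (intro G.subgroupI) (auto simp: subsemigroup_def)
qed

section \<open>Boundaries of half-spaces as Lie subgroups\<close>

lemma continuous_map_Euclidean_coord:
  "continuous_map (subtopology (Euclidean_space d) W) euclideanreal (\<lambda>p. p i)"
  unfolding Euclidean_space_def
  by (intro continuous_map_from_subtopology continuous_map_product_projection) simp

lemma continuous_map_exp:
  assumes "continuous_map X euclideanreal f"
  shows "continuous_map X euclideanreal (\<lambda>x. exp (f x))"
  using continuous_map_compose[OF assms, of euclideanreal exp] by (simp add: o_def continuous_on_exp)

lemma partial_deriv_exp_affine:
  fixes d :: nat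
  assumes "i < d"
  shows "((\<lambda>t. e + (\<Sum>j<d. l j * (p(i := t)) j) + k * exp ((p(i := t)) r)) has_field_derivative
    (l i + (if i = r then k else 0) * exp (p r))) (at (p i))"
proof -
  have *: "(\<Sum>j<d. l j * (p(i := t)) j) = (\<Sum>j<d. l j * p j) + l i * (t - p i)" for t
  proof -
    have "(\<Sum>j<d. l j * (p(i := t)) j) = (\<Sum>j<d. l j * p j + (if j = i then l i * (t - p i) else 0))"
      by (intro sum.cong) (auto simp: algebra_simps)
    then show ?thesis using assms by (simp add: sum.distrib)
  qed
  show ?thesis unfolding *
    by (cases "i = r") (auto intro!: derivative_eq_intros)
qed

text \<open>
  A class of functions that contains the coordinates of all charts needed here and is closed under partial
  derivatives, so that smoothness follows by induction on the order.
\<close>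

lemma smooth_on_exp_affine:
  "smooth_on d W (\<lambda>p. e + (\<Sum>j<d. l j * p j) + k * exp (p r))"
proof -
  have cont: "continuous_map (subtopology (Euclidean_space d) W) euclideanreal
      (\<lambda>p. e + (\<Sum>j<d. l j * p j) + k * exp (p r))" for e l k
    by (intro continuous_map_add continuous_map_real_mult continuous_map_sum continuous_map_exp
        continuous_map_Euclidean_coord) auto
  have "Ck_on d K W (\<lambda>p. e + (\<Sum>j<d. l j * p j) + k * exp (p r))" for K
  proof (induction K arbitrary: e l k)
    case 0
    then show ?case using cont by simp
  next
    case (Suc K)
    have "partial_deriv i (\<lambda>p. e + (\<Sum>j<d. l j * p j) + k * exp (p r)) =
        (\<lambda>p. l i + (\<Sum>j<d. 0 * p j) + (if i = r then k else 0) * exp (p r))" if "i < d" for i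
    proof
      fix p
      show "partial_deriv i (\<lambda>p. e + (\<Sum>j<d. l j * p j) + k * exp (p r)) p
          = l i + (\<Sum>j<d. 0 * p j) + (if i = r then k else 0) * exp (p r)"
        using DERIV_imp_deriv[OF partial_deriv_exp_affine[OF that]]
        unfolding partial_deriv_def by (simp only: mult_zero_left sum.neutral_const add_0_right)
    qed
    note pd = this
    have fd: "(\<lambda>t. e + (\<Sum>j<d. l j * (p(i := t)) j) + k * exp ((p(i := t)) r)) field_differentiable (at (p i))"
      if "i < d" for i p
      unfolding field_differentiable_def using partial_deriv_exp_affine[OF that] by blast
    show ?case unfolding Ck_on.simps
    proof (intro conjI allI impI ballI)
      fix i assume "i < d"
      then show "Ck_on d K W (partial_deriv i (\<lambda>p. e + (\<Sum>j<d. l j * p j) + k * exp (p r)))"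
        unfolding pd[OF \<open>i < d\<close>] by (intro Suc)
    qed (use cont fd in blast)+
  qed
  then show ?thesis by (simp add: smooth_on_def)
qed

lemma topological_group_subgroup:
  fixes G (structure)
  assumes G: "topological_group G X" and L: "subgroup L G"
  shows "topological_group (G\<lparr>carrier := L\<rparr>) (subtopology X L)"
proof -
  interpret group G using G by (simp add: topological_group_def)
  have top: "topspace X = carrier G" using G by (simp add: topological_group_def)
  have sub: "L \<subseteq> carrier G" using L by (rule subgroup.subset)
  have "continuous_map (prod_topology (subtopology X L) (subtopology X L)) (subtopology X L) (\<lambda>(g, h). g \<otimes> h)"
    using G subgroup.m_closed[OF L]
    by (auto simp: topological_group_def continuous_map_in_subtopology subtopology_Times[symmetric]
        intro: continuous_map_from_subtopology)
  moreover have "continuous_map (subtopology X L) (subtopology X L) (\<lambda>g. inv\<^bsub>G\<lparr>carrier := L\<rparr>\<^esub> g)"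
  proof -
    have "continuous_map (subtopology X L) (subtopology X L) (\<lambda>g. inv g)"
      using G subgroup.m_inv_closed[OF L]
      by (auto simp: topological_group_def continuous_map_in_subtopology intro: continuous_map_from_subtopology)
    then show ?thesis
      by (rule continuous_map_eq) (use m_inv_consistent[OF L] in auto)
  qed
  ultimately show ?thesis
    using subgroup.subgroup_is_group[OF L group_axioms] top sub
    by (auto simp: topological_group_def)
qed

definition H_of_coords :: "nat \<Rightarrow> nat \<Rightarrow> (nat \<Rightarrow> real) \<Rightarrow> H_elt" where
  "H_of_coords m n x = (\<lambda>i. if i < m - 1 then x i else 0, x (m - 1), \<lambda>i. if i < n then x (m + i) else 0)"

lemma H_coord_of_coords:
  "m \<ge> 1 \<Longrightarrow> j < m + n \<Longrightarrow> H_coord m j (H_of_coords m n x) = x j"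
  by (auto simp: H_coord_eq H_of_coords_def)

lemma H_of_coords_coord:
  assumes "m \<ge> 1" "g \<in> carrier (H_group m n)" and x: "\<And>j. j < m + n \<Longrightarrow> x j = H_coord m j g"
  shows "H_of_coords m n x = g"
proof -
  have "(\<lambda>i. if i < m - 1 then x i else 0) = fst g"
    using assms by (auto simp: fun_eq_iff H_carrier H_coord_eq)
  moreover have "x (m - 1) = ht g" using assms by (simp add: H_coord_eq)
  moreover have "(\<lambda>i. if i < n then x (m + i) else 0) = tr g"
    using assms by (auto simp: fun_eq_iff H_carrier H_coord_eq)
  ultimately show ?thesis by (simp add: H_of_coords_def)
qed

text \<open>
  Omitting the coordinate \<open>i0\<close> is a global chart of the graph: \<open>un\<close> inserts the gap at \<open>i0\<close> into the
  numbering of the coordinates, and \<open>skip\<close> closes it.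
\<close>

lemma connected_lie_subgroup_graph:
  fixes l :: "nat \<Rightarrow> real"
  assumes m: "m \<ge> 1" and i0: "i0 < m + n" "l i0 = 0" and k: "k \<noteq> 0 \<Longrightarrow> i0 \<noteq> m - 1"
    and L_def: "L = {g \<in> carrier (H_group m n). H_coord m i0 g = (\<Sum>j<m+n. l j * H_coord m j g) + k * (exp (ht g) - 1)}"
    and L: "subgroup L (H_group m n)"
  shows "connected_lie_subgroup (H_group m n) (m + n) (H_coord m) (m + n - 1) L"
proof -
  let ?G = "H_group m n" and ?X = "H_top m n"
  define d where "d = m + n - 1"
  have N: "m + n = Suc d" using m by (simp add: d_def)
  define skip where "skip j = (if j < i0 then j else j - 1)" for j
  define un where "un i = (if i < i0 then i else Suc i)" for i
  have skip_un [simp]: "skip (un i) = i" for i by (simp add: skip_def un_def)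
  have un_skip: "j \<noteq> i0 \<Longrightarrow> un (skip j) = j" for j by (auto simp: skip_def un_def)
  have un_lt: "i < d \<Longrightarrow> un i < m + n" for i using N by (simp add: un_def)
  have un_ne: "un i \<noteq> i0" for i by (simp add: un_def)
  have skip_lt: "j < m + n \<Longrightarrow> j \<noteq> i0 \<Longrightarrow> skip j < d" for j using N i0 by (auto simp: skip_def)
  have sum_un: "(\<Sum>j<m+n. l j * x j) = (\<Sum>i<d. l (un i) * x (un i))" for x
  proof -
    have "(\<Sum>j<m+n. l j * x j) = (\<Sum>j\<in>{..<m+n} - {i0}. l j * x j)"
      using i0 by (intro sum.mono_neutral_right) auto
    also have "\<dots> = (\<Sum>i<d. l (un i) * x (un i))"
      using un_lt un_ne skip_lt un_skip
      by (intro sum.reindex_bij_witness[of _ un skip]) auto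
    finally show ?thesis .
  qed
  define r where "r = skip (m - 1)"
  define R where "R p = - k + (\<Sum>i<d. l (un i) * p i) + k * exp (p r)" for p
  define xx where "xx p j = (if j = i0 then R p else p (skip j))" for p j
  define \<phi> where "\<phi> p = H_of_coords m n (xx p)" for p
  define \<psi> where "\<psi> g i = (if i < d then H_coord m (un i) g else 0)" for g i
  have ht: "H_coord m (m - 1) g = ht g" for g by (simp add: H_coord_eq)
  have coord_\<phi>: "H_coord m j (\<phi> p) = xx p j" if "j < m + n" for j p
    unfolding \<phi>_def using H_coord_of_coords[OF m that] .
  have m1: "m - 1 < m + n" using m by simp
  have xx_ht: "xx p (m - 1) = ht (\<phi> p)" for p using coord_\<phi>[OF m1] ht by metis
  have \<phi>_car: "\<phi> p \<in> carrier ?G" for p by (auto simp: \<phi>_def H_of_coords_def H_carrier)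
  have \<phi>L: "\<phi> p \<in> L" for p
  proof -
    have "(\<Sum>j<m+n. l j * H_coord m j (\<phi> p)) = (\<Sum>i<d. l (un i) * p i)"
      unfolding sum_un using un_lt un_ne by (intro sum.cong) (auto simp: coord_\<phi> xx_def)
    moreover have "k * exp (p r) = k * exp (ht (\<phi> p))"
    proof (cases "k = 0")
      case False
      then have "xx p (m - 1) = p r" using k by (simp add: xx_def r_def)
      then show ?thesis by (simp only: xx_ht)
    qed simp
    ultimately show ?thesis using i0
      by (simp add: L_def \<phi>_car coord_\<phi> xx_def R_def right_diff_distrib)
  qed
  have cont_xx: "continuous_map (Euclidean_space d) euclideanreal (\<lambda>p. xx p j)" for j
  proof -
    have c: "continuous_map (Euclidean_space d) euclideanreal (\<lambda>p. p i)" for i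
      using continuous_map_Euclidean_coord[of d UNIV i] by simp
    have "continuous_map (Euclidean_space d) euclideanreal R"
      unfolding R_def[abs_def]
      by (intro continuous_map_add continuous_map_real_mult continuous_map_sum continuous_map_exp c) auto
    then show ?thesis using c by (auto simp: xx_def)
  qed
  have "continuous_map (Euclidean_space d) ?X \<phi>"
    using \<phi>_car cont_xx by (auto simp: continuous_map_into_H) (auto simp: \<phi>_def H_of_coords_def)
  then have cont_\<phi>: "continuous_map (Euclidean_space d) (subtopology ?X L) \<phi>"
    using \<phi>L by (auto simp: continuous_map_in_subtopology)
  have cont_\<psi>: "continuous_map (subtopology ?X L) (Euclidean_space d) \<psi>"
    unfolding \<psi>_def[abs_def] continuous_map_componentwise_Euclidean_space
    by (intro allI impI continuous_map_from_subtopology continuous_map_H_coord)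
  have \<psi>\<phi>: "\<psi> (\<phi> p) = p" if "p \<in> topspace (Euclidean_space d)" for p
    using that un_lt un_ne by (auto simp: \<psi>_def coord_\<phi> xx_def topspace_Euclidean_space fun_eq_iff)
  have \<phi>\<psi>: "\<phi> (\<psi> g) = g" if g: "g \<in> L" for g
  proof -
    have eq: "\<psi> g (skip j) = H_coord m j g" if "j < m + n" "j \<noteq> i0" for j
      using that skip_lt un_skip by (simp add: \<psi>_def)
    have "(\<Sum>i<d. l (un i) * \<psi> g i) = (\<Sum>j<m+n. l j * H_coord m j g)"
      unfolding sum_un by (intro sum.cong) (auto simp: \<psi>_def)
    moreover have "k * exp (\<psi> g r) = k * exp (ht g)"
      using eq[OF m1] k unfolding r_def ht by (cases "k = 0") auto
    ultimately have "R (\<psi> g) = H_coord m i0 g" using g by (simp add: R_def L_def right_diff_distrib)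
    then have "xx (\<psi> g) j = H_coord m j g" if "j < m + n" for j using that eq by (simp add: xx_def)
    then show ?thesis unfolding \<phi>_def using m g by (intro H_of_coords_coord) (auto simp: L_def)
  qed
  have "L \<subseteq> topspace ?X" by (auto simp: L_def topspace_H_top)
  then have maps: "homeomorphic_maps (Euclidean_space d) (subtopology ?X L) \<phi> \<psi>"
    unfolding homeomorphic_maps_def using cont_\<phi> cont_\<psi> \<psi>\<phi> \<phi>\<psi> by auto
  let ?W = "topspace (Euclidean_space d)"
  have "connected_space (subtopology ?X L)"
    using maps connected_Euclidean_space[of d] homeomorphic_connected_space homeomorphic_space_def by blast
  moreover have "homeomorphic_map (subtopology (Euclidean_space d) ?W) (subtopology (subtopology ?X L) L) \<phi>"
    using maps by (simp add: subtopology_subtopology homeomorphic_map_maps) blast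
  moreover have "openin (subtopology ?X L) L"
    using \<open>L \<subseteq> topspace ?X\<close> by (metis openin_topspace topspace_subtopology_subset)
  moreover have "smooth_immersion (m + n) (H_coord m) d ?W \<phi>"
    unfolding smooth_immersion_def
  proof (intro conjI allI impI ballI)
    have comp: "H_coord m j \<circ> \<phi> = (\<lambda>p. xx p j)" if "j < m + n" for j
      using coord_\<phi>[OF that] by auto
    have proj: "(\<lambda>p. xx p j) = (\<lambda>p. 0 + (\<Sum>i<d. (if i = skip j then 1 else 0) * p i) + 0 * exp (p 0))"
      if "j < m + n" "j \<noteq> i0" for j
    proof
      fix p :: "nat \<Rightarrow> real"
      have "(\<Sum>i<d. (if i = skip j then 1 else 0) * p i) = (\<Sum>i<d. if i = skip j then p i else 0)"
        by (intro sum.cong) auto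
      also have "\<dots> = p (skip j)" using skip_lt[OF that] by simp
      finally show "xx p j = 0 + (\<Sum>i<d. (if i = skip j then 1 else 0) * p i) + 0 * exp (p 0)"
        using that by (simp add: xx_def)
    qed
    fix j assume j: "j < m + n"
    show "smooth_on d ?W (H_coord m j \<circ> \<phi>)"
    proof (cases "j = i0")
      case True
      then have "H_coord m j \<circ> \<phi> = R" using comp[OF j] by (simp add: xx_def[abs_def])
      then show ?thesis unfolding R_def[abs_def] by (simp only: smooth_on_exp_affine)
    next
      case False
      show ?thesis unfolding comp[OF j] proj[OF j False] by (rule smooth_on_exp_affine)
    qed
  next
    have pd: "partial_deriv i' (H_coord m (un i) \<circ> \<phi>) p = (if i' = i then 1 else 0)" if "i < d" "i' < d" for i i' p
    proof -
      have "H_coord m (un i) \<circ> \<phi> = (\<lambda>p. p i)"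
        using coord_\<phi>[OF un_lt[OF that(1)]] un_ne by (auto simp: xx_def)
      then show ?thesis by (auto simp: partial_deriv_def)
    qed
    fix p i and c :: "nat \<Rightarrow> real"
    assume c: "\<forall>j<m + n. (\<Sum>i<d. c i * partial_deriv i (H_coord m j \<circ> \<phi>) p) = 0" and i: "i < d"
    have "0 = (\<Sum>i'<d. c i' * partial_deriv i' (H_coord m (un i) \<circ> \<phi>) p)" using c un_lt[OF i] by simp
    also have "\<dots> = (\<Sum>i'<d. if i' = i then c i' else 0)" by (intro sum.cong) (auto simp: pd[OF i])
    finally show "c i = 0" using i by simp
  qed
  ultimately have "\<exists>Y. topological_group (?G\<lparr>carrier := L\<rparr>) Y \<and> connected_space Y \<and>
          (\<forall>g\<in>L. \<exists>U W \<phi>. openin Y U \<and> g \<in> U \<and> openin (Euclidean_space d) W \<and>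
             homeomorphic_map (subtopology (Euclidean_space d) W) (subtopology Y U) \<phi> \<and>
             smooth_immersion (m + n) (H_coord m) d W \<phi>)"
    using topological_group_subgroup[OF topological_group_H L]
    by (intro exI[of _ "subtopology ?X L"] conjI ballI exI[of _ L] exI[of _ ?W] exI[of _ \<phi>]) auto
  then show ?thesis using L unfolding connected_lie_subgroup_def d_def by blast
qed

lemma sum_lessThan_add: "(\<Sum>j<m + n. F j) = (\<Sum>j<m. F j) + (\<Sum>i<n. F (m + i))" for F :: "nat \<Rightarrow> real"
  by (induction n) auto

text \<open>
  The equation \<open>F = 0\<close> can be solved for any coordinate that occurs linearly with nonzero coefficient.
\<close>

theorem connected_lie_subgroup_half_space_boundary:
  assumes F: "half_space_form m n F" and m: "m \<ge> 1"
  shows "connected_lie_subgroup (H_group m n) (m + n) (H_coord m) (m + n - 1) {g \<in> carrier (H_group m n). F g = 0}"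
    (is "connected_lie_subgroup _ _ _ _ ?L")
  using F unfolding half_space_form_def
proof (elim disjE exE conjE)
  fix f i0 assume Ff: "F = lin_form m f" and i0: "i0 < m" "f i0 \<noteq> 0"
  define l where "l j = (if j < m \<and> j \<noteq> i0 then - f j / f i0 else 0)" for j
  have eq: "F g = f i0 * (H_coord m i0 g - (\<Sum>j<m+n. l j * H_coord m j g))" for g
  proof -
    have "(\<Sum>j<m+n. l j * H_coord m j g) = (\<Sum>j<m. l j * H_coord m j g)"
      by (simp add: sum_lessThan_add l_def)
    also have "\<dots> = (\<Sum>j\<in>{..<m} - {i0}. - (f j * H_coord m j g / f i0))"
      using i0 by (simp add: sum.remove[of "{..<m}" i0] l_def)
    finally show ?thesis
      using i0 by (simp add: Ff lin_form_def sum.remove[of "{..<m}" i0] sum_negf algebra_simps flip: sum_divide_distrib)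
  qed
  show ?thesis
  proof (rule connected_lie_subgroup_graph[OF m, of i0 _ l 0])
    show "?L = {g \<in> carrier (H_group m n). H_coord m i0 g = (\<Sum>j<m+n. l j * H_coord m j g) + 0 * (exp (ht g) - 1)}"
      using i0 by (simp add: eq)
  qed (use i0 subgroup_half_space_boundary[OF F] in \<open>auto simp: l_def\<close>)
next
  fix \<gamma> c k0 assume Ff: "F = aff_form n \<gamma> c" and k0: "k0 < n" "\<gamma> k0 \<noteq> 0"
  define l where "l j = (if m \<le> j \<and> j \<noteq> m + k0 then - \<gamma> (j - m) / \<gamma> k0 else 0)" for j
  have eq: "F g = \<gamma> k0 * (H_coord m (m + k0) g - ((\<Sum>j<m+n. l j * H_coord m j g) + c / \<gamma> k0 * (exp (ht g) - 1)))" for g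
  proof -
    have co: "H_coord m (m + i) g = tr g i" for i
    proof -
      have "\<not> m + i < m - 1" "m + i \<noteq> m - 1" using m by linarith+
      then show ?thesis unfolding H_coord_eq by simp
    qed
    have "(\<Sum>j<m+n. l j * H_coord m j g) = (\<Sum>i<n. l (m + i) * tr g i)"
      by (simp add: sum_lessThan_add co) (simp add: l_def)
    also have "\<dots> = (\<Sum>i\<in>{..<n} - {k0}. - (\<gamma> i * tr g i / \<gamma> k0))"
      using k0 by (simp add: sum.remove[of "{..<n}" k0] l_def)
    finally show ?thesis unfolding co
      using k0 by (simp add: Ff aff_form_def sum.remove[of "{..<n}" k0] sum_negf algebra_simps flip: sum_divide_distrib)
  qed
  show ?thesis
  proof (rule connected_lie_subgroup_graph[OF m, of "m + k0" _ l "c / \<gamma> k0"])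
    show "?L = {g \<in> carrier (H_group m n). H_coord m (m + k0) g =
        (\<Sum>j<m+n. l j * H_coord m j g) + c / \<gamma> k0 * (exp (ht g) - 1)}"
      using k0 by (simp add: eq)
  qed (use k0 m subgroup_half_space_boundary[OF F] in \<open>auto simp: l_def\<close>)
qed

section \<open>Local injectivity from partial derivatives\<close>

text \<open>
  The filter of neighbourhoods of \<open>p\<close> within the points that vanish beyond the dimension; with it the limit
  rules for real functions apply to charts.
\<close>

definition Euclidean_nhds :: "nat \<Rightarrow> (nat \<Rightarrow> real) \<Rightarrow> (nat \<Rightarrow> real) filter" where
  "Euclidean_nhds d p = inf (nhds p) (principal (topspace (Euclidean_space d)))"

definition coord_box :: "nat \<Rightarrow> (nat \<Rightarrow> real) \<Rightarrow> real \<Rightarrow> (nat \<Rightarrow> real) set" where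
  "coord_box d p \<delta> = {q \<in> topspace (Euclidean_space d). \<forall>i<d. \<bar>q i - p i\<bar> < \<delta>}"

lemma eventually_Euclidean_nhds_openin:
  assumes "openin (Euclidean_space d) W" "p \<in> W"
  shows "eventually (\<lambda>q. q \<in> W) (Euclidean_nhds d p)"
proof -
  obtain V where V: "open V" "W = V \<inter> topspace (Euclidean_space d)"
    using assms(1) unfolding Euclidean_space_def euclidean_product_topology openin_subtopology
    by (auto simp: topspace_Euclidean_space)
  then have "eventually (\<lambda>q. q \<in> V) (nhds p)" using assms(2) by (intro eventually_nhds_in_open) auto
  then show ?thesis unfolding Euclidean_nhds_def eventually_inf_principal
    by eventually_elim (use V in auto)
qed

lemma eventually_Euclidean_nhds_box:
  assumes "eventually P (Euclidean_nhds d p)" and p: "p \<in> topspace (Euclidean_space d)"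
  shows "\<exists>\<delta>>0. \<forall>q\<in>coord_box d p \<delta>. P q"
proof -
  obtain V where V: "open V" "p \<in> V" "\<And>q. q \<in> V \<Longrightarrow> q \<in> topspace (Euclidean_space d) \<Longrightarrow> P q"
    using assms(1) unfolding Euclidean_nhds_def eventually_inf_principal eventually_nhds by blast
  have "openin (product_topology (\<lambda>i::nat. euclideanreal) UNIV) V"
    using V(1) by (simp add: euclidean_product_topology)
  then obtain X where X: "p \<in> PiE UNIV X" "\<And>i. open (X i)" "PiE UNIV X \<subseteq> V"
    using product_topology_open_contains_basis[of "\<lambda>_. euclideanreal" UNIV V p] V(2) by auto
  have "\<exists>\<delta>>0. \<forall>t. \<bar>t - p i\<bar> < \<delta> \<longrightarrow> t \<in> X i" for i
    using X(1) X(2)[of i] by (auto simp: open_dist dist_real_def PiE_UNIV_domain)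
  then obtain e where e: "\<And>i. e i > 0" "\<And>i t. \<bar>t - p i\<bar> < e i \<Longrightarrow> t \<in> X i" by metis
  define \<delta> where "\<delta> = Min (insert 1 (e ` {..<d}))"
  have "\<delta> > 0" using e by (simp add: \<delta>_def)
  moreover have "P q" if q: "q \<in> coord_box d p \<delta>" for q
  proof (rule V(3))
    have "q i \<in> X i" for i
    proof (cases "i < d")
      case True
      then have "\<bar>q i - p i\<bar> < \<delta>" "\<delta> \<le> e i" using q by (auto simp: coord_box_def \<delta>_def)
      then show ?thesis by (intro e(2)) simp
    next
      case False
      then have "q i = p i" using q p by (simp add: coord_box_def topspace_Euclidean_space)
      then show ?thesis using e by simp
    qed
    then show "q \<in> V" using X(3) by (auto simp: PiE_UNIV_domain)
  qed (use q in \<open>simp add: coord_box_def\<close>)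
  ultimately show ?thesis by blast
qed

lemma openin_coord_box: "openin (Euclidean_space d) (coord_box d p \<delta>)"
proof -
  have "openin (Euclidean_space d) {q \<in> topspace (Euclidean_space d). q i \<in> {p i - \<delta><..<p i + \<delta>}}" for i
    using continuous_map_Euclidean_coord[of d UNIV i]
    by (intro openin_continuous_map_preimage[where Y = euclideanreal]) auto
  then have "openin (Euclidean_space d) (topspace (Euclidean_space d) \<inter>
      (\<Inter>i<d. {q \<in> topspace (Euclidean_space d). q i \<in> {p i - \<delta><..<p i + \<delta>}}))"
    by (cases "d = 0") (auto intro!: openin_Inter)
  moreover have "coord_box d p \<delta> = topspace (Euclidean_space d) \<inter>
      (\<Inter>i<d. {q \<in> topspace (Euclidean_space d). q i \<in> {p i - \<delta><..<p i + \<delta>}})"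
  proof -
    have "\<bar>t - a\<bar> < \<delta> \<longleftrightarrow> t \<in> {a - \<delta><..<a + \<delta>}" for t a :: real by auto
    then show ?thesis unfolding coord_box_def by auto
  qed
  ultimately show ?thesis by simp
qed

lemma tendsto_Euclidean_nhds:
  fixes f :: "(nat \<Rightarrow> real) \<Rightarrow> real"
  assumes f: "continuous_map (subtopology (Euclidean_space d) W) euclideanreal f"
    and W: "openin (Euclidean_space d) W" and p: "p \<in> W"
  shows "(f \<longlongrightarrow> f p) (Euclidean_nhds d p)"
proof (rule topological_tendstoI)
  fix S assume "open S" "f p \<in> S"
  have "openin (subtopology (Euclidean_space d) W) {x \<in> topspace (subtopology (Euclidean_space d) W). f x \<in> S}"
    using f \<open>open S\<close> by (intro openin_continuous_map_preimage) auto
  then have "openin (Euclidean_space d) {x \<in> topspace (subtopology (Euclidean_space d) W). f x \<in> S}"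
    using W openin_trans_full by blast
  moreover have "p \<in> {x \<in> topspace (subtopology (Euclidean_space d) W). f x \<in> S}"
    using p \<open>f p \<in> S\<close> openin_subset[OF W] by auto
  ultimately have "eventually (\<lambda>q. q \<in> {x \<in> topspace (subtopology (Euclidean_space d) W). f x \<in> S}) (Euclidean_nhds d p)"
    by (rule eventually_Euclidean_nhds_openin)
  then show "eventually (\<lambda>x. f x \<in> S) (Euclidean_nhds d p)" by eventually_elim auto
qed

text \<open>
  Go from \<open>x\<close> to \<open>y\<close> by changing one coordinate at a time; the box contains all intermediate points.
\<close>

lemma coordinatewise_mean_value:
  assumes D: "\<And>q i. q \<in> coord_box d p \<delta> \<Longrightarrow> i < d \<Longrightarrow>
      ((\<lambda>t. f (q(i := t))) has_field_derivative D i q) (at (q i))"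
    and x: "x \<in> coord_box d p \<delta>" and y: "y \<in> coord_box d p \<delta>"
  shows "\<exists>\<xi>. (\<forall>i<d. \<xi> i \<in> coord_box d p \<delta>) \<and> f y - f x = (\<Sum>i<d. D i (\<xi> i) * (y i - x i))"
proof -
  define z where "z k i = (if i < k then y i else x i)" for k i
  have step: "\<exists>q\<in>coord_box d p \<delta>. f (z (Suc k)) - f (z k) = D k q * (y k - x k)" if k: "k < d" for k
  proof -
    have z: "z (Suc k) = (z k)(k := y k)" "z k = (z k)(k := x k)" by (auto simp: z_def)
    have in_box: "(z k)(k := t) \<in> coord_box d p \<delta>" if "min (x k) (y k) \<le> t" "t \<le> max (x k) (y k)" for t
    proof -
      have "\<bar>x k - p k\<bar> < \<delta>" "\<bar>y k - p k\<bar> < \<delta>" using x y k by (auto simp: coord_box_def)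
      then have "\<bar>t - p k\<bar> < \<delta>" using that by (auto simp: min_def max_def split: if_splits)
      then show ?thesis using x y k by (auto simp: coord_box_def z_def topspace_Euclidean_space)
    qed
    have der: "((\<lambda>t. f ((z k)(k := t))) has_field_derivative D k ((z k)(k := t))) (at t)"
      if "min (x k) (y k) \<le> t" "t \<le> max (x k) (y k)" for t
      using D[OF in_box[OF that] k] by simp
    consider "x k = y k" | "x k < y k" | "y k < x k" by linarith
    then show ?thesis
    proof cases
      case 1
      then show ?thesis using z in_box[of "x k"] by (intro bexI[of _ "z k"]) auto
    next
      case 2
      obtain t where t: "x k < t" "t < y k"
        "f ((z k)(k := y k)) - f ((z k)(k := x k)) = (y k - x k) * D k ((z k)(k := t))"
        using MVT2[OF 2, of "\<lambda>t. f ((z k)(k := t))" "\<lambda>t. D k ((z k)(k := t))"] der 2 by auto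
      then show ?thesis using z in_box[of t] 2 by (intro bexI[of _ "(z k)(k := t)"]) (auto simp: mult.commute)
    next
      case 3
      obtain t where t: "y k < t" "t < x k"
        "f ((z k)(k := x k)) - f ((z k)(k := y k)) = (x k - y k) * D k ((z k)(k := t))"
        using MVT2[OF 3, of "\<lambda>t. f ((z k)(k := t))" "\<lambda>t. D k ((z k)(k := t))"] der 3 by auto
      then have "f ((z k)(k := y k)) - f ((z k)(k := x k)) = D k ((z k)(k := t)) * (y k - x k)"
        by (simp add: algebra_simps)
      then show ?thesis using z in_box[of t] t 3 by (intro bexI[of _ "(z k)(k := t)"]) auto
    qed
  qed
  then have "\<forall>k. \<exists>q. k < d \<longrightarrow> q \<in> coord_box d p \<delta> \<and> f (z (Suc k)) - f (z k) = D k q * (y k - x k)" by blast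
  from choice[OF this] obtain \<xi> where \<xi>: "\<And>k. k < d \<Longrightarrow> \<xi> k \<in> coord_box d p \<delta>"
    "\<And>k. k < d \<Longrightarrow> f (z (Suc k)) - f (z k) = D k (\<xi> k) * (y k - x k)" by blast
  have "z 0 = x" by (rule ext) (simp add: z_def)
  moreover have "z d = y" using x y by (auto simp: z_def coord_box_def topspace_Euclidean_space fun_eq_iff)
  ultimately have "f y - f x = (\<Sum>k<d. f (z (Suc k)) - f (z k))"
    using sum_lessThan_telescope[of "\<lambda>k. f (z k)" d] by simp
  also have "\<dots> = (\<Sum>k<d. D k (\<xi> k) * (y k - x k))" using \<xi>(2) by (intro sum.cong) auto
  finally show ?thesis using \<xi>(1) by blast
qed

text \<open>
  A substitute for the inverse function theorem that uses only partial derivatives.  After composing \<open>F\<close>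
  with the inverse of its derivative at \<open>p\<close>, the derivatives differ from the unit matrix by less than
  \<open>\<epsilon> < 1 / N\<close> on a box.  By the mean value theorem, equal values at \<open>x\<close> and \<open>y\<close> force
  \<open>(\<Sum>k. \<bar>y k - x k\<bar>) \<le> N \<epsilon> (\<Sum>k. \<bar>y k - x k\<bar>)\<close>.
\<close>

lemma locally_injective_if_no_covector:
  fixes F :: "nat \<Rightarrow> (nat \<Rightarrow> real) \<Rightarrow> real"
  assumes p: "p \<in> topspace (Euclidean_space N)"
    and der: "eventually (\<lambda>q. \<forall>i<N. \<forall>j<N. ((\<lambda>t. F j (q(i := t))) has_field_derivative D i j q) (at (q i))) (Euclidean_nhds N p)"
    and cont: "\<And>i j. i < N \<Longrightarrow> j < N \<Longrightarrow> (D i j \<longlongrightarrow> D i j p) (Euclidean_nhds N p)"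
    and nondeg: "\<And>u. (\<And>i. i < N \<Longrightarrow> (\<Sum>j<N. u j * D i j p) = 0) \<Longrightarrow> (\<And>j. j < N \<Longrightarrow> u j = 0)"
  shows "\<exists>\<delta>>0. \<forall>x\<in>coord_box N p \<delta>. \<forall>y\<in>coord_box N p \<delta>. (\<forall>j<N. F j x = F j y) \<longrightarrow> x = y"
proof -
  have "\<exists>B. \<forall>i<N. \<forall>k<N. (\<Sum>j<N. B k j * D i j p) = (if i = k then 1 else 0)"
    by (rule dual_system) (rule nondeg)
  then obtain B where B: "\<And>i k. i < N \<Longrightarrow> k < N \<Longrightarrow> (\<Sum>j<N. B k j * D i j p) = (if i = k then 1 else 0)"
    by blast
  define E where "E i k q = (\<Sum>j<N. B k j * D i j q)" for i k q
  define \<epsilon> where "\<epsilon> = 1 / (2 * real N + 1)"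
  have \<epsilon>: "\<epsilon> > 0" "real N * \<epsilon> < 1" by (auto simp: \<epsilon>_def field_simps)
  have close: "eventually (\<lambda>q. \<bar>E i k q - (if i = k then 1 else 0)\<bar> < \<epsilon>) (Euclidean_nhds N p)"
    if "i < N" "k < N" for i k
  proof -
    have "(E i k \<longlongrightarrow> (\<Sum>j<N. B k j * D i j p)) (Euclidean_nhds N p)"
      unfolding E_def using cont that by (intro tendsto_intros) auto
    then have "eventually (\<lambda>q. dist (E i k q) (if i = k then 1 else 0) < \<epsilon>) (Euclidean_nhds N p)"
      using \<epsilon> by (simp only: B[OF that] tendsto_iff)
    then show ?thesis by (simp add: dist_real_def)
  qed
  have "eventually (\<lambda>q. \<forall>i\<in>{..<N}. \<forall>k\<in>{..<N}. \<bar>E i k q - (if i = k then 1 else 0)\<bar> < \<epsilon>) (Euclidean_nhds N p)"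
    using close by (intro eventually_ball_finite ballI) auto
  from eventually_Euclidean_nhds_box[OF eventually_conj[OF der this] p]
  obtain \<delta> where \<delta>: "\<delta> > 0" and
    der': "\<And>q i j. q \<in> coord_box N p \<delta> \<Longrightarrow> i < N \<Longrightarrow> j < N \<Longrightarrow> ((\<lambda>t. F j (q(i := t))) has_field_derivative D i j q) (at (q i))" and
    close': "\<And>q i k. q \<in> coord_box N p \<delta> \<Longrightarrow> i < N \<Longrightarrow> k < N \<Longrightarrow> \<bar>E i k q - (if i = k then 1 else 0)\<bar> < \<epsilon>"
    by auto
  have "x = y" if x: "x \<in> coord_box N p \<delta>" and y: "y \<in> coord_box N p \<delta>" and eq: "\<And>j. j < N \<Longrightarrow> F j x = F j y" for x y
  proof -
    define s where "s = (\<Sum>i<N. \<bar>y i - x i\<bar>)"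
    have le: "\<bar>y k - x k\<bar> \<le> \<epsilon> * s" if k: "k < N" for k
    proof -
      have "((\<lambda>t. \<Sum>j<N. B k j * F j (q(i := t))) has_field_derivative E i k q) (at (q i))"
        if "q \<in> coord_box N p \<delta>" "i < N" for q i
        unfolding E_def using der'[OF that] by (intro DERIV_sum DERIV_cmult) auto
      from coordinatewise_mean_value[of N p \<delta> "\<lambda>x. \<Sum>j<N. B k j * F j x" "\<lambda>i. E i k", OF this x y]
      obtain \<xi> where \<xi>: "\<And>i. i < N \<Longrightarrow> \<xi> i \<in> coord_box N p \<delta>"
        "(\<Sum>j<N. B k j * F j y) - (\<Sum>j<N. B k j * F j x) = (\<Sum>i<N. E i k (\<xi> i) * (y i - x i))" by blast
      have "(\<Sum>j<N. B k j * F j y) - (\<Sum>j<N. B k j * F j x) = 0" using eq by simp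
      then have 0: "(\<Sum>i<N. E i k (\<xi> i) * (y i - x i)) = 0" using \<xi>(2) by simp
      have "(\<Sum>i<N. ((if i = k then 1 else 0) - E i k (\<xi> i)) * (y i - x i))
          = (\<Sum>i<N. if i = k then y i - x i else 0) - (\<Sum>i<N. E i k (\<xi> i) * (y i - x i))"
        unfolding sum_subtractf[symmetric] by (intro sum.cong) (auto simp: algebra_simps)
      then have "y k - x k = (\<Sum>i<N. ((if i = k then 1 else 0) - E i k (\<xi> i)) * (y i - x i))"
        using k 0 by simp
      also have "\<bar>\<dots>\<bar> \<le> (\<Sum>i<N. \<epsilon> * \<bar>y i - x i\<bar>)"
      proof (rule order_trans[OF sum_abs sum_mono])
        fix i assume "i \<in> {..<N}"
        then have "\<bar>(if i = k then 1 else 0) - E i k (\<xi> i)\<bar> \<le> \<epsilon>"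
          using close'[OF \<xi>(1), of i i k] k by (simp add: abs_minus_commute)
        then show "\<bar>((if i = k then 1 else 0) - E i k (\<xi> i)) * (y i - x i)\<bar> \<le> \<epsilon> * \<bar>y i - x i\<bar>"
          unfolding abs_mult by (intro mult_right_mono) auto
      qed
      finally show ?thesis by (simp add: s_def sum_distrib_left)
    qed
    have s0: "s \<ge> 0" by (simp add: s_def sum_nonneg)
    have "s \<le> (\<Sum>k<N. \<epsilon> * s)" unfolding s_def[symmetric] using le
      by (subst s_def) (intro sum_mono, auto)
    then have "s * (1 - real N * \<epsilon>) \<le> 0" by (simp add: algebra_simps)
    then have "s = 0" using s0 \<epsilon>(2) by (auto simp: mult_le_0_iff)
    then have eq: "y i = x i" if "i < N" for i
      using that by (simp add: s_def sum_nonneg_eq_0_iff)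
    show ?thesis
    proof
      fix i show "x i = y i"
        using eq[of i] x y by (cases "i < N") (auto simp: coord_box_def topspace_Euclidean_space)
    qed
  qed
  then show ?thesis using \<delta> by blast
qed

section \<open>Connected Lie subgroups of codimension one\<close>

definition immersed_chart ::
    "nat \<Rightarrow> (nat \<Rightarrow> 'a \<Rightarrow> real) \<Rightarrow> nat \<Rightarrow> 'a topology \<Rightarrow> 'a set \<Rightarrow> (nat \<Rightarrow> real) set \<Rightarrow> ((nat \<Rightarrow> real) \<Rightarrow> 'a) \<Rightarrow> bool" where
  "immersed_chart N x d Y U W \<phi> \<longleftrightarrow> openin Y U \<and> openin (Euclidean_space d) W \<and>
     homeomorphic_map (subtopology (Euclidean_space d) W) (subtopology Y U) \<phi> \<and> smooth_immersion N x d W \<phi>"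

lemma immersed_chart_coord:
  assumes ch: "immersed_chart N x d Y U W \<phi>" and j: "j < N" and p: "p \<in> W"
  shows "((x j \<circ> \<phi>) \<longlongrightarrow> (x j \<circ> \<phi>) p) (Euclidean_nhds d p)"
    and "i < d \<Longrightarrow> ((\<lambda>t. (x j \<circ> \<phi>) (p(i := t))) has_field_derivative partial_deriv i (x j \<circ> \<phi>) p) (at (p i))"
    and "i < d \<Longrightarrow> (partial_deriv i (x j \<circ> \<phi>) \<longlongrightarrow> partial_deriv i (x j \<circ> \<phi>) p) (Euclidean_nhds d p)"
proof -
  have W: "openin (Euclidean_space d) W" using ch by (simp add: immersed_chart_def)
  have "Ck_on d (Suc 0) W (x j \<circ> \<phi>)"
    using ch j unfolding immersed_chart_def smooth_immersion_def smooth_on_def by blast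
  then have C: "continuous_map (subtopology (Euclidean_space d) W) euclideanreal (x j \<circ> \<phi>)"
    "\<And>i. i < d \<Longrightarrow> (\<lambda>t. (x j \<circ> \<phi>) (p(i := t))) field_differentiable (at (p i))"
    "\<And>i. i < d \<Longrightarrow> continuous_map (subtopology (Euclidean_space d) W) euclideanreal (partial_deriv i (x j \<circ> \<phi>))"
    using p by auto
  show "((x j \<circ> \<phi>) \<longlongrightarrow> (x j \<circ> \<phi>) p) (Euclidean_nhds d p)"
    by (rule tendsto_Euclidean_nhds[OF C(1) W p])
  show "i < d \<Longrightarrow> ((\<lambda>t. (x j \<circ> \<phi>) (p(i := t))) has_field_derivative partial_deriv i (x j \<circ> \<phi>) p) (at (p i))"
    unfolding partial_deriv_def using C(2) by (metis field_differentiable_derivI)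
  show "i < d \<Longrightarrow> (partial_deriv i (x j \<circ> \<phi>) \<longlongrightarrow> partial_deriv i (x j \<circ> \<phi>) p) (Euclidean_nhds d p)"
    by (rule tendsto_Euclidean_nhds[OF C(3) W p])
qed

lemma immersed_chart_into:
  assumes "immersed_chart N x d Y U W \<phi>"
  shows "continuous_map (subtopology (Euclidean_space d) W) Y \<phi>" "\<phi> ` W \<subseteq> U" "U \<subseteq> topspace Y"
    "W \<subseteq> topspace (Euclidean_space d)"
proof -
  have h: "homeomorphic_map (subtopology (Euclidean_space d) W) (subtopology Y U) \<phi>"
    and W: "openin (Euclidean_space d) W" and U: "openin Y U"
    using assms by (simp_all add: immersed_chart_def)
  from W show Ws: "W \<subseteq> topspace (Euclidean_space d)" by (rule openin_subset)
  from U show "U \<subseteq> topspace Y" by (rule openin_subset)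
  from homeomorphic_imp_continuous_map[OF h]
  show "continuous_map (subtopology (Euclidean_space d) W) Y \<phi>"
    by (simp add: continuous_map_in_subtopology)
  show "\<phi> ` W \<subseteq> U"
    using homeomorphic_imp_surjective_map[OF h] Ws by auto
qed

text \<open>
  Invariance of domain: composed with the inverse of the chart, an injection would be an open map of
  \<open>\<real>\<^bsup>d+1\<^esup>\<close> into itself with values in the hyperplane \<open>\<real>\<^sup>d\<close>.
\<close>

lemma no_injection_into_chart:
  assumes ch: "immersed_chart N x d Y U W \<phi>"
    and O: "openin (Euclidean_space (Suc d)) V" "P0 \<in> V"
    and \<Psi>: "continuous_map (subtopology (Euclidean_space (Suc d)) V) Y \<Psi>" "\<Psi> P0 \<in> U"
  shows "\<not> inj_on \<Psi> V"
proof
  assume inj: "inj_on \<Psi> V"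
  let ?N = "Euclidean_space (Suc d)" and ?d = "Euclidean_space d"
  obtain \<psi> where maps: "homeomorphic_maps (subtopology ?d W) (subtopology Y U) \<phi> \<psi>"
    using ch by (auto simp: immersed_chart_def homeomorphic_map_maps)
  have U: "openin Y U" "U \<subseteq> topspace Y" using ch immersed_chart_into[OF ch] by (auto simp: immersed_chart_def)
  define V' where "V' = {P \<in> topspace (subtopology ?N V). \<Psi> P \<in> U}"
  have VV: "V' \<subseteq> V" using openin_subset[OF O(1)] by (auto simp: V'_def)
  have V': "openin ?N V'"
    unfolding V'_def using openin_continuous_map_preimage[OF \<Psi>(1) U(1)] O(1) openin_trans_full by blast
  have P0: "P0 \<in> V'" using O \<Psi>(2) openin_subset[OF O(1)] by (auto simp: V'_def)
  have "continuous_map (subtopology ?N V') Y \<Psi>"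
    using \<Psi>(1) VV by (metis continuous_map_from_subtopology_mono)
  then have "continuous_map (subtopology ?N V') (subtopology Y U) \<Psi>"
    by (auto simp: continuous_map_in_subtopology V'_def)
  moreover have "continuous_map (subtopology Y U) ?d \<psi>"
    using maps by (auto simp: homeomorphic_maps_def continuous_map_in_subtopology)
  ultimately have cont: "continuous_map (subtopology ?N V') ?d (\<psi> \<circ> \<Psi>)"
    by (rule continuous_map_compose)
  moreover have "topspace ?d \<subseteq> topspace ?N" by simp
  ultimately have "continuous_map (subtopology ?N V') ?N (\<psi> \<circ> \<Psi>)"
    unfolding cm_Euclidean_space_iff_continuous_on by blast
  moreover have "inj_on (\<psi> \<circ> \<Psi>) V'"
  proof (rule comp_inj_on)
    show "inj_on \<Psi> V'" using inj VV by (rule inj_on_subset)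
    have "\<phi> (\<psi> y) = y" if "y \<in> U" for y
      using maps that U by (auto simp: homeomorphic_maps_def)
    then have "inj_on \<psi> U" by (metis inj_onI)
    then show "inj_on \<psi> (\<Psi> ` V')" by (rule inj_on_subset) (auto simp: V'_def)
  qed
  ultimately have op: "openin ?N ((\<psi> \<circ> \<Psi>) ` V')"
    using V' by (intro invariance_of_domain_Euclidean_space) auto
  have sub: "(\<psi> \<circ> \<Psi>) ` V' \<subseteq> topspace ?d"
    using continuous_map_image_subset_topspace[OF cont] openin_subset[OF V'] by (simp add: Int_absorb1)
  let ?y = "(\<psi> \<circ> \<Psi>) P0"
  have y: "?y \<in> (\<psi> \<circ> \<Psi>) ` V'" using P0 by blast
  then have yt: "?y \<in> topspace ?N" using openin_subset[OF op] by blast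
  obtain \<delta> where \<delta>: "\<delta> > 0" "\<forall>q\<in>coord_box (Suc d) ?y \<delta>. q \<in> (\<psi> \<circ> \<Psi>) ` V'"
    using eventually_Euclidean_nhds_box[OF eventually_Euclidean_nhds_openin[OF op y] yt] by blast
  have "?y(d := ?y d + \<delta> / 2) \<in> coord_box (Suc d) ?y \<delta>"
    using yt \<delta>(1) by (auto simp: coord_box_def topspace_Euclidean_space)
  then have "?y(d := ?y d + \<delta> / 2) \<in> topspace ?d" using \<delta>(2) sub by blast
  moreover have "?y \<in> topspace ?d" using y sub by blast
  ultimately show False using \<delta>(1) by (auto simp: topspace_Euclidean_space)
qed

lemma filterlim_Euclidean_nhds:
  fixes f :: "(nat \<Rightarrow> real) \<Rightarrow> nat \<Rightarrow> real"
  assumes "\<And>i. continuous_on UNIV (\<lambda>P. f P i)" and "\<And>P. P \<in> topspace (Euclidean_space N) \<Longrightarrow> f P \<in> topspace (Euclidean_space d)"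
  shows "filterlim f (Euclidean_nhds d (f P0)) (Euclidean_nhds N P0)"
  unfolding Euclidean_nhds_def filterlim_inf filterlim_principal
proof
  have "continuous_on UNIV f" using assms(1) by (rule continuous_on_coordinatewise_then_product)
  then have "isCont f P0" by (simp add: continuous_on_eq_continuous_at)
  then have "filterlim f (nhds (f P0)) (nhds P0)" by (simp add: isCont_def tendsto_at_iff_tendsto_nhds)
  then show "filterlim f (nhds (f P0)) (inf (nhds P0) (principal (topspace (Euclidean_space N))))"
    by (rule filterlim_mono) auto
  show "\<forall>\<^sub>F x in inf (nhds P0) (principal (topspace (Euclidean_space N))). f x \<in> topspace (Euclidean_space d)"
    using assms(2) by (simp add: eventually_inf_principal)
qed

lemma H_coord_mult_eq:
  assumes "m \<ge> 1"
  shows "H_coord m j (g \<otimes>\<^bsub>H_group m n\<^esub> h) =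
    H_coord m j g + (if j < m then 1 else exp (H_coord m (m - 1) g)) * H_coord m j h"
  using assms by (auto simp: H_coord_eq H_mult)

text \<open>
  The two kinds of expressions annihilated by \<open>u\<close> are the partial derivatives of the coordinates of
  \<open>\<phi>1 p \<phi>2 q\<close> with respect to the \<open>i\<close>-th coordinate of \<open>p\<close> and the \<open>k\<close>-th coordinate of \<open>q\<close>.  These are
  \<open>d + 1\<close> variables.  If the derivatives were linearly independent, the product would be injective near
  \<open>(p1, p2)\<close>, although it takes values in \<open>L\<close>, which has dimension \<open>d\<close>.
\<close>

lemma product_of_charts_degenerate:
  assumes Y: "topological_group (H_group m n\<lparr>carrier := L\<rparr>) Y" and m: "m \<ge> 1" and N: "m + n = Suc d"
    and ch1: "immersed_chart (m + n) (H_coord m) d Y U1 W1 \<phi>1" and p1: "p1 \<in> W1"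
    and ch2: "immersed_chart (m + n) (H_coord m) d Y U2 W2 \<phi>2" and p2: "p2 \<in> W2"
    and ch3: "immersed_chart (m + n) (H_coord m) d Y U3 W3 \<phi>3"
      "\<phi>1 p1 \<otimes>\<^bsub>H_group m n\<^esub> \<phi>2 p2 \<in> U3"
    and k: "k < d"
  defines "A \<equiv> \<lambda>j. H_coord m j \<circ> \<phi>1" and "B \<equiv> \<lambda>j. H_coord m j \<circ> \<phi>2"
  shows "\<exists>u. (\<exists>j<m+n. u j \<noteq> 0) \<and>
    (\<forall>i<d. (\<Sum>j<m+n. u j * (partial_deriv i (A j) p1 +
      (if j < m then 0 else exp (A (m - 1) p1) * partial_deriv i (A (m - 1)) p1) * B j p2)) = 0) \<and>
    (\<Sum>j<m+n. u j * ((if j < m then 1 else exp (A (m - 1) p1)) * partial_deriv k (B j) p2)) = 0"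
proof (rule ccontr)
  assume contr: "\<not> ?thesis"
  let ?G = "H_group m n" and ?N = "Euclidean_space (m + n)"
  have m1: "m - 1 < m + n" using m by simp
  note into1 = immersed_chart_into[OF ch1] and into2 = immersed_chart_into[OF ch2]
  \<comment> \<open>A point \<open>P\<close> of \<open>\<real>\<^bsup>d+1\<^esup>\<close> encodes the argument \<open>l P\<close> of \<open>\<phi>1\<close> in its first \<open>d\<close> coordinates and the \<open>k\<close>-th
    coordinate of the argument \<open>r P\<close> of \<open>\<phi>2\<close> in the last one.\<close>
  define l where "l P = P(d := 0)" for P :: "nat \<Rightarrow> real"
  define r where "r P = p2(k := P d)" for P :: "nat \<Rightarrow> real"
  define P0 where "P0 = p1(d := p2 k)"
  have p1d: "p1 \<in> topspace (Euclidean_space d)" and p2d: "p2 \<in> topspace (Euclidean_space d)"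
    using into1(4) into2(4) p1 p2 by auto
  have l0: "l P0 = p1" using p1d by (auto simp: l_def P0_def topspace_Euclidean_space)
  have r0: "r P0 = p2" by (auto simp: r_def P0_def)
  have P0: "P0 \<in> topspace ?N" using p1d N by (auto simp: P0_def topspace_Euclidean_space)
  have lt: "l P \<in> topspace (Euclidean_space d)" if "P \<in> topspace ?N" for P
    using that N by (auto simp: l_def topspace_Euclidean_space)
  have rt: "r P \<in> topspace (Euclidean_space d)" for P
    using p2d k by (auto simp: r_def topspace_Euclidean_space)
  have contl: "continuous_on UNIV (\<lambda>P. l P i)" for i
    by (cases "i = d") (auto simp: l_def intro: continuous_intros)
  have contr': "continuous_on UNIV (\<lambda>P. r P i)" for i
    by (cases "i = k") (auto simp: r_def intro: continuous_intros)
  have liml: "filterlim l (Euclidean_nhds d p1) (Euclidean_nhds (m + n) P0)"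
    using filterlim_Euclidean_nhds[of l "m + n" d P0, OF contl lt] by (simp add: l0)
  have limr: "filterlim r (Euclidean_nhds d p2) (Euclidean_nhds (m + n) P0)"
    using filterlim_Euclidean_nhds[of r "m + n" d P0, OF contr' rt] by (simp add: r0)
  define \<Psi> where "\<Psi> P = \<phi>1 (l P) \<otimes>\<^bsub>?G\<^esub> \<phi>2 (r P)" for P
  define w where "w j P = (if j < m then 1 else exp (A (m - 1) (l P)))" for j P
  define F where "F j P = A j (l P) + w j P * B j (r P)" for j P
  have F_eq: "H_coord m j (\<Psi> P) = F j P" for j P
    by (simp add: \<Psi>_def F_def w_def A_def B_def H_coord_mult_eq[OF m])
  define D where "D i j P = (if i < d then partial_deriv i (A j) (l P) +
      (if j < m then 0 else exp (A (m - 1) (l P)) * partial_deriv i (A (m - 1)) (l P)) * B j (r P)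
    else w j P * partial_deriv k (B j) (r P))" for i j P
  have W1: "openin (Euclidean_space d) W1" and W2: "openin (Euclidean_space d) W2"
    using ch1 ch2 by (auto simp: immersed_chart_def)
  have evl: "eventually (\<lambda>P. l P \<in> W1) (Euclidean_nhds (m + n) P0)"
    using eventually_compose_filterlim[OF eventually_Euclidean_nhds_openin[OF W1 p1] liml] .
  have evr: "eventually (\<lambda>P. r P \<in> W2) (Euclidean_nhds (m + n) P0)"
    using eventually_compose_filterlim[OF eventually_Euclidean_nhds_openin[OF W2 p2] limr] .
  have der: "((\<lambda>t. F j (P(i := t))) has_field_derivative D i j P) (at (P i))"
    if P: "l P \<in> W1" "r P \<in> W2" and ij: "i < m + n" "j < m + n" for P i j
  proof (cases "i < d")
    case True
    have lu: "l (P(i := t)) = (l P)(i := t)" for t using True by (auto simp: l_def)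
    have ru: "r (P(i := t)) = r P" for t using True by (auto simp: r_def)
    have li: "l P i = P i" using True by (simp add: l_def)
    then have upd: "(l P)(i := P i) = l P" by (metis fun_upd_triv)
    have dA: "((\<lambda>t. A j ((l P)(i := t))) has_field_derivative partial_deriv i (A j) (l P)) (at (P i))"
      if "j < m + n" for j
      using immersed_chart_coord(2)[OF ch1 that P(1) True] by (simp add: A_def li)
    show ?thesis
      unfolding F_def w_def lu ru using dA[OF ij(2)] dA[OF m1] True
      by (auto simp: D_def upd intro!: derivative_eq_intros)
  next
    case False
    then have i: "i = d" using ij N by simp
    have lu: "l (P(i := t)) = l P" for t by (auto simp: l_def i)
    have ru: "r (P(i := t)) = (r P)(k := t)" for t by (auto simp: r_def i)
    have "((\<lambda>t. B j ((r P)(k := t))) has_field_derivative partial_deriv k (B j) (r P)) (at (P i))"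
      using immersed_chart_coord(2)[OF ch2 ij(2) P(2) k] by (simp add: B_def i r_def)
    then show ?thesis
      unfolding F_def w_def lu ru using False
      by (auto simp: D_def w_def intro!: derivative_eq_intros)
  qed
  have tA: "((\<lambda>P. A j (l P)) \<longlongrightarrow> A j p1) (Euclidean_nhds (m + n) P0)" if "j < m + n" for j
    using filterlim_compose[OF immersed_chart_coord(1)[OF ch1 that p1] liml] by (simp add: A_def o_def)
  have tB: "((\<lambda>P. B j (r P)) \<longlongrightarrow> B j p2) (Euclidean_nhds (m + n) P0)" if "j < m + n" for j
    using filterlim_compose[OF immersed_chart_coord(1)[OF ch2 that p2] limr] by (simp add: B_def o_def)
  have tdA: "((\<lambda>P. partial_deriv i (A j) (l P)) \<longlongrightarrow> partial_deriv i (A j) p1) (Euclidean_nhds (m + n) P0)"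
    if "j < m + n" "i < d" for i j
    using filterlim_compose[OF immersed_chart_coord(3)[OF ch1 that(1) p1 that(2)] liml] by (simp add: A_def)
  have tdB: "((\<lambda>P. partial_deriv k (B j) (r P)) \<longlongrightarrow> partial_deriv k (B j) p2) (Euclidean_nhds (m + n) P0)"
    if "j < m + n" for j
    using filterlim_compose[OF immersed_chart_coord(3)[OF ch2 that p2 k] limr] by (simp add: B_def)
  have contD: "(D i j \<longlongrightarrow> D i j P0) (Euclidean_nhds (m + n) P0)" if "i < m + n" "j < m + n" for i j
  proof (cases "i < d")
    case True
    then show ?thesis using tA[OF m1] tB[OF that(2)] tdA[OF that(2) True] tdA[OF m1 True]
      unfolding D_def[abs_def] by (cases "j < m") (auto simp: l0 r0 intro!: tendsto_intros)
  next
    case False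
    then show ?thesis using tA[OF m1] tdB[OF that(2)]
      unfolding D_def[abs_def] w_def by (cases "j < m") (auto simp: l0 r0 intro!: tendsto_intros)
  qed
  have "\<exists>\<delta>>0. \<forall>x\<in>coord_box (m + n) P0 \<delta>. \<forall>y\<in>coord_box (m + n) P0 \<delta>. (\<forall>j<m+n. F j x = F j y) \<longrightarrow> x = y"
  proof (rule locally_injective_if_no_covector[where D = D])
    show "\<forall>\<^sub>F q in Euclidean_nhds (m + n) P0. \<forall>i<m + n. \<forall>j<m + n.
        ((\<lambda>t. F j (q(i := t))) has_real_derivative D i j q) (at (q i))"
      using evl evr by eventually_elim (use der in blast)
    fix u :: "nat \<Rightarrow> real" and j
    assume u: "\<And>i. i < m + n \<Longrightarrow> (\<Sum>j<m+n. u j * D i j P0) = 0" and j: "j < m + n"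
    show "u j = 0"
    proof (rule ccontr)
      assume "u j \<noteq> 0"
      moreover have "(\<Sum>j<m+n. u j * (partial_deriv i (A j) p1 +
        (if j < m then 0 else exp (A (m - 1) p1) * partial_deriv i (A (m - 1)) p1) * B j p2)) = 0" if "i < d" for i
      proof -
        have "D i j P0 = partial_deriv i (A j) p1 +
          (if j < m then 0 else exp (A (m - 1) p1) * partial_deriv i (A (m - 1)) p1) * B j p2" for j
          using that unfolding D_def l0 r0 by simp
        moreover have "i < m + n" using that N by simp
        ultimately show ?thesis using u[of i] by (simp only:)
      qed
      moreover have "(\<Sum>j<m+n. u j * ((if j < m then 1 else exp (A (m - 1) p1)) * partial_deriv k (B j) p2)) = 0"
      proof -
        have "D d j P0 = (if j < m then 1 else exp (A (m - 1) p1)) * partial_deriv k (B j) p2" for j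
          unfolding D_def w_def l0 r0 by simp
        moreover have "d < m + n" using N by simp
        ultimately show ?thesis using u[of d] by (simp only:)
      qed
      ultimately show False using contr j by blast
    qed
  qed (use P0 contD in auto)
  then obtain \<delta> where \<delta>: "\<delta> > 0" "\<And>x y. x \<in> coord_box (m + n) P0 \<delta> \<Longrightarrow> y \<in> coord_box (m + n) P0 \<delta> \<Longrightarrow>
    (\<And>j. j < m + n \<Longrightarrow> F j x = F j y) \<Longrightarrow> x = y" by blast
  have cml: "continuous_map ?N (Euclidean_space d) l"
    using contl lt cm_Euclidean_space_iff_continuous_on[of "m + n" UNIV d l]
    by (auto intro: continuous_on_coordinatewise_then_product continuous_on_subset)
  have cmr: "continuous_map ?N (Euclidean_space d) r"
    using contr' rt cm_Euclidean_space_iff_continuous_on[of "m + n" UNIV d r]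
    by (auto intro: continuous_on_coordinatewise_then_product continuous_on_subset)
  define V where "V = coord_box (m + n) P0 \<delta> \<inter>
    ({P \<in> topspace ?N. l P \<in> W1} \<inter> {P \<in> topspace ?N. r P \<in> W2})"
  have V: "openin ?N V"
    unfolding V_def using openin_continuous_map_preimage[OF cml W1] openin_continuous_map_preimage[OF cmr W2]
    by (intro openin_Int openin_coord_box)
  have "P0 \<in> V" using P0 \<delta>(1) p1 p2 by (auto simp: V_def coord_box_def l0 r0)
  have "continuous_map (subtopology ?N V) Y (\<lambda>P. \<phi>1 (l P))"
  proof -
    have "continuous_map (subtopology ?N V) (subtopology (Euclidean_space d) W1) l"
      using cml by (auto simp: continuous_map_in_subtopology V_def intro: continuous_map_from_subtopology)
    from continuous_map_compose[OF this into1(1)] show ?thesis by (simp add: o_def)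
  qed
  moreover have "continuous_map (subtopology ?N V) Y (\<lambda>P. \<phi>2 (r P))"
  proof -
    have "continuous_map (subtopology ?N V) (subtopology (Euclidean_space d) W2) r"
      using cmr by (auto simp: continuous_map_in_subtopology V_def intro: continuous_map_from_subtopology)
    from continuous_map_compose[OF this into2(1)] show ?thesis by (simp add: o_def)
  qed
  ultimately have "continuous_map (subtopology ?N V) (prod_topology Y Y) (\<lambda>P. (\<phi>1 (l P), \<phi>2 (r P)))"
    by (simp add: continuous_map_pairwise o_def)
  from continuous_map_compose[OF this, of Y "\<lambda>(g, h). g \<otimes>\<^bsub>?G\<^esub> h"]
  have "continuous_map (subtopology ?N V) Y \<Psi>"
    using Y by (simp add: topological_group_def o_def \<Psi>_def[abs_def])
  moreover have "\<Psi> P0 \<in> U3" using ch3(2) by (simp add: \<Psi>_def l0 r0)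
  ultimately have "\<not> inj_on \<Psi> V"
    using no_injection_into_chart[OF ch3(1)] V \<open>P0 \<in> V\<close> unfolding N by blast
  moreover have "inj_on \<Psi> V"
    by (rule inj_onI, rule \<delta>(2)) (auto simp: V_def simp flip: F_eq)
  ultimately show False by blast
qed

lemma immersed_chart_independent:
  assumes ch: "immersed_chart N x d Y U W \<phi>" and p: "p \<in> W"
    and c: "\<And>j. j < N \<Longrightarrow> (\<Sum>i<d. c i * partial_deriv i (x j \<circ> \<phi>) p) = 0" and i: "i < d"
  shows "c i = 0"
  using assms unfolding immersed_chart_def smooth_immersion_def by blast

text \<open>
  The covector of the preceding lemma, read at the factor \<open>\<phi>1 p1\<close>, annihilates the tangent space there, so up
  to a factor it is \<open>\<nu>\<close>.  Reading it at the factor \<open>\<phi>2 p2\<close> instead gives a transported \<open>\<nu>\<close>; as \<open>\<nu>\<close> does not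
  depend on \<open>k\<close>, this annihilates the whole tangent space at \<open>\<phi>2 p2\<close>.
\<close>

lemma annihilator_transport:
  assumes Y: "topological_group (H_group m n\<lparr>carrier := L\<rparr>) Y" and m: "m \<ge> 1" and N: "m + n = Suc d"
    and charts: "\<And>g. g \<in> L \<Longrightarrow> \<exists>U W \<phi>. g \<in> U \<and> immersed_chart (m + n) (H_coord m) d Y U W \<phi>"
    and ch1: "immersed_chart (m + n) (H_coord m) d Y U1 W1 \<phi>1" and p1: "p1 \<in> W1"
    and ch2: "immersed_chart (m + n) (H_coord m) d Y U2 W2 \<phi>2" and p2: "p2 \<in> W2"
    and \<nu>: "\<And>i. i < d \<Longrightarrow> (\<Sum>j<m+n. \<nu> j * partial_deriv i (H_coord m j \<circ> \<phi>1) p1) = 0"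
    and k: "k < d"
  shows "(\<Sum>j<m+n. ((if j < m then 1 else exp (ht (\<phi>1 p1))) *
      (\<nu> j - (if j = m - 1 then exp (ht (\<phi>1 p1)) * (\<Sum>i<n. \<nu> (m + i) * tr (\<phi>2 p2) i) else 0)))
      * partial_deriv k (H_coord m j \<circ> \<phi>2) p2) = 0"
proof -
  let ?G = "H_group m n"
  have top: "topspace Y = L" using Y by (simp add: topological_group_def)
  have m1: "m - 1 < m + n" using m by simp
  have "\<phi>1 p1 \<in> L" "\<phi>2 p2 \<in> L"
    using immersed_chart_into[OF ch1] immersed_chart_into[OF ch2] p1 p2 top by auto
  then have "\<phi>1 p1 \<otimes>\<^bsub>?G\<^esub> \<phi>2 p2 \<in> L"
  proof -
    have "group (?G\<lparr>carrier := L\<rparr>)" using Y by (simp add: topological_group_def)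
    from monoid.m_closed[OF group.is_monoid[OF this], of "\<phi>1 p1" "\<phi>2 p2"]
    show ?thesis using \<open>\<phi>1 p1 \<in> L\<close> \<open>\<phi>2 p2 \<in> L\<close> by simp
  qed
  then obtain U3 W3 \<phi>3 where ch3: "immersed_chart (m + n) (H_coord m) d Y U3 W3 \<phi>3"
      "\<phi>1 p1 \<otimes>\<^bsub>?G\<^esub> \<phi>2 p2 \<in> U3" using charts by blast
  define a where "a = ht (\<phi>1 p1)"
  define dA where "dA i j = partial_deriv i (H_coord m j \<circ> \<phi>1) p1" for i j
  define dB where "dB j = partial_deriv k (H_coord m j \<circ> \<phi>2) p2" for j
  have ht: "(H_coord m (m - 1) \<circ> \<phi>1) p1 = a" by (simp add: H_coord_eq a_def)
  have trB: "(H_coord m (m + i) \<circ> \<phi>2) p2 = tr (\<phi>2 p2) i" for i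
  proof -
    have "\<not> m + i < m - 1" "m + i \<noteq> m - 1" using m by linarith+
    then show ?thesis by (simp add: H_coord_eq)
  qed
  obtain u where u: "\<exists>j<m+n. u j \<noteq> 0"
    "\<And>i. i < d \<Longrightarrow> (\<Sum>j<m+n. u j * (dA i j + (if j < m then 0 else exp a * dA i (m - 1)) * (H_coord m j \<circ> \<phi>2) p2)) = 0"
    "(\<Sum>j<m+n. u j * ((if j < m then 1 else exp a) * dB j)) = 0"
    using product_of_charts_degenerate[OF Y m N ch1 p1 ch2 p2 ch3 k] unfolding ht dA_def[symmetric] dB_def[symmetric] by blast
  define t where "t = (\<Sum>i<n. u (m + i) * tr (\<phi>2 p2) i)"
  \<comment> \<open>The restriction of \<open>u\<close> to the first factor: varying \<open>a\<close> there also rescales the \<open>b\<close> of the second factor.\<close>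
  define v where "v j = u j + (if j = m - 1 then exp a * t else 0)" for j
  have vm: "v (m + i) = u (m + i)" for i using m by (simp add: v_def)
  have v: "(\<Sum>j<m+n. v j * dA i j) = 0" if i: "i < d" for i
  proof -
    have "(\<Sum>j<m+n. u j * ((if j < m then 0 else exp a * dA i (m - 1)) * (H_coord m j \<circ> \<phi>2) p2)) = exp a * dA i (m - 1) * t"
      unfolding sum_lessThan_add trB t_def by (simp add: sum_distrib_left mult_ac)
    then have "(\<Sum>j<m+n. u j * dA i j) + exp a * dA i (m - 1) * t = 0"
      using u(2)[OF i] by (simp add: distrib_left sum.distrib)
    moreover have "(\<Sum>j<m+n. v j * dA i j) = (\<Sum>j<m+n. u j * dA i j + (if j = m - 1 then exp a * t * dA i (m - 1) else 0))"
      by (intro sum.cong) (auto simp: v_def algebra_simps)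
    ultimately show ?thesis using m1 by (simp add: sum.distrib mult_ac)
  qed
  have "\<exists>j<m+n. v j \<noteq> 0"
  proof (rule ccontr)
    assume "\<not> ?thesis"
    then have v0: "v j = 0" if "j < m + n" for j using that by blast
    then have "t = 0" unfolding t_def by (intro sum.neutral) (simp add: vm[symmetric])
    then have "u j = v j" for j by (simp add: v_def)
    then show False using u(1) v0 by auto
  qed
  then have "\<exists>s. \<forall>j<m+n. \<nu> j = s * v j"
  proof (intro annihilator_unique[OF N, of dA])
    fix c i assume "\<And>j. j < m + n \<Longrightarrow> (\<Sum>i<d. c i * dA i j) = 0" "i < d"
    then show "c i = 0" unfolding dA_def by (rule immersed_chart_independent[OF ch1 p1])
  qed (use v \<nu> dA_def in simp_all)
  then obtain s where s: "\<And>j. j < m + n \<Longrightarrow> \<nu> j = s * v j" by blast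
  have "(\<Sum>i<n. \<nu> (m + i) * tr (\<phi>2 p2) i) = s * t"
    unfolding t_def sum_distrib_left by (intro sum.cong) (auto simp: s vm)
  then have "\<nu> j - (if j = m - 1 then exp a * (\<Sum>i<n. \<nu> (m + i) * tr (\<phi>2 p2) i) else 0) = s * u j" if "j < m + n" for j
    using s[OF that] by (auto simp: v_def algebra_simps)
  then have "(\<Sum>j<m+n. ((if j < m then 1 else exp a) *
      (\<nu> j - (if j = m - 1 then exp a * (\<Sum>i<n. \<nu> (m + i) * tr (\<phi>2 p2) i) else 0))) * dB j)
      = (\<Sum>j<m+n. s * (u j * ((if j < m then 1 else exp a) * dB j)))"
    by (intro sum.cong) auto
  also have "\<dots> = 0" using u(3) by (simp flip: sum_distrib_left)
  finally show ?thesis by (simp only: a_def dB_def)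
qed

lemma constant_if_partials_vanish:
  assumes Y: "connected_space Y"
    and charts: "\<And>g. g \<in> topspace Y \<Longrightarrow> \<exists>U W \<phi>. g \<in> U \<and> immersed_chart N x d Y U W \<phi>"
    and der: "\<And>U W \<phi> p i. immersed_chart N x d Y U W \<phi> \<Longrightarrow> p \<in> W \<Longrightarrow> i < d \<Longrightarrow>
      ((\<lambda>t. F (\<phi> (p(i := t)))) has_field_derivative 0) (at (p i))"
    and g: "g \<in> topspace Y" and h: "h \<in> topspace Y"
  shows "F g = (F h :: real)"
proof -
  have loc: "\<exists>V. openin Y V \<and> g \<in> V \<and> (\<forall>h\<in>V. F h = F g)" if g: "g \<in> topspace Y" for g
  proof -
    obtain U W \<phi> where gU: "g \<in> U" and ch: "immersed_chart N x d Y U W \<phi>" using charts[OF g] by blast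
    note into = immersed_chart_into[OF ch]
    have W: "openin (Euclidean_space d) W" and U: "openin Y U"
      and hom: "homeomorphic_map (subtopology (Euclidean_space d) W) (subtopology Y U) \<phi>"
      using ch by (auto simp: immersed_chart_def)
    have "\<phi> ` W = U"
      using homeomorphic_imp_surjective_map[OF hom] into by (simp add: Int_absorb1)
    then obtain p where p: "p \<in> W" "\<phi> p = g" using gU by blast
    then have pt: "p \<in> topspace (Euclidean_space d)" using into(4) by blast
    obtain \<delta> where \<delta>: "\<delta> > 0" "coord_box d p \<delta> \<subseteq> W"
      using eventually_Euclidean_nhds_box[OF eventually_Euclidean_nhds_openin[OF W p(1)] pt] by blast
    have pbox: "p \<in> coord_box d p \<delta>" using pt \<delta>(1) by (simp add: coord_box_def)
    have "F (\<phi> q) = F (\<phi> p)" if q: "q \<in> coord_box d p \<delta>" for q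
    proof -
      have "\<exists>\<xi>. (\<forall>i<d. \<xi> i \<in> coord_box d p \<delta>) \<and> F (\<phi> q) - F (\<phi> p) = (\<Sum>i<d. 0 * (q i - p i))"
        by (rule coordinatewise_mean_value[where f = "\<lambda>q. F (\<phi> q)" and D = "\<lambda>_ _. 0"])
          (use der[OF ch] \<delta>(2) pbox q in auto)
      then show ?thesis by simp
    qed
    moreover have "openin (subtopology (Euclidean_space d) W) (coord_box d p \<delta>)"
      using openin_coord_box \<delta>(2) by (metis openin_subset_topspace_eq openin_subtopology_Int2 inf.absorb_iff2)
    then have "openin (subtopology Y U) (\<phi> ` coord_box d p \<delta>)"
      using homeomorphic_imp_open_map[OF hom] by (simp add: open_map_def)
    then have "openin Y (\<phi> ` coord_box d p \<delta>)" using U openin_trans_full by blast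
    ultimately show ?thesis using pbox p(2) by blast
  qed
  have opn: "openin Y {g' \<in> topspace Y. P (F g')}" for P
  proof (subst openin_subopen, intro ballI)
    fix x assume x: "x \<in> {g' \<in> topspace Y. P (F g')}"
    then obtain V where V: "openin Y V" "x \<in> V" "\<forall>h\<in>V. F h = F x" using loc[of x] by blast
    have "V \<subseteq> {g' \<in> topspace Y. P (F g')}"
    proof
      fix y assume "y \<in> V"
      then have "F y = F x" "y \<in> topspace Y" using V(3) openin_subset[OF V(1)] by blast+
      with x show "y \<in> {g' \<in> topspace Y. P (F g')}" by simp
    qed
    then show "\<exists>V. openin Y V \<and> x \<in> V \<and> V \<subseteq> {g' \<in> topspace Y. P (F g')}" using V by blast
  qed
  have "openin Y {g' \<in> topspace Y. F g' = F h}" by (rule opn[of "\<lambda>r. r = F h"])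
  moreover have "openin Y {g' \<in> topspace Y. F g' \<noteq> F h}" by (rule opn[of "\<lambda>r. r \<noteq> F h"])
  moreover have "topspace Y \<subseteq> {g' \<in> topspace Y. F g' = F h} \<union> {g' \<in> topspace Y. F g' \<noteq> F h}" by blast
  moreover have "{g' \<in> topspace Y. F g' = F h} \<inter> {g' \<in> topspace Y. F g' \<noteq> F h} = {}" by blast
  ultimately have "{g' \<in> topspace Y. F g' = F h} = {} \<or> {g' \<in> topspace Y. F g' \<noteq> F h} = {}"
    using Y unfolding connected_space_def by blast
  then show ?thesis using g h by blast
qed

text \<open>
  Let \<open>\<nu>\<close> annihilate the tangent space at the identity.  Transport with the identity as left factor
  gives an annihilator \<open>\<mu> g\<close> at \<open>g\<close>, and transport of \<open>\<mu> g\<close> back, with the identity as right factor, must give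
  a multiple of \<open>\<nu>\<close>.  If \<open>\<nu>\<close> does not involve the last \<open>n\<close> coordinates, then \<open>\<mu> g = \<nu>\<close>, and the
  linear form \<open>\<nu>\<close> is constant on \<open>L\<close>.  Otherwise the multiple is \<open>e\<^sup>a\<close>, and the equation for the coordinate
  \<open>a\<close> is an affine form that vanishes on \<open>L\<close>.
\<close>

theorem connected_lie_subgroup_in_half_space:
  assumes L: "connected_lie_subgroup (H_group m n) (m + n) (H_coord m) (m + n - 1) L"
    and m: "m \<ge> 1"
  shows "\<exists>F. half_space_form m n F \<and> L \<subseteq> {g \<in> carrier (H_group m n). F g \<ge> 0}"
proof -
  let ?G = "H_group m n"
  define d where "d = m + n - 1"
  have N: "m + n = Suc d" using m by (simp add: d_def)
  have m1: "m - 1 < m + n" using m by simp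
  have sub: "subgroup L ?G" using L by (simp add: connected_lie_subgroup_def)
  have "\<exists>Y. topological_group (?G\<lparr>carrier := L\<rparr>) Y \<and> connected_space Y \<and>
          (\<forall>g\<in>L. \<exists>U W \<phi>. openin Y U \<and> g \<in> U \<and> openin (Euclidean_space d) W \<and>
             homeomorphic_map (subtopology (Euclidean_space d) W) (subtopology Y U) \<phi> \<and>
             smooth_immersion (m + n) (H_coord m) d W \<phi>)"
    using L unfolding connected_lie_subgroup_def d_def by (rule conjunct2)
  then obtain Y where Y: "topological_group (?G\<lparr>carrier := L\<rparr>) Y" "connected_space Y"
    and raw: "\<forall>g\<in>L. \<exists>U W \<phi>. openin Y U \<and> g \<in> U \<and> openin (Euclidean_space d) W \<and>
             homeomorphic_map (subtopology (Euclidean_space d) W) (subtopology Y U) \<phi> \<and>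
             smooth_immersion (m + n) (H_coord m) d W \<phi>"
    by (elim exE conjE)
  have charts: "\<exists>U W \<phi>. g \<in> U \<and> immersed_chart (m + n) (H_coord m) d Y U W \<phi>" if "g \<in> L" for g
    using bspec[OF raw that] unfolding immersed_chart_def by blast
  have top: "topspace Y = L" using Y(1) by (simp add: topological_group_def)
  have car: "L \<subseteq> carrier ?G" using sub by (rule subgroup.subset)
  have one: "\<one>\<^bsub>?G\<^esub> \<in> L" using sub by (rule subgroup.one_closed)
  have point: "\<exists>U W \<phi> p. immersed_chart (m + n) (H_coord m) d Y U W \<phi> \<and> p \<in> W \<and> \<phi> p = g" if g: "g \<in> L" for g
  proof -
    obtain U W \<phi> where gU: "g \<in> U" and ch: "immersed_chart (m + n) (H_coord m) d Y U W \<phi>" using charts[OF g] by blast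
    have "homeomorphic_map (subtopology (Euclidean_space d) W) (subtopology Y U) \<phi>"
      using ch by (simp add: immersed_chart_def)
    from homeomorphic_imp_surjective_map[OF this]
    have "\<phi> ` W = U" using immersed_chart_into[OF ch] by (simp add: Int_absorb1)
    then show ?thesis using ch gU by blast
  qed
  obtain Ue We \<phi>e pe where che: "immersed_chart (m + n) (H_coord m) d Y Ue We \<phi>e" "pe \<in> We"
    and \<phi>e: "\<phi>e pe = \<one>\<^bsub>?G\<^esub>"
    using point[OF one] by blast
  define T where "T i j = partial_deriv i (H_coord m j \<circ> \<phi>e) pe" for i j
  have "\<exists>\<nu>. (\<exists>j<m+n. \<nu> j \<noteq> 0) \<and> (\<forall>i\<in>{..<d}. (\<Sum>j<m+n. \<nu> j * T i j) = 0)"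
    using N by (intro homogeneous_system_solution) auto
  then obtain \<nu> where \<nu>: "\<exists>j<m+n. \<nu> j \<noteq> 0" "\<And>i. i < d \<Longrightarrow> (\<Sum>j<m+n. \<nu> j * T i j) = 0" by auto
  define \<mu> where "\<mu> g j = \<nu> j - (if j = m - 1 then \<Sum>i<n. \<nu> (m + i) * tr g i else 0)" for g j
  have one0: "ht \<one>\<^bsub>?G\<^esub> = 0" "tr \<one>\<^bsub>?G\<^esub> i = 0" for i by (simp_all add: H_one)
  have \<mu>: "(\<Sum>j<m+n. \<mu> (\<phi> p) j * partial_deriv i (H_coord m j \<circ> \<phi>) p) = 0"
    if ch: "immersed_chart (m + n) (H_coord m) d Y U W \<phi>" "p \<in> W" and i: "i < d" for U W \<phi> p i
    using annihilator_transport[OF Y(1) m N charts che ch \<nu>(2)[unfolded T_def] i]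
    by (simp add: \<phi>e one0 \<mu>_def if_distrib[of "\<lambda>x. x * _"] cong: if_cong)
  have proportional: "\<exists>s. \<forall>j<m+n. (if j < m then 1 else exp (ht g)) * \<mu> g j = s * \<nu> j" if g: "g \<in> L" for g
  proof -
    obtain U W \<phi> p where ch: "immersed_chart (m + n) (H_coord m) d Y U W \<phi>" "p \<in> W" and g': "\<phi> p = g"
      using point[OF g] by blast
    have zero: "(\<Sum>j<m+n. ((if j < m then 1 else exp (ht g)) * \<mu> g j) * T i j) = 0" if i: "i < d" for i
      using annihilator_transport[OF Y(1) m N charts ch che \<mu>[OF ch] i]
      unfolding \<phi>e g' one0 by (simp add: T_def cong: if_cong)
    show ?thesis
    proof (rule annihilator_unique[OF N, of T])
      fix c i assume "\<And>j. j < m + n \<Longrightarrow> (\<Sum>i<d. c i * T i j) = 0" "i < d"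
      then show "c i = 0" unfolding T_def by (rule immersed_chart_independent[OF che])
    qed (use \<nu> zero in blast)+
  qed
  show ?thesis
  proof (cases "\<forall>i<n. \<nu> (m + i) = 0")
    case True
    have \<mu>\<nu>: "\<mu> g = \<nu>" for g using True by (auto simp: \<mu>_def)
    have nz: "\<exists>i<m. \<nu> i \<noteq> 0"
    proof -
      obtain j where "j < m + n" "\<nu> j \<noteq> 0" using \<nu>(1) by blast
      moreover have "j < m"
      proof (rule ccontr)
        assume "\<not> j < m"
        then have "j - m < n" "m + (j - m) = j" using \<open>j < m + n\<close> by linarith+
        then show False using True \<open>\<nu> j \<noteq> 0\<close> by metis
      qed
      ultimately show ?thesis by blast
    qed
    have "lin_form m \<nu> g = lin_form m \<nu> \<one>\<^bsub>?G\<^esub>" if g: "g \<in> L" for g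
    proof (rule constant_if_partials_vanish[OF Y(2)])
      fix U W \<phi> p i
      assume ch: "immersed_chart (m + n) (H_coord m) d Y U W \<phi>" and p: "p \<in> W" and i: "i < d"
      have "((\<lambda>t. \<Sum>j<m. \<nu> j * (H_coord m j \<circ> \<phi>) (p(i := t))) has_field_derivative
          (\<Sum>j<m. \<nu> j * partial_deriv i (H_coord m j \<circ> \<phi>) p)) (at (p i))"
        using immersed_chart_coord(2)[OF ch _ p i] by (intro DERIV_sum DERIV_cmult) auto
      moreover have "(\<Sum>j<m. \<nu> j * partial_deriv i (H_coord m j \<circ> \<phi>) p) = 0"
        using \<mu>[OF ch p i] True by (simp add: \<mu>\<nu> sum_lessThan_add)
      ultimately show "((\<lambda>t. lin_form m \<nu> (\<phi> (p(i := t)))) has_field_derivative 0) (at (p i))"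
        by (simp add: lin_form_def)
    qed (use charts g one top in auto)
    then have "L \<subseteq> {g \<in> carrier ?G. lin_form m \<nu> g \<ge> 0}"
      using car by (auto simp: lin_form_def H_coord_one)
    then show ?thesis using nz by (auto simp: half_space_form_def)
  next
    case False
    then obtain i0 where i0: "i0 < n" "\<nu> (m + i0) \<noteq> 0" by blast
    define \<gamma> where "\<gamma> i = \<nu> (m + i)" for i
    have "aff_form n \<gamma> (- \<nu> (m - 1)) g = 0" if g: "g \<in> L" for g
    proof -
      obtain s where s: "\<And>j. j < m + n \<Longrightarrow> (if j < m then 1 else exp (ht g)) * \<mu> g j = s * \<nu> j"
        using proportional[OF g] by blast
      have "m + i0 < m + n" "\<not> m + i0 < m" "m + i0 \<noteq> m - 1" using i0 m by linarith+
      then have "s = exp (ht g)" using s[of "m + i0"] i0 by (simp add: \<mu>_def)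
      then have "\<nu> (m - 1) - (\<Sum>i<n. \<nu> (m + i) * tr g i) = exp (ht g) * \<nu> (m - 1)"
        using s[OF m1] m by (simp add: \<mu>_def)
      then show ?thesis by (simp add: aff_form_def \<gamma>_def algebra_simps)
    qed
    then have "L \<subseteq> {g \<in> carrier ?G. aff_form n \<gamma> (- \<nu> (m - 1)) g \<ge> 0}"
      using car by auto
    moreover have "half_space_form m n (aff_form n \<gamma> (- \<nu> (m - 1)))"
    proof -
      have "\<exists>i<n. \<gamma> i \<noteq> 0" using i0 by (auto simp: \<gamma>_def)
      then show ?thesis unfolding half_space_form_def by blast
    qed
    ultimately show ?thesis by blast
  qed
qed

section \<open>Quasi-dense and nonseparated sets\<close>

theorem corollary2p11:
  fixes m n :: nat and S :: "H_elt set"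
  assumes "m \<ge> 1" and "n \<ge> 1"
    and "S \<subseteq> carrier (H_group m n)"
  shows "multiplicatively_quasi_dense (H_group m n) (H_top m n) (m + n) (H_coord m) S \<longleftrightarrow>
         nonseparated (H_group m n) (H_top m n) S"
proof -
  let ?G = "H_group m n" and ?X = "H_top m n"
  define T where "T = ?X closure_of semigroup_generated ?G S"
  have gen: "subsemigroup (semigroup_generated ?G S) ?G"
    using subsemigroup_generated[OF assms(3) group_H_group] .
  have T: "subsemigroup T ?G" "closedin ?X T"
    unfolding T_def using subsemigroup_closure[OF topological_group_H gen] by auto
  have "semigroup_generated ?G S \<subseteq> T"
    unfolding T_def using gen by (intro closure_of_subset) (auto simp: subsemigroup_def topspace_H_top)
  then have ST: "S \<subseteq> T" by (auto intro: semigroup_generated.incl)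
  have T_min: "T \<subseteq> M" if "S \<subseteq> M" "maximal_subsemigroup ?G ?X M" for M
  proof -
    have "subsemigroup M ?G" using that(2) by (simp add: maximal_subsemigroup_def)
    from semigroup_generated_subset[OF this that(1)] show ?thesis
      unfolding T_def using closedin_maximal_subsemigroup[OF topological_group_H that(2)]
      by (rule closure_of_minimal)
  qed
  have half_space: "\<exists>F. half_space_form m n F \<and> M \<subseteq> {g \<in> carrier ?G. F g \<ge> 0}"
    if "subsemigroup M ?G" "closedin ?X M" "\<not> subgroup M ?G" for M
  proof -
    have "\<not> off_half_spaces m n M" using subgroup_if_off_half_spaces[OF that(1,2) _ assms(1)] that(3) by blast
    then obtain F where "half_space_form m n F" "\<And>g. g \<in> M \<Longrightarrow> F g \<ge> 0"
      unfolding off_half_spaces_def by (meson not_le)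
    then show ?thesis using that(1) by (auto simp: subsemigroup_def)
  qed
  show ?thesis
  proof
    assume mqd: "multiplicatively_quasi_dense ?G ?X (m + n) (H_coord m) S"
    then have group: "subgroup T ?G" by (simp add: multiplicatively_quasi_dense_def T_def)
    show "nonseparated ?G ?X S"
      unfolding nonseparated_def
    proof
      assume "\<exists>M. maximal_subsemigroup ?G ?X M \<and> S \<subseteq> M"
      then obtain M where M: "maximal_subsemigroup ?G ?X M" "S \<subseteq> M" by blast
      have "\<exists>F. half_space_form m n F \<and> M \<subseteq> {g \<in> carrier ?G. F g \<ge> 0}"
        using closedin_maximal_subsemigroup[OF topological_group_H M(1)] M(1)
        by (intro half_space) (auto simp: maximal_subsemigroup_def)
      then obtain F where F: "half_space_form m n F" "M \<subseteq> {g \<in> carrier ?G. F g \<ge> 0}" by blast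
      have "T \<subseteq> {g \<in> carrier ?G. F g = 0}"
        using T_min[OF M(2,1)] F(2) by (intro subgroup_half_space_subset_boundary[OF F(1) group]) blast
      with connected_lie_subgroup_half_space_boundary[OF F(1) assms(1)] mqd show False
        unfolding multiplicatively_quasi_dense_def T_def by blast
    qed
  next
    assume non: "nonseparated ?G ?X S"
    have no_half_space: False if "half_space_form m n F" "T \<subseteq> {g \<in> carrier ?G. F g \<ge> 0}" for F
      using maximal_subsemigroup_half_space[OF that(1)] ST that(2) non
      unfolding nonseparated_def by blast
    have "subgroup T ?G" using half_space[OF T] no_half_space by blast
    moreover have "\<not> (\<exists>L. connected_lie_subgroup ?G (m + n) (H_coord m) (m + n - 1) L \<and> T \<subseteq> L)"
      using connected_lie_subgroup_in_half_space[OF _ assms(1)] no_half_space by (meson subset_trans)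
    ultimately show "multiplicatively_quasi_dense ?G ?X (m + n) (H_coord m) S"
      by (simp add: multiplicatively_quasi_dense_def T_def)
  qed
qed

end
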